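(* Let $\mathfrak{p}=(p_1,\dots,p_m)\in[1,\infty]^m$, not all $p_j$ equal to $1$, and put $r(\mathfrak{p}):=\min\{\max\{2,p_k'\}:1\le k\le m\}\in[2,\infty)$. Let $(\gamma_{\mathfrak{j}})_{\mathfrak{j}\in\mathcal{M}}$, where $\mathcal{M}=\bigcup_{m,n\in\mathbb{N}}\{1,\dots,n\}^m$, be a family of (real or complex) subgaussian random variables with $s=\sup_{\mathfrak{j}}\mathrm{sg}(\gamma_{\mathfrak{j}})<\infty$ and, if $r(\mathfrak{p})>2$, also $M=\sup_{\mathfrak{j}}\|\gamma_{\mathfrak{j}}\|_\infty<\infty$. Then there is a constant $C_{r(\mathfrak{p})}=C(p_1,\dots,p_m)>0$ (depending, besides $p_1,\dots,p_m$, only on $s$, and on $M$ if $r(\mathfrak{p})>2$) such that for all $n_1,\dots,n_m\in\mathbb{N}$ and every $m$-linear random mapping on $\ell_{p_1}^{n_1}\times\cdots\times\ell_{p_m}^{n_m}$ $$L(\omega,z_1,\dots,z_m):=\sum_{\mathfrak{j}=(j_1,\dots,j_m)\in\mathfrak{J}}\gamma_{\mathfrak{j}}(\omega)\,c_{\mathfrak{j}}\,z_1(j_1)\cdots z_m(j_m),\qquad \mathfrak{J}:=\prod_{j=1}^m\{1,\dots,n_j\},$$ with scalar coefficients $c_{\mathfrak{j}}$, we have $$\Big\|\sup_{(z_1,\dots,z_m)\in B_{\ell_{p_1}^{n_1}\times\cdots\times\ell_{p_m}^{n_m}}}|L(\cdot,z_1,\dots,z_m)|\Big\|_{L_{\varphi_{r(\mathfrak{p})}}}\le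 C_{r(\mathfrak{p})}(1+\log m)^{\frac1{r(\mathfrak{p})}}\sup_{\mathfrak{j}\in\mathfrak{J}}|c_{\mathfrak{j}}|\Big(\sum_{j=1}^mn_j\Big)^{\frac1{r(\mathfrak{p})}}\prod_{j=1}^mn_j^{\max\{\frac12-\frac1{p_j},0\}}.$$ In addition, let $m$ be fixed and $n=n_1=\dots=n_m$, and assume that all $\gamma_{\mathfrak{j}}$ are normal Gaussian, Rademacher or Steinhaus variables if $r(\mathfrak{p})=2$, and Rademacher or Steinhaus variables if $r(\mathfrak{p})\in[2,\infty)$ is arbitrary. Then the estimate is optimal in the sense that $$\Big\|\sup_{z_j\in B_{\ell_{p_j}^{n}},\,1\le j\le m}\Big|\sum_{\mathfrak{j}\in\mathfrak{J}}\gamma_{\mathfrak{j}}\,z_1(j_1)\cdots z_m(j_m)\Big|\Big\|_{L_{\varphi_{r(\mathfrak{p})}}}\asymp n^{\frac1{r(\mathfrak{p})}+\sum_{j=1}^m\max\{\frac12-\frac1{p_j},0\}},$$ where the constants depend only on $m$ and the $p_j$'s but not on $n$.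
   Context: A real random variable $f$ is subgaussian if there is $s\ge0$ with $\mathbb{E}\exp(xf)\le\exp(s^2x^2/2)$ for all $x\in\mathbb{R}$; a complex random variable $f$ is subgaussian if there is $s\ge0$ with $\mathbb{E}\exp(\mathrm{Re}(zf))\le\exp(s^2|z|^2/2)$ for all $z\in\mathbb{C}$. The best such $s$ is denoted $\mathrm{sg}(f)$. All random variables live on a probability space $(\Omega,\mathcal{A},\mathbb{P})$. Rademacher variables take values $\pm1$ with probability $1/2$; Steinhaus variables are uniformly distributed on the unit circle. For $1\le r<\infty$ let $\varphi_r(t)=e^{t^r}-1$ and $\|f\|_{L_{\varphi_r}}=\inf\{\varepsilon>0:\int_\Omega\varphi_r(|f|/\varepsilon)\,d\mathbb{P}\le1\}$. $p'$ is the conjugate exponent of $p$ ($1'=\infty$, $\infty'=1$, $1/\infty=0$). $\ell_p^n$ is $\mathbb{K}^n$ with the $\ell_p$-norm ($\mathbb{K}=\mathbb{R}$ or $\mathbb{C}$), $B_X$ is the closed unit ball of $X$, and $B_{X_1\times\cdots\times X_m}=B_{X_1}\times\cdots\times B_{X_m}$.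
   Formalization: The random variables γ_j are assumed independent; without this the claim fails (m=2, p=(2,2), all γ_j equal to one Rademacher variable, c=1). The constants are stated for a fixed underlying set Ω; passing to the joint law of the family makes them uniform. *)

theory Defs
  imports "HOL-Probability.Probability"
begin

section \<open>Subgaussian random variables\<close>

definition real_subgaussian_with :: "'a measure \<Rightarrow> ('a \<Rightarrow> real) \<Rightarrow> real \<Rightarrow> bool" where
  "real_subgaussian_with P f s \<longleftrightarrow> s \<ge> 0 \<and>
     (\<forall>x::real. (\<integral>\<^sup>+\<omega>. ennreal (exp (x * f \<omega>)) \<partial>P) \<le> ennreal (exp (s\<^sup>2 * x\<^sup>2 / 2)))"

definition subgaussian_with :: "'a measure \<Rightarrow> ('a \<Rightarrow> complex) \<Rightarrow> real \<Rightarrow> bool" where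
  "subgaussian_with P f s \<longleftrightarrow> s \<ge> 0 \<and>
     (\<forall>z::complex. (\<integral>\<^sup>+\<omega>. ennreal (exp (Re (z * f \<omega>))) \<partial>P) \<le> ennreal (exp (s\<^sup>2 * (cmod z)\<^sup>2 / 2)))"

text \<open>
  Real random variables are treated as complex ones with real values.  By the following lemma
  the real and the complex notion of subgaussianity then agree, with the same constants.
\<close>

lemma subgaussian_with_of_real:
  "subgaussian_with P (\<lambda>\<omega>. complex_of_real (f \<omega>)) s \<longleftrightarrow> real_subgaussian_with P f s"
proof
  assume L: "subgaussian_with P (\<lambda>\<omega>. complex_of_real (f \<omega>)) s"
  have "(\<integral>\<^sup>+\<omega>. ennreal (exp (x * f \<omega>)) \<partial>P) \<le> ennreal (exp (s\<^sup>2 * x\<^sup>2 / 2))" for x :: real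
    using L[unfolded subgaussian_with_def, THEN conjunct2, rule_format, of "complex_of_real x"]
    by simp
  then show "real_subgaussian_with P f s"
    using L by (simp add: subgaussian_with_def real_subgaussian_with_def)
next
  assume R: "real_subgaussian_with P f s"
  have "(\<integral>\<^sup>+\<omega>. ennreal (exp (Re (z * complex_of_real (f \<omega>)))) \<partial>P)
          \<le> ennreal (exp (s\<^sup>2 * (cmod z)\<^sup>2 / 2))" for z
  proof -
    have "(\<integral>\<^sup>+\<omega>. ennreal (exp (Re (z * complex_of_real (f \<omega>)))) \<partial>P)
            \<le> ennreal (exp (s\<^sup>2 * (Re z)\<^sup>2 / 2))"
      using R by (simp add: real_subgaussian_with_def)
    also have "\<dots> \<le> ennreal (exp (s\<^sup>2 * (cmod z)\<^sup>2 / 2))"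
      by (intro ennreal_leI) (simp add: cmod_power2 mult_left_mono)
    finally show ?thesis .
  qed
  then show "subgaussian_with P (\<lambda>\<omega>. complex_of_real (f \<omega>)) s"
    using R by (simp add: subgaussian_with_def real_subgaussian_with_def)
qed

definition subgaussian :: "'a measure \<Rightarrow> ('a \<Rightarrow> complex) \<Rightarrow> bool" where
  "subgaussian P f \<longleftrightarrow> f \<in> borel_measurable P \<and> (\<exists>s. subgaussian_with P f s)"

definition sg :: "'a measure \<Rightarrow> ('a \<Rightarrow> complex) \<Rightarrow> real" where
  "sg P f = Inf {s. subgaussian_with P f s}"


section \<open>Special distributions\<close>

definition rademacher :: "'a measure \<Rightarrow> ('a \<Rightarrow> complex) \<Rightarrow> bool" where
  "rademacher P f \<longleftrightarrow> f \<in> borel_measurable P \<and>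
     measure P {\<omega> \<in> space P. f \<omega> = 1} = 1 / 2 \<and> measure P {\<omega> \<in> space P. f \<omega> = -1} = 1 / 2"

definition steinhaus :: "'a measure \<Rightarrow> ('a \<Rightarrow> complex) \<Rightarrow> bool" where
  "steinhaus P f \<longleftrightarrow> f \<in> borel_measurable P \<and>
     distr P borel f = distr (uniform_measure lborel {0..<2 * pi}) borel cis"

text \<open>
  A normal Gaussian variable is either a real one, with law \<open>N(0,1)\<close>, or a complex one, with
  density \<open>exp (- |w|^2) / \<pi>\<close>, i.e. distributed like \<open>(g + i h) / sqrt 2\<close> for independent
  real \<open>N(0,1)\<close> variables \<open>g\<close> and \<open>h\<close>.
\<close>

definition normal_gaussian :: "'a measure \<Rightarrow> ('a \<Rightarrow> complex) \<Rightarrow> bool" where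
  "normal_gaussian P f \<longleftrightarrow> f \<in> borel_measurable P \<and>
     (distr P borel f = distr (density lborel std_normal_density) borel complex_of_real \<or>
      distr P borel f = density lborel (\<lambda>w. ennreal (exp (- (cmod w)\<^sup>2) / pi)))"


section \<open>Exponential Orlicz norms\<close>

definition orlicz_fun :: "real \<Rightarrow> real \<Rightarrow> real" where
  "orlicz_fun r t = exp (t powr r) - 1"

text \<open>The infimum is taken in the extended nonnegative reals, so it is \<open>\<infinity>\<close> if no \<open>\<epsilon>\<close> qualifies.\<close>

definition orlicz_norm :: "real \<Rightarrow> 'a measure \<Rightarrow> ('a \<Rightarrow> real) \<Rightarrow> ennreal" where
  "orlicz_norm r P f =
     Inf {ennreal \<epsilon> | \<epsilon>. \<epsilon> > 0 \<and> (\<integral>\<^sup>+\<omega>. ennreal (orlicz_fun r (\<bar>f \<omega>\<bar> / \<epsilon>)) \<partial>P) \<le> 1}"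


section \<open>Exponents and finite-dimensional balls\<close>

definition conj_exponent :: "ereal \<Rightarrow> ereal" where
  "conj_exponent p = (if p = 1 then \<infinity> else if p = \<infinity> then 1 else p / (p - 1))"

definition r_exponent :: "ereal list \<Rightarrow> real" where
  "r_exponent ps = real_of_ereal (Min ((\<lambda>p. max 2 (conj_exponent p)) ` set ps))"

definition dim_exponent :: "ereal \<Rightarrow> real" where
  "dim_exponent p = max (1 / 2 - real_of_ereal (1 / p)) 0"

definition lp_norm :: "ereal \<Rightarrow> nat \<Rightarrow> (nat \<Rightarrow> complex) \<Rightarrow> real" where
  "lp_norm p n z =
     (if p = \<infinity> then Max ((\<lambda>i. cmod (z i)) ` {1..n})
      else (\<Sum>i=1..n. cmod (z i) powr real_of_ereal p) powr (1 / real_of_ereal p))"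

text \<open>
  The scalar field \<open>K\<close> is one of the subsets \<open>\<real>\<close> and \<open>UNIV\<close> of the complex numbers, and
  \<open>K\<^sup>n\<close> consists of the (extensional) functions from \<open>{1..n}\<close> to \<open>K\<close>.
\<close>

definition lp_ball :: "complex set \<Rightarrow> ereal \<Rightarrow> nat \<Rightarrow> (nat \<Rightarrow> complex) set" where
  "lp_ball K p n = {z \<in> {1..n} \<rightarrow>\<^sub>E K. lp_norm p n z \<le> 1}"

definition prod_ball ::
    "complex set \<Rightarrow> ereal list \<Rightarrow> nat list \<Rightarrow> (nat \<Rightarrow> nat \<Rightarrow> complex) set" where
  "prod_ball K ps ns = (\<Pi>\<^sub>E k\<in>{..<length ps}. lp_ball K (ps ! k) (ns ! k))"


section \<open>Multi-indices and random multilinear mappings\<close>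

text \<open>
  A multi-index \<open>(j\<^sub>1, \<dots>, j\<^sub>m)\<close> is a list of length \<open>m\<close> with entries in \<open>{1..}\<close>; its
  positions are numbered from \<open>0\<close>.
\<close>

definition all_multi_indices :: "nat list set" where
  "all_multi_indices = (\<Union>m\<in>{1..}. \<Union>n\<in>{1..}. {js. length js = m \<and> set js \<subseteq> {1..n}})"

definition multi_indices :: "nat list \<Rightarrow> nat list set" where
  "multi_indices ns = {js. length js = length ns \<and> (\<forall>k<length ns. js ! k \<in> {1..ns ! k})}"

definition random_multilinear ::
    "(nat list \<Rightarrow> 'a \<Rightarrow> complex) \<Rightarrow> (nat list \<Rightarrow> complex) \<Rightarrow> nat list \<Rightarrow>
     'a \<Rightarrow> (nat \<Rightarrow> nat \<Rightarrow> complex) \<Rightarrow> complex" where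
  "random_multilinear \<gamma> c ns \<omega> z =
     (\<Sum>js\<in>multi_indices ns. \<gamma> js \<omega> * c js * (\<Prod>k<length ns. z k (js ! k)))"

text \<open>
  The real-valued supremum is over a nonempty set which is bounded above, since all coordinates
  of points in the unit balls have modulus at most \<open>1\<close>.
\<close>

definition sup_multilinear ::
    "complex set \<Rightarrow> ereal list \<Rightarrow> (nat list \<Rightarrow> 'a \<Rightarrow> complex) \<Rightarrow> (nat list \<Rightarrow> complex) \<Rightarrow>
     nat list \<Rightarrow> 'a \<Rightarrow> real" where
  "sup_multilinear K ps \<gamma> c ns \<omega> =
     (SUP z\<in>prod_ball K ps ns. cmod (random_multilinear \<gamma> c ns \<omega> z))"

end

theory Submission
  imports Defs
begin

text \<open>
  Put \<open>q = r / (r - 1) \<in> (1, 2]\<close>. Subgaussianity, together with boundedness if \<open>q < 2\<close>, gives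
  \<open>E exp (Re (w \<gamma>)) \<le> exp (D \<bar>w\<bar>\<^sup>q)\<close>. By independence, \<open>L (\<cdot>, z)\<close> at a fixed point of the balls
  satisfies the same bound with \<open>D\<close> multiplied by the \<open>q\<close>-th power of the \<open>\<ell>\<^sub>q\<close>-norm of its
  coefficients, which yields a \<open>\<phi>\<^sub>r\<close>-moment by Legendre duality. A lattice net with exponentially
  many points in each ball reduces the supremum to a finite maximum; the resulting factor in
  front is exponential in \<open>m\<close>, which is harmless since the constant may depend on \<open>m\<close>.
  For the lower bound, all variables but the one with the largest \<open>p\<^sub>k\<close> are frozen; maximising over
  signs in the remaining one leaves a sum of \<open>n\<close> absolute values, and a Khintchine type
  inequality bounds its expectation.
\<close>

section \<open>Exponential moments and Orlicz norms\<close>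

text \<open>The exponent \<open>q\<close> lets both cases of \<open>r\<close> be treated alike. If r
  = 2, then q = 2 and the inclusion of l_p into l_2 costs n^(max (1/2 - 1/p) 0). If r > 2, then
  every p_k is at most q, the inclusion into l_q has norm 1 and every \<open>dim_exponent\<close>
  vanishes. Boundedness enters only for large \<open>w\<close>, where the quadratic exponent of a
  subgaussian variable exceeds |w|^q and is replaced by the trivial M |w|. The supremum runs over an
  uncountable set, so in both directions it is compared, pointwise in \<omega>, with measurable
  functions of finitely many of the variables. All constants must be fixed before the probability
  space, the variables and the dimensions; hence the analytic lemmas obtain them from
  \<open>r\<close> and a bound \<open>D\<close> alone. The nets live in the complex balls, which
  contain the balls over either field; the moment bounds hold for complex multipliers anyway. The
  two estimates meet because the variable left free in the lower bound satisfies 1 - 1/p = 1/r +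
  \<open>dim_exponent p\<close>.\<close>

text \<open>Discrete form of the Legendre duality between E k^p and t^r, where p = r/(r-1). Only
  natural \<open>k\<close> are allowed, because the moment bound below sums over all
  \<open>k\<close>; rounding costs a term \<open>t\<close>, which is absorbed into t^r at the price
  of the factor \<open>K\<close>.\<close>

lemma exp_powr_le_exp_linear:
  fixes r E :: real
  assumes r: "r \<ge> 2" and E: "E \<ge> 1"
  obtains \<delta> K where "\<delta> > 0" "K > 0"
    "\<And>t::real. t \<ge> 0 \<Longrightarrow> \<exists>k::nat. exp (\<delta> * t powr r) \<le> K * exp (real k * t - E * real k powr (r / (r - 1)))"
proof -
  define p where "p = r / (r - 1)"
  \<comment> \<open>A near-maximiser of k t - E k^p is k = d t^(r-1). This \<open>d\<close> makes E
    d^p = d/2, so half of the gain d t^r survives.\<close>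
  define d where "d = (2 * E) powr (- (r - 1))"
  have d0: "d > 0" using E by (simp add: d_def)
  have p1: "p \<ge> 1" using r by (simp add: p_def field_simps)
  have rp: "(r - 1) * p = r" using r by (simp add: p_def)
  have dp: "E * d powr p = d / 2"
  proof -
    have "d powr p = d * d powr (p - 1)"
      using d0 by (simp add: powr_diff)
    also have "d powr (p - 1) = (2 * E) powr (-1)"
    proof -
      have "- (r - 1) * (p - 1) = -1" using rp by (simp add: algebra_simps)
      then show ?thesis by (simp add: d_def powr_powr)
    qed
    also have "\<dots> = 1 / (2 * E)"
      using E by (simp add: powr_minus_divide)
    finally show ?thesis using E by simp
  qed
  show thesis
  proof (rule that[of "d / 4" "exp (4 / d)"])
    fix t :: real assume t: "t \<ge> 0"
    define k where "k = nat \<lfloor>d * t powr (r - 1)\<rfloor>"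
    have x0: "d * t powr (r - 1) \<ge> 0" using d0 by simp
    have k1: "real k \<le> d * t powr (r - 1)" and k2: "real k \<ge> d * t powr (r - 1) - 1"
      using x0 by (auto simp: k_def)
    have tr: "t powr (r - 1) * t = t powr r"
      using t by (cases "t = 0") (auto simp: powr_diff)
    have "real k * t \<ge> (d * t powr (r - 1) - 1) * t"
      using k2 t by (rule mult_right_mono)
    then have A: "real k * t \<ge> d * t powr r - t"
      by (simp add: algebra_simps flip: tr)
    have "real k powr p \<le> (d * t powr (r - 1)) powr p"
      using k1 p1 by (intro powr_mono2) auto
    also have "\<dots> = d powr p * t powr r"
      using d0 rp by (simp add: powr_mult powr_powr)
    finally have "E * real k powr p \<le> E * (d powr p * t powr r)"
      using E by (intro mult_left_mono) auto
    then have B: "E * real k powr p \<le> d / 2 * t powr r"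
      using dp by (simp flip: mult.assoc)
    \<comment> \<open>Rounding \<open>k\<close> down loses \<open>t\<close>. If t^(r-1) is large, a
      quarter of the gain pays for it; otherwise \<open>t\<close> is bounded by 4/d.\<close>
    have C: "t \<le> d / 4 * t powr r + 4 / d"
    proof (cases "t powr (r - 1) \<ge> 4 / d")
      case True
      then have "t * 1 \<le> t * (d / 4 * t powr (r - 1))"
        using d0 t by (intro mult_left_mono) (auto simp: field_simps)
      then have "t \<le> d / 4 * t powr r"
        by (simp add: algebra_simps flip: tr)
      then show ?thesis using d0 by (smt (verit) divide_pos_pos)
    next
      case False
      have "t \<le> 4 / d"
      proof (cases "t \<ge> 1")
        case True
        then have "t powr 1 \<le> t powr (r - 1)" using r by (intro powr_mono) auto
        then show ?thesis using False True by simp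
      next
        case F: False
        have "d \<le> (2 * E) powr 0" unfolding d_def using r E by (intro powr_mono) auto
        then have "d \<le> 1" using E by simp
        then have "1 \<le> 4 / d" using d0 by (simp add: field_simps)
        then show ?thesis using F by simp
      qed
      moreover have "0 \<le> d / 4 * t powr r" using d0 by simp
      ultimately show ?thesis by linarith
    qed
    have "d / 4 * t powr r \<le> 4 / d + (k * t - E * real k powr p)"
      using A B C by linarith
    then have "exp (d / 4 * t powr r) \<le> exp (4 / d) * exp (real k * t - E * real k powr p)"
      by (simp flip: exp_add)
    then show "\<exists>k::nat. exp (d / 4 * t powr r) \<le> exp (4 / d) * exp (real k * t - E * real k powr (r / (r - 1)))"
      unfolding p_def by blast
  qed (use d0 in auto)
qed

text \<open>The moment hypotheses control only real parts of w X. One of the four quarter turns of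
  \<open>x\<close> has real part max |Re x| |Im x|, so a sum over four directions dominates the
  modulus.\<close>

lemma cmod_le_Re_rotation:
  obtains u where "u \<in> {1, -1, \<i>, -\<i>}" "cmod x \<le> 2 * Re (u * x)"
proof -
  have "cmod x \<le> \<bar>Re x\<bar> + \<bar>Im x\<bar>" by (rule cmod_le)
  then have "cmod x \<le> 2 * Re (1 * x) \<or> cmod x \<le> 2 * Re (-1 * x) \<or>
      cmod x \<le> 2 * Re (\<i> * x) \<or> cmod x \<le> 2 * Re (-\<i> * x)"
    by simp linarith
  then show thesis using that by blast
qed

text \<open>The function exp (\<delta> t^r) is dominated by a series over \<open>k\<close>, for each
  of the four rotations, of exponentials linear in \<open>X\<close>, and the hypothesis bounds their
  integrals. The constants depend on \<open>r\<close> and \<open>D\<close> only.\<close>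

lemma exp_moment_of_mgf_bound:
  fixes r D :: real
  assumes r: "r \<ge> 2" and D: "D \<ge> 0"
  obtains \<delta> K where "\<delta> > 0" "K > 0"
    "\<And>(P :: 'a measure) X \<rho>. X \<in> borel_measurable P \<Longrightarrow> \<rho> > 0 \<Longrightarrow>
      (\<And>w. (\<integral>\<^sup>+\<omega>. ennreal (exp (Re (w * X \<omega>))) \<partial>P)
              \<le> ennreal (exp (D * (cmod w * \<rho>) powr (r / (r - 1))))) \<Longrightarrow>
      (\<integral>\<^sup>+\<omega>. ennreal (exp (\<delta> * (cmod (X \<omega>) / \<rho>) powr r)) \<partial>P) \<le> ennreal K"
proof -
  define p where "p = r / (r - 1)"
  have p1: "p \<ge> 1" using r by (simp add: p_def field_simps)
  \<comment> \<open>Using D + 1 instead of \<open>D\<close> leaves a spare factor exp (- k^p) after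
    the mgf bound, which makes the series over \<open>k\<close> converge.\<close>
  from exp_powr_le_exp_linear[OF r, of "D + 1"] D obtain \<delta> K where \<delta>: "\<delta> > 0" and K: "K > 0" and
    le: "\<And>t::real. t \<ge> 0 \<Longrightarrow> \<exists>k::nat. exp (\<delta> * t powr r) \<le> K * exp (real k * t - (D + 1) * real k powr p)"
    unfolding p_def by (metis add_increasing order_refl)
  define U where "U = {1, -1, \<i>, -\<i>}"
  define S where "S = (\<Sum>k. exp (-1 :: real) ^ k)"
  have sumS: "(\<lambda>k. exp (-1 :: real) ^ k) sums S"
    unfolding S_def by (intro summable_sums summable_geometric) auto
  have S0: "S > 0"
    unfolding S_def using sumS by (intro suminf_pos) (auto simp: sums_iff)
  have finU: "finite U" by (simp add: U_def)
  have U1: "cmod u = 1" if "u \<in> U" for u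
    using that by (auto simp: U_def)
  show thesis
  \<comment> \<open>The factor (1/2)^r undoes the 2 lost in passing from the modulus to a rotated
    real part.\<close>
  proof (rule that[of "\<delta> * (1/2) powr r" "real (card U) * (K * S)"])
    show "\<delta> * (1/2) powr r > 0" using \<delta> by simp
    show "real (card U) * (K * S) > 0" using K S0 finU by (auto simp: card_gt_0_iff U_def)
    fix P :: "'a measure" and X \<rho>
    assume X[measurable]: "X \<in> borel_measurable P" and \<rho>: "(\<rho>::real) > 0"
      and mgf: "\<And>w. (\<integral>\<^sup>+\<omega>. ennreal (exp (Re (w * X \<omega>))) \<partial>P)
              \<le> ennreal (exp (D * (cmod w * \<rho>) powr (r / (r - 1))))"
    define g where "g u k \<omega> = ennreal (K * exp (real k * (Re (u * X \<omega>) / \<rho>) - (D + 1) * real k powr p))"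
      for u and k :: nat and \<omega>
    have gm[measurable]: "g u k \<in> borel_measurable P" for u k
      unfolding g_def by measurable
    have pt: "ennreal (exp (\<delta> * (1/2) powr r * (cmod (X \<omega>) / \<rho>) powr r)) \<le> (\<Sum>u\<in>U. \<Sum>k. g u k \<omega>)" for \<omega>
    proof -
      obtain u where u: "u \<in> U" "cmod (X \<omega>) \<le> 2 * Re (u * X \<omega>)"
        using cmod_le_Re_rotation[of "X \<omega>"] unfolding U_def by metis
      define t where "t = Re (u * X \<omega>) / \<rho>"
      have t0: "t \<ge> 0" unfolding t_def using u(2) \<rho>
        by (smt (verit) divide_nonneg_nonneg norm_ge_zero)
      have "(1/2) powr r * (cmod (X \<omega>) / \<rho>) powr r = (1/2 * (cmod (X \<omega>) / \<rho>)) powr r"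
        using \<rho> by (simp only: powr_mult)
      also have "\<dots> \<le> t powr r"
        unfolding t_def using u(2) \<rho> r by (intro powr_mono2) (auto simp: field_simps)
      finally have "exp (\<delta> * ((1/2) powr r * (cmod (X \<omega>) / \<rho>) powr r)) \<le> exp (\<delta> * t powr r)"
        using \<delta> by simp
      moreover obtain k :: nat where "exp (\<delta> * t powr r) \<le> K * exp (real k * t - (D + 1) * real k powr p)"
        using le[OF t0] by blast
      ultimately have "exp (\<delta> * ((1/2) powr r * (cmod (X \<omega>) / \<rho>) powr r)) \<le> K * exp (real k * t - (D + 1) * real k powr p)"
        by (rule order_trans)
      then have "ennreal (exp (\<delta> * (1/2) powr r * (cmod (X \<omega>) / \<rho>) powr r)) \<le> g u k \<omega>"
        unfolding g_def t_def by (intro ennreal_leI) (simp only: mult.assoc)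
      also have "\<dots> \<le> (\<Sum>k. g u k \<omega>)"
        using sum_le_suminf[of "\<lambda>k. g u k \<omega>" "{k}"] by simp
      also have "\<dots> \<le> (\<Sum>u\<in>U. \<Sum>k. g u k \<omega>)"
        using finU u(1) by (intro member_le_sum) auto
      finally show ?thesis .
    qed
    have gi: "(\<integral>\<^sup>+\<omega>. g u k \<omega> \<partial>P) \<le> ennreal (K * exp (-1) ^ k)" if "u \<in> U" for u k
    proof -
      have "(\<integral>\<^sup>+\<omega>. g u k \<omega> \<partial>P) =
          (\<integral>\<^sup>+\<omega>. ennreal (K * exp (- (D + 1) * real k powr p)) * ennreal (exp (Re (of_real (k / \<rho>) * u * X \<omega>))) \<partial>P)"
      proof (intro nn_integral_cong)
        fix \<omega>
        have "real k * (Re (u * X \<omega>) / \<rho>) = Re (of_real (k / \<rho>) * (u * X \<omega>))"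
          by (simp only: times_complex.sel Re_complex_of_real Im_complex_of_real) simp
        then show "g u k \<omega> = ennreal (K * exp (- (D + 1) * real k powr p)) * ennreal (exp (Re (of_real (k / \<rho>) * u * X \<omega>)))"
          using K by (simp add: g_def exp_diff exp_minus field_simps flip: ennreal_mult exp_add)
      qed
      also have "\<dots> = ennreal (K * exp (- (D + 1) * real k powr p)) * (\<integral>\<^sup>+\<omega>. ennreal (exp (Re (of_real (k / \<rho>) * u * X \<omega>))) \<partial>P)"
        by (rule nn_integral_cmult) measurable
      also have "\<dots> \<le> ennreal (K * exp (- (D + 1) * real k powr p)) * ennreal (exp (D * (cmod (of_real (k / \<rho>) * u) * \<rho>) powr (r / (r - 1))))"
        by (intro mult_left_mono mgf) auto
      also have "cmod (of_real (k / \<rho>) * u) * \<rho> = k"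
        using \<rho> U1[OF that] by (simp add: norm_mult norm_divide)
      also have "ennreal (K * exp (- (D + 1) * real k powr p)) * ennreal (exp (D * real k powr (r / (r - 1))))
          = ennreal (K * exp (- (real k powr p)))"
        using K by (simp add: p_def algebra_simps flip: ennreal_mult exp_add)
      also have "\<dots> \<le> ennreal (K * exp (-1) ^ k)"
      proof -
        have "real k \<le> real k powr p"
          using p1 by (cases "k = 0") (auto intro: order_trans[OF _ powr_mono[of 1 p "real k"]])
        then have "exp (- (real k powr p)) \<le> exp (-1) ^ k"
          by (simp flip: exp_of_nat_mult)
        then show ?thesis using K by (intro ennreal_leI) auto
      qed
      finally show ?thesis .
    qed
    have gs: "(\<integral>\<^sup>+\<omega>. (\<Sum>k. g u k \<omega>) \<partial>P) \<le> ennreal (K * S)" if "u \<in> U" for u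
    proof -
      have "(\<integral>\<^sup>+\<omega>. (\<Sum>k. g u k \<omega>) \<partial>P) = (\<Sum>k. \<integral>\<^sup>+\<omega>. g u k \<omega> \<partial>P)"
        by (rule nn_integral_suminf) simp
      also have "\<dots> \<le> (\<Sum>k. ennreal (K * exp (-1) ^ k))"
        using gi[OF that] by (intro suminf_le) auto
      also have "\<dots> = ennreal (K * S)"
        using K sums_mult[OF sumS, of K] by (intro suminf_ennreal_eq) auto
      finally show ?thesis .
    qed
    have "(\<integral>\<^sup>+\<omega>. ennreal (exp (\<delta> * (1/2) powr r * (cmod (X \<omega>) / \<rho>) powr r)) \<partial>P)
        \<le> (\<integral>\<^sup>+\<omega>. (\<Sum>u\<in>U. \<Sum>k. g u k \<omega>) \<partial>P)"
      by (intro nn_integral_mono pt)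
    also have "\<dots> = (\<Sum>u\<in>U. \<integral>\<^sup>+\<omega>. (\<Sum>k. g u k \<omega>) \<partial>P)"
      by (rule nn_integral_sum) measurable
    also have "\<dots> \<le> (\<Sum>u\<in>U. ennreal (K * S))"
      by (intro sum_mono gs)
    also have "\<dots> = ennreal (real (card U) * (K * S))"
      using K S0 by (simp add: ennreal_mult ennreal_of_nat_eq_real_of_nat)
    finally show "(\<integral>\<^sup>+\<omega>. ennreal (exp (\<delta> * (1/2) powr r * (cmod (X \<omega>) / \<rho>) powr r)) \<partial>P)
        \<le> ennreal (real (card U) * (K * S))" .
  qed
qed

lemma orlicz_norm_le:
  assumes "\<epsilon> > 0" "(\<integral>\<^sup>+\<omega>. ennreal (orlicz_fun r (\<bar>f \<omega>\<bar> / \<epsilon>)) \<partial>P) \<le> 1"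
  shows "orlicz_norm r P f \<le> ennreal \<epsilon>"
  unfolding orlicz_norm_def using assms by (intro Inf_lower) auto

text \<open>
  The convexity bound \<open>exp (\<theta> y) \<le> A\<^sup>\<theta> (1 - \<theta> + \<theta> exp y / A)\<close>, with \<open>\<theta>\<close> chosen such that
  \<open>A\<^sup>\<theta> = 2\<close>, turns the union bound \<open>A = exp (\<kappa> N)\<close> into a loss of \<open>N powr (1 / r)\<close> only.
\<close>
lemma orlicz_norm_le_of_finite_max:
  fixes X :: "'b \<Rightarrow> 'a \<Rightarrow> complex" and N :: real
  assumes r: "r \<ge> 2" and \<delta>: "\<delta> > 0" and \<rho>: "\<rho> > 0" and B: "B > 0" and N: "N \<ge> 1"
    and F: "finite F" "real (card F) * K \<le> exp (\<kappa> * N)" and \<kappa>: "\<kappa> \<ge> 2" and K: "K \<ge> 0"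
    and X[measurable]: "\<And>w. w \<in> F \<Longrightarrow> X w \<in> borel_measurable P"
    and P: "prob_space P"
    and exm: "\<And>w. w \<in> F \<Longrightarrow> (\<integral>\<^sup>+\<omega>. ennreal (exp (\<delta> * (cmod (X w \<omega>) / \<rho>) powr r)) \<partial>P) \<le> ennreal K"
    and f: "\<And>\<omega>. \<omega> \<in> space P \<Longrightarrow> \<exists>w\<in>F. \<bar>f \<omega>\<bar> \<le> B * cmod (X w \<omega>)"
  shows "orlicz_norm r P f \<le> ennreal (B * \<rho> * (\<kappa> / (\<delta> * ln 2)) powr (1 / r) * N powr (1 / r))"
proof -
  interpret prob_space P by fact
  define A where "A = exp (\<kappa> * N)"
  define \<theta> where "\<theta> = ln 2 / (\<kappa> * N)"
  \<comment> \<open>Normalised so that (|f| / \<epsilon>)^r is at most \<theta> times the exponent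
    appearing in \<open>exm\<close>.\<close>
  define \<epsilon> where "\<epsilon> = B * \<rho> * (1 / (\<delta> * \<theta>)) powr (1 / r)"
  have \<kappa>N: "\<kappa> * N \<ge> 2" using \<kappa> N by (smt (verit) mult_le_cancel_left1 mult_mono)
  have A0: "A > 0" by (simp add: A_def)
  have \<theta>0: "\<theta> > 0" using \<kappa>N by (simp add: \<theta>_def)
  \<comment> \<open>The bound 2 \<theta> \<le> 1 keeps 1 - 2 \<theta> nonnegative; this is what
    remains of 2 (1 - \<theta>) after the -1 in \<open>orlicz_fun\<close>. The integral then comes
    out as exactly (1 - 2 \<theta>) + 2 \<theta> = 1.\<close>
  have "ln 2 \<le> (1::real)" using ln_le_minus_one[of "2::real"] by simp
  then have \<theta>1: "2 * \<theta> \<le> 1" using \<kappa>N by (simp add: \<theta>_def field_simps)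
  have \<epsilon>0: "\<epsilon> > 0" using B \<rho> \<delta> \<theta>0 by (simp add: \<epsilon>_def)
  have \<epsilon>r: "(B * \<rho> / \<epsilon>) powr r = \<delta> * \<theta>"
    using B \<rho> \<delta> \<theta>0 r by (simp add: \<epsilon>_def powr_divide powr_powr)
  define G where "G \<omega> = (\<Sum>w\<in>F. exp (\<delta> * (cmod (X w \<omega>) / \<rho>) powr r))" for \<omega>
  have Gm[measurable]: "G \<in> borel_measurable P" unfolding G_def by measurable
  have conv: "exp (\<theta> * y) \<le> 2 * (1 - \<theta> + \<theta> * exp y / A)" for y :: real
  proof -
    have "exp ((1 - \<theta>) * 0 + \<theta> * (y - \<kappa> * N)) \<le> (1 - \<theta>) * exp 0 + \<theta> * exp (y - \<kappa> * N)"
      using convex_onD[OF exp_convex, of \<theta> 0 "y - \<kappa> * N"] \<theta>0 \<theta>1 by simp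
    then have "exp (\<theta> * (y - \<kappa> * N)) \<le> 1 - \<theta> + \<theta> * exp y / A"
      by (simp add: A_def exp_diff)
    moreover have "exp (\<theta> * y) = 2 * exp (\<theta> * (y - \<kappa> * N))"
    proof -
      have "exp (\<theta> * y) = exp (\<theta> * (\<kappa> * N)) * exp (\<theta> * (y - \<kappa> * N))"
        by (simp add: right_diff_distrib flip: exp_add)
      also have "exp (\<theta> * (\<kappa> * N)) = 2"
        using \<kappa>N by (auto simp: \<theta>_def)
      finally show ?thesis .
    qed
    ultimately show ?thesis by (simp only: mult_le_cancel_left_pos zero_less_numeral)
  qed
  have pt: "ennreal (orlicz_fun r (\<bar>f \<omega>\<bar> / \<epsilon>)) \<le> ennreal (1 - 2 * \<theta>) + ennreal (2 * \<theta> / A) * ennreal (G \<omega>)"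
    if om: "\<omega> \<in> space P" for \<omega>
  proof -
    obtain w where w: "w \<in> F" "\<bar>f \<omega>\<bar> \<le> B * cmod (X w \<omega>)" using f[OF om] by blast
    define y where "y = \<delta> * (cmod (X w \<omega>) / \<rho>) powr r"
    have "(\<bar>f \<omega>\<bar> / \<epsilon>) powr r \<le> (B * \<rho> / \<epsilon> * (cmod (X w \<omega>) / \<rho>)) powr r"
      using w(2) \<epsilon>0 \<rho> r by (intro powr_mono2) (auto simp: field_simps)
    also have "\<dots> = \<theta> * y"
      using \<epsilon>0 \<rho> B by (simp only: powr_mult \<epsilon>r y_def) simp
    finally have "exp ((\<bar>f \<omega>\<bar> / \<epsilon>) powr r) \<le> exp (\<theta> * y)" by simp
    also note conv
    also have "2 * (1 - \<theta> + \<theta> * exp y / A) \<le> 2 * (1 - \<theta> + \<theta> * G \<omega> / A)"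
    proof -
      have "exp y \<le> G \<omega>" unfolding G_def y_def using F(1) w(1) by (intro member_le_sum) auto
      then show ?thesis using \<theta>0 A0 by (simp add: divide_right_mono mult_left_mono)
    qed
    finally have "orlicz_fun r (\<bar>f \<omega>\<bar> / \<epsilon>) \<le> (1 - 2 * \<theta>) + (2 * \<theta> / A) * G \<omega>"
      by (simp add: orlicz_fun_def algebra_simps)
    moreover have "G \<omega> \<ge> 0" unfolding G_def by (intro sum_nonneg) auto
    ultimately show ?thesis using \<theta>0 \<theta>1 A0
      by (simp flip: ennreal_mult ennreal_plus)
  qed
  have "(\<integral>\<^sup>+\<omega>. ennreal (G \<omega>) \<partial>P) = (\<Sum>w\<in>F. \<integral>\<^sup>+\<omega>. ennreal (exp (\<delta> * (cmod (X w \<omega>) / \<rho>) powr r)) \<partial>P)"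
    unfolding G_def by (subst nn_integral_sum[symmetric]) (auto simp: sum_ennreal)
  also have "\<dots> \<le> (\<Sum>w\<in>F. ennreal K)" by (intro sum_mono exm)
  also have "\<dots> = ennreal (real (card F) * K)"
    using K by (simp add: ennreal_mult ennreal_of_nat_eq_real_of_nat)
  also have "\<dots> \<le> ennreal A" using F(2) by (intro ennreal_leI) (simp add: A_def)
  finally have GA: "(\<integral>\<^sup>+\<omega>. ennreal (G \<omega>) \<partial>P) \<le> ennreal A" .
  have "(\<integral>\<^sup>+\<omega>. ennreal (orlicz_fun r (\<bar>f \<omega>\<bar> / \<epsilon>)) \<partial>P)
      \<le> (\<integral>\<^sup>+\<omega>. ennreal (1 - 2 * \<theta>) + ennreal (2 * \<theta> / A) * ennreal (G \<omega>) \<partial>P)"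
    by (intro nn_integral_mono pt)
  also have "\<dots> = ennreal (1 - 2 * \<theta>) + ennreal (2 * \<theta> / A) * (\<integral>\<^sup>+\<omega>. ennreal (G \<omega>) \<partial>P)"
    by (subst nn_integral_add) (auto simp: nn_integral_cmult emeasure_space_1)
  also have "\<dots> \<le> ennreal (1 - 2 * \<theta>) + ennreal (2 * \<theta> / A) * ennreal A"
    using GA by (intro add_left_mono mult_left_mono) auto
  also have "\<dots> = 1"
    using \<theta>0 \<theta>1 A0 by (simp flip: ennreal_mult ennreal_plus)
  finally have "orlicz_norm r P f \<le> ennreal \<epsilon>"
    by (rule orlicz_norm_le[OF \<epsilon>0])
  also have "\<epsilon> = B * \<rho> * (\<kappa> / (\<delta> * ln 2)) powr (1 / r) * N powr (1 / r)"
  proof -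
    have "1 / (\<delta> * \<theta>) = \<kappa> / (\<delta> * ln 2) * N" by (simp add: \<theta>_def)
    then show ?thesis using \<kappa> \<delta> N by (simp only: \<epsilon>_def powr_mult mult_ac)
  qed
  finally show ?thesis .
qed

section \<open>Nets in the balls\<close>

lemma ereal_exponent_cases:
  fixes p :: ereal
  assumes "1 \<le> p"
  obtains (infinite) "p = \<infinity>" "real_of_ereal (1 / p) = 0"
    | (finite) q where "p = ereal q" "q \<ge> 1" "real_of_ereal (1 / p) = 1 / q"
proof (cases p)
  case (real q)
  then show ?thesis using assms finite[of q] by (auto simp: one_ereal_def)
qed (use assms infinite in auto)

lemma cmod_le_lp_norm:
  assumes p: "1 \<le> p" and i: "i \<in> {1..n}"
  shows "cmod (z i) \<le> lp_norm p n z"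
  using p
proof (cases rule: ereal_exponent_cases)
  case infinite
  then show ?thesis using i by (auto simp: lp_norm_def intro!: Max_ge)
next
  case (finite q)
  have "cmod (z i) = (cmod (z i) powr q) powr (1 / q)"
    using finite by (simp add: powr_powr)
  also have "\<dots> \<le> (\<Sum>i=1..n. cmod (z i) powr q) powr (1 / q)"
    using finite i by (intro powr_mono2 member_le_sum) auto
  finally show ?thesis using finite by (simp add: lp_norm_def)
qed

lemma lp_norm_mono:
  assumes p: "1 \<le> p" and n: "1 \<le> n" and le: "\<And>i. i \<in> {1..n} \<Longrightarrow> cmod (z i) \<le> cmod (w i)"
  shows "lp_norm p n z \<le> lp_norm p n w"
  using p
proof (cases rule: ereal_exponent_cases)
  case infinite
  have "Max ((\<lambda>i. cmod (z i)) ` {1..n}) \<le> Max ((\<lambda>i. cmod (w i)) ` {1..n})"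
    using n le by (intro Max.boundedI) (auto intro: order_trans[OF le Max_ge])
  then show ?thesis using infinite by (simp add: lp_norm_def)
next
  case (finite q)
  then show ?thesis using le by (auto simp: lp_norm_def intro!: powr_mono2 sum_mono sum_nonneg)
qed

text \<open>The inscribed cube: n coordinates of size n^(-1/p) have norm 1. It fixes the mesh of the
  net and the flat vectors of the lower bound.\<close>

lemma lp_norm_le_of_coordinates:
  assumes p: "1 \<le> p" and n: "1 \<le> n" and c: "c \<ge> 0"
    and le: "\<And>i. i \<in> {1..n} \<Longrightarrow> cmod (z i) \<le> c * real n powr (- real_of_ereal (1 / p))"
  shows "lp_norm p n z \<le> c"
  using p
proof (cases rule: ereal_exponent_cases)
  case infinite
  then show ?thesis using n le by (auto simp: lp_norm_def intro!: Max.boundedI)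
next
  case (finite q)
  have "(\<Sum>i=1..n. cmod (z i) powr q) \<le> (\<Sum>i=1..n. (c * real n powr (- (1 / q))) powr q)"
    using finite le by (intro sum_mono powr_mono2) auto
  also have "(c * real n powr (- (1 / q))) powr q = c powr q * real n powr (-1)"
    using finite by (simp add: powr_mult powr_powr)
  also have "(\<Sum>i=1..n. c powr q * real n powr (-1)) = c powr q"
    using n by (simp add: powr_minus)
  finally have "(\<Sum>i=1..n. cmod (z i) powr q) powr (1 / q) \<le> (c powr q) powr (1 / q)"
    using finite by (intro powr_mono2 sum_nonneg) auto
  then show ?thesis using finite c by (simp add: lp_norm_def powr_powr)
qed

lemma lp_norm_scale:
  assumes p: "1 \<le> p" and n: "1 \<le> n"
  shows "lp_norm p n (\<lambda>i. a * z i) = cmod a * lp_norm p n z"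
  using p
proof (cases rule: ereal_exponent_cases)
  case infinite
  have "Max ((\<lambda>x. cmod a * x) ` (\<lambda>i. cmod (z i)) ` {1..n}) = cmod a * Max ((\<lambda>i. cmod (z i)) ` {1..n})"
    using n by (intro mono_Max_commute[symmetric]) (auto intro!: monoI mult_left_mono)
  then show ?thesis using infinite by (simp add: lp_norm_def norm_mult image_image)
next
  case (finite q)
  then show ?thesis
    by (simp add: lp_norm_def norm_mult powr_mult powr_powr flip: sum_distrib_left)
qed

lemma lp_ball_power_sum_le:
  assumes q: "1 \<le> q" and n: "1 \<le> n" and z: "lp_norm (ereal q) n z \<le> 1"
  shows "(\<Sum>i=1..n. cmod (z i) powr q) \<le> 1"
proof -
  have "((\<Sum>i=1..n. cmod (z i) powr q) powr (1 / q)) powr q \<le> 1 powr q"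
    using q z by (intro powr_mono2) (auto simp: lp_norm_def)
  then show ?thesis using q by (simp add: powr_powr sum_nonneg)
qed

text \<open>Stands in for Hoelder's inequality when l_p sums with different exponents are compared;
  the price is a factor 2.\<close>

lemma powr_le_one_plus_powr:
  assumes "0 \<le> x" "0 \<le> a" "a \<le> b"
  shows "x powr a \<le> 1 + x powr (b::real)"
proof (cases "x \<le> 1")
  case True
  have "x powr a \<le> 1 powr a" using True assms by (intro powr_mono2) auto
  then show ?thesis by (simp add: add_increasing2)
next
  case False
  then have "x powr a \<le> x powr b" using assms by (intro powr_mono) auto
  then show ?thesis by simp
qed

text \<open>Up to the factor 2, this is the norm of the inclusion of l_p into l_1, rescaled so that
  the bound is linear in \<open>n\<close> for every \<open>p\<close>. The linearity is what makes
  the number of lattice points exponential in \<open>n\<close>.\<close>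

lemma lp_ball_sum_le:
  assumes p: "1 \<le> p" and n: "1 \<le> n" and z: "lp_norm p n z \<le> 1"
  shows "(\<Sum>i=1..n. cmod (z i) * real n powr real_of_ereal (1 / p)) \<le> 2 * n"
  using p
proof (cases rule: ereal_exponent_cases)
  case infinite
  have "(\<Sum>i=1..n. cmod (z i) * real n powr real_of_ereal (1 / p)) \<le> (\<Sum>i=1..n. 1)"
    using infinite n cmod_le_lp_norm[OF p, of _ n z] z by (intro sum_mono) (auto intro: order_trans)
  then show ?thesis by simp
next
  case (finite q)
  have "(\<Sum>i=1..n. cmod (z i) * real n powr real_of_ereal (1 / p))
      \<le> (\<Sum>i=1..n. 1 + cmod (z i) powr q * n)"
  proof (intro sum_mono)
    fix i
    have "(cmod (z i) * real n powr (1 / q)) powr 1 \<le> 1 + (cmod (z i) * real n powr (1 / q)) powr q"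
      using finite by (intro powr_le_one_plus_powr) auto
    then show "cmod (z i) * real n powr real_of_ereal (1 / p) \<le> 1 + cmod (z i) powr q * n"
      using finite by (simp add: powr_mult powr_powr)
  qed
  also have "\<dots> = n + (\<Sum>i=1..n. cmod (z i) powr q) * n"
    by (simp add: sum.distrib sum_distrib_right)
  also have "\<dots> \<le> real n + 1 * real n"
    using lp_ball_power_sum_le[of q n z] finite n z by (intro add_left_mono mult_right_mono) auto
  finally show ?thesis by simp
qed

text \<open>If p \<le> q, all coordinates have modulus at most 1 and a larger exponent decreases the
  sum. If q = 2 < p, this is the norm n^(1/2 - 1/p) of the inclusion of l_p into l_2, with a factor
  2 from \<open>powr_le_one_plus_powr\<close>.\<close>

lemma lp_ball_power_sum_le_dim_exponent:
  assumes p: "1 \<le> p" and n: "1 \<le> n" and z: "lp_norm p n z \<le> 1" and q: "1 < q"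
    and pq: "q = 2 \<or> p \<le> ereal q"
  shows "(\<Sum>i=1..n. cmod (z i) powr q) \<le> 2 * (real n powr dim_exponent p) powr q"
proof (cases "p \<le> ereal q")
  case True
  then obtain u where u: "p = ereal u" "u \<ge> 1" "u \<le> q"
    using p by (cases p) auto
  have "(\<Sum>i=1..n. cmod (z i) powr q) \<le> (\<Sum>i=1..n. cmod (z i) powr u)"
  proof (intro sum_mono)
    fix i assume "i \<in> {1..n}"
    then have "cmod (z i) \<le> 1" using cmod_le_lp_norm[OF p, of i n z] z by simp
    then show "cmod (z i) powr q \<le> cmod (z i) powr u" using u by (intro powr_mono') auto
  qed
  also have "\<dots> \<le> 1" using lp_ball_power_sum_le[of u n z] u n z by simp
  also have "1 \<le> (real n powr dim_exponent p) powr q"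
    using n q by (intro ge_one_powr_ge_zero) (auto simp: dim_exponent_def)
  also have "\<dots> \<le> 2 * (real n powr dim_exponent p) powr q" by simp
  finally show ?thesis .
next
  case False
  then have q2: "q = 2" using pq by simp
  show ?thesis using p
  proof (cases rule: ereal_exponent_cases)
    case infinite
    have "cmod (z i) ^ 2 \<le> 1" if "i \<in> {1..n}" for i
      using cmod_le_lp_norm[OF p that, of z] z by (intro power_le_one) auto
    then have "(\<Sum>i=1..n. cmod (z i) ^ 2) \<le> n"
      using sum_bounded_above[of "{1..n}" "\<lambda>i. cmod (z i) ^ 2" 1] by simp
    then show ?thesis using infinite n by (simp add: q2 dim_exponent_def powr_powr)
  next
    case (finite u)
    then have u2: "u > 2" using False q2 by simp
    have "(\<Sum>i=1..n. cmod (z i) powr 2 * n powr (2 / u)) \<le> (\<Sum>i=1..n. 1 + cmod (z i) powr u * n)"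
    proof (intro sum_mono)
      fix i
      have "(cmod (z i) * real n powr (1 / u)) powr 2 \<le> 1 + (cmod (z i) * real n powr (1 / u)) powr u"
        using u2 by (intro powr_le_one_plus_powr) auto
      then show "cmod (z i) powr 2 * n powr (2 / u) \<le> 1 + cmod (z i) powr u * n"
        using u2 by (simp add: powr_mult powr_powr)
    qed
    also have "\<dots> = n + (\<Sum>i=1..n. cmod (z i) powr u) * n"
      by (simp add: sum.distrib sum_distrib_right)
    also have "\<dots> \<le> real n + 1 * real n"
      using lp_ball_power_sum_le[of u n z] finite n z by (intro add_left_mono mult_right_mono) auto
    finally have "(\<Sum>i=1..n. cmod (z i) powr 2) * n powr (2 / u) \<le> 2 * n"
      by (simp only: sum_distrib_right)
    then have "(\<Sum>i=1..n. cmod (z i) powr 2) \<le> 2 * n / n powr (2 / u)"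
      using n by (simp add: pos_le_divide_eq)
    also have "\<dots> = 2 * real n powr (1 - 2 / u)"
      using n by (simp add: powr_diff)
    also have "real n powr (1 - 2 / u) = (real n powr dim_exponent p) powr q"
    proof -
      have "max (1 / 2 - 1 / u) 0 * 2 = 1 - 2 / u" using u2 by (simp add: max_def field_simps)
      then show ?thesis using finite by (simp add: q2 dim_exponent_def powr_powr del: powr_numeral)
    qed
    finally show ?thesis by (simp only: q2)
  qed
qed

lemma sum_two_powr_neg_abs_le:
  "(\<Sum>k\<in>{-int N..int N}. (1/2::real) ^ nat \<bar>k\<bar>) \<le> 3"
proof -
  have "(\<Sum>k\<in>{-int N..int N}. (1/2::real) ^ nat \<bar>k\<bar>) = 3 - 2 * (1/2) ^ N"
  proof (induction N)
    case (Suc N)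
    have "{-int (Suc N)..int (Suc N)} = insert (- int (Suc N)) (insert (int (Suc N)) {-int N..int N})"
      by auto
    moreover have "nat (1 + int N) = Suc N" "nat (int N + 1) = Suc N" by simp_all
    ultimately show ?case using Suc by simp
  qed simp
  then show ?thesis by simp
qed

text \<open>Exponential Markov: each vector counted has weight at least 1 in \<open>\<Sum>\<^sub>a 2\<^bsup>D n - \<Sum>\<bar>a i\<bar>\<^esup>\<close>, which factorises.\<close>
lemma card_integer_l1_ball_le:
  fixes D n :: nat
  defines "Z \<equiv> {a \<in> {1..n} \<rightarrow>\<^sub>E (UNIV :: int set). (\<Sum>i=1..n. \<bar>a i\<bar>) \<le> int (D * n)}"
  shows "finite Z" "card Z \<le> (2 ^ D * 3) ^ n"
proof -
  define Q where "Q = {1..n} \<rightarrow>\<^sub>E {-int (D * n)..int (D * n)}"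
  have ZQ: "Z \<subseteq> Q"
  proof
    fix a assume a: "a \<in> Z"
    have "\<bar>a i\<bar> \<le> int (D * n)" if "i \<in> {1..n}" for i
    proof -
      have "\<bar>a i\<bar> \<le> (\<Sum>i=1..n. \<bar>a i\<bar>)" using that by (intro member_le_sum) auto
      then show ?thesis using a by (simp add: Z_def)
    qed
    then show "a \<in> Q" using a unfolding Z_def Q_def by (auto simp: PiE_iff abs_le_iff) (metis abs_le_iff minus_le_iff)+
  qed
  have finQ: "finite Q" unfolding Q_def by (intro finite_PiE) auto
  show finZ: "finite Z" using ZQ finQ by (rule finite_subset)
  have "real (card Z) = (\<Sum>a\<in>Z. 1)" by simp
  also have "\<dots> \<le> (\<Sum>a\<in>Z. 2 ^ (D * n) * (\<Prod>i=1..n. (1/2) ^ nat \<bar>a i\<bar>))"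
  proof (intro sum_mono)
    fix a assume "a \<in> Z"
    then have "(\<Sum>i=1..n. \<bar>a i\<bar>) \<le> int (D * n)" by (simp add: Z_def)
    moreover have "int (\<Sum>i=1..n. nat \<bar>a i\<bar>) = (\<Sum>i=1..n. \<bar>a i\<bar>)" by simp
    ultimately have "(\<Sum>i=1..n. nat \<bar>a i\<bar>) \<le> D * n" by linarith
    then have "(1/2::real) ^ (D * n) \<le> (1/2) ^ (\<Sum>i=1..n. nat \<bar>a i\<bar>)"
      by (intro power_decreasing) auto
    then have "2 ^ (D * n) * (1/2::real) ^ (D * n) \<le> 2 ^ (D * n) * (1/2) ^ (\<Sum>i=1..n. nat \<bar>a i\<bar>)"
      by (intro mult_left_mono) auto
    then show "1 \<le> 2 ^ (D * n) * (\<Prod>i=1..n. (1/2::real) ^ nat \<bar>a i\<bar>)"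
      by (simp add: power_sum flip: power_mult_distrib)
  qed
  also have "\<dots> \<le> (\<Sum>a\<in>Q. 2 ^ (D * n) * (\<Prod>i=1..n. (1/2) ^ nat \<bar>a i\<bar>))"
    using finQ ZQ by (intro sum_mono2) (auto intro!: prod_nonneg mult_nonneg_nonneg)
  also have "\<dots> = 2 ^ (D * n) * (\<Prod>i=1..n. \<Sum>k\<in>{-int (D * n)..int (D * n)}. (1/2) ^ nat \<bar>k\<bar>)"
    unfolding Q_def by (subst prod_sum_PiE) (auto simp: sum_distrib_left)
  also have "\<dots> \<le> 2 ^ (D * n) * (\<Prod>i=1..n. 3)"
    using sum_two_powr_neg_abs_le[of "D * n"] by (intro mult_left_mono prod_mono) (auto intro!: sum_nonneg)
  also have "\<dots> = real ((2 ^ D * 3) ^ n)"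
    by (simp add: power_mult_distrib power_mult)
  finally show "card Z \<le> (2 ^ D * 3) ^ n" by (simp only: of_nat_le_iff)
qed

lemma round_toward_zero:
  fixes x :: real
  obtains a :: int where "\<bar>of_int a\<bar> \<le> \<bar>x\<bar>" "\<bar>x - of_int a\<bar> \<le> 1"
proof (cases "x \<ge> 0")
  case True
  then have "0 \<le> \<lfloor>x\<rfloor>" "of_int \<lfloor>x\<rfloor> \<le> x" "x < of_int \<lfloor>x\<rfloor> + 1" by simp_all
  then show ?thesis using True by (intro that[of "\<lfloor>x\<rfloor>"]) (simp_all add: abs_le_iff, linarith)
next
  case False
  then have "\<lceil>x\<rceil> \<le> 0" "x \<le> of_int \<lceil>x\<rceil>" "of_int \<lceil>x\<rceil> < x + 1" by (simp_all add: ceiling_le_iff) linarith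
  then show ?thesis using False by (intro that[of "\<lceil>x\<rceil>"]) (simp_all add: abs_le_iff)
qed

text \<open>
  The net consists of the points of the lattice of mesh \<open>n powr (- 1 / p) / 4\<close> in the ball.
  Rounding the coordinates of a point towards zero does not leave the ball.
\<close>
lemma lp_ball_net:
  assumes p: "1 \<le> p" and n: "1 \<le> n"
  obtains F where "finite F" "card F \<le> 1000000 ^ n"
    "\<And>w. w \<in> F \<Longrightarrow> lp_norm p n w \<le> 1"
    "\<And>z. lp_norm p n z \<le> 1 \<Longrightarrow> \<exists>w\<in>F. lp_norm p n (\<lambda>i. z i - w i) \<le> 1 / 2"
proof -
  define e where "e = real_of_ereal (1 / p)"
  define h where "h = real n powr (- e) / 4"
  have h0: "h > 0" using n by (simp add: h_def)
  \<comment> \<open>Dividing by \<open>h\<close> multiplies by 4 n^(1/p), and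
    \<open>lp_ball_sum_le\<close> contributes 2 n: hence 8 n, for real and imaginary parts
    alike.\<close>
  define Z where "Z = {a \<in> {1..n} \<rightarrow>\<^sub>E (UNIV :: int set). (\<Sum>i=1..n. \<bar>a i\<bar>) \<le> int (8 * n)}"
  define v where "v = (\<lambda>(a, b) (i::nat). complex_of_real h * Complex (of_int (a i)) (of_int (b i :: int)))"
  \<comment> \<open>Lattice points outside the ball are discarded, because the moment bounds are
    applied at points of the ball only.\<close>
  define F where "F = v ` (Z \<times> Z) \<inter> {w. lp_norm p n w \<le> 1}"
  have Z: "finite Z" "card Z \<le> (2 ^ 8 * 3) ^ n"
    unfolding Z_def by (rule card_integer_l1_ball_le)+
  show thesis
  proof (rule that[of F])
    show "finite F" using Z by (simp add: F_def)
    have "card F \<le> card (v ` (Z \<times> Z))" unfolding F_def using Z by (intro card_mono) auto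
    also have "\<dots> \<le> card Z * card Z" using card_image_le[of "Z \<times> Z" v] Z by (simp add: card_cartesian_product)
    also have "\<dots> \<le> (2 ^ 8 * 3) ^ n * (2 ^ 8 * 3) ^ n" using Z(2) by (intro mult_mono) auto
    also have "\<dots> = ((2 ^ 8 * 3) * (2 ^ 8 * 3)) ^ n" by (rule power_mult_distrib[symmetric])
    \<comment> \<open>One factor 2^8 * 3 = 768 stems from the real parts and one from the imaginary
      parts; 768^2 = 589824.\<close>
    also have "\<dots> \<le> 1000000 ^ n" by (intro power_mono) auto
    finally show "card F \<le> 1000000 ^ n" .
    show "lp_norm p n w \<le> 1" if "w \<in> F" for w using that by (simp add: F_def)
    fix z assume z: "lp_norm p n z \<le> 1"
    define ro :: "real \<Rightarrow> int" where "ro x = (SOME a. \<bar>of_int a\<bar> \<le> \<bar>x\<bar> \<and> \<bar>x - of_int a\<bar> \<le> 1)" for x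
    have ro: "\<bar>of_int (ro x)\<bar> \<le> \<bar>x\<bar>" "\<bar>x - of_int (ro x)\<bar> \<le> 1" for x
      using someI_ex[of "\<lambda>a. \<bar>of_int a\<bar> \<le> \<bar>x\<bar> \<and> \<bar>x - of_int a\<bar> \<le> 1"] round_toward_zero[of x]
      unfolding ro_def by metis+
    define a where "a = restrict (\<lambda>i. ro (Re (z i) / h)) {1..n}"
    define b where "b = restrict (\<lambda>i. ro (Im (z i) / h)) {1..n}"
    have sum8: "(\<Sum>i=1..n. cmod (z i) / h) \<le> 8 * n"
    proof -
      have "(\<Sum>i=1..n. cmod (z i) / h) = 4 * (\<Sum>i=1..n. cmod (z i) * real n powr e)"
        using n by (simp add: h_def powr_minus sum_distrib_left field_simps)
      also have "\<dots> \<le> 4 * real (2 * n)" using lp_ball_sum_le[OF p n z] unfolding e_def by (intro mult_left_mono) auto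
      finally show ?thesis by simp
    qed
    have inZ: "restrict (\<lambda>i. ro (f (z i) / h)) {1..n} \<in> Z" if f: "\<And>x. \<bar>f x\<bar> \<le> cmod x" for f :: "complex \<Rightarrow> real"
    proof -
      have "(\<Sum>i=1..n. \<bar>real_of_int (ro (f (z i) / h))\<bar>) \<le> (\<Sum>i=1..n. cmod (z i) / h)"
        using h0 f ro(1) by (intro sum_mono) (auto simp: divide_right_mono intro!: order_trans[OF ro(1)])
      then have "(\<Sum>i=1..n. \<bar>real_of_int (ro (f (z i) / h))\<bar>) \<le> 8 * n" using sum8 by linarith
      then have "real_of_int (\<Sum>i=1..n. \<bar>ro (f (z i) / h)\<bar>) \<le> real_of_int (int (8 * n))" by simp
      then have "(\<Sum>i=1..n. \<bar>ro (f (z i) / h)\<bar>) \<le> int (8 * n)" by (simp only: of_int_le_iff)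
      then show ?thesis by (simp add: Z_def)
    qed
    have ab: "a \<in> Z" "b \<in> Z"
      unfolding a_def b_def using inZ[of Re, OF abs_Re_le_cmod] inZ[of Im, OF abs_Im_le_cmod] by simp_all
    define w where "w = v (a, b)"
    have wi: "Re (w i) = h * ro (Re (z i) / h)" "Im (w i) = h * ro (Im (z i) / h)" if "i \<in> {1..n}" for i
      using that by (auto simp: w_def v_def a_def b_def)
    have le1: "\<bar>h * of_int (ro (x / h))\<bar> \<le> \<bar>x\<bar>" and le2: "\<bar>x - h * of_int (ro (x / h))\<bar> \<le> h" for x
    proof -
      show "\<bar>h * of_int (ro (x / h))\<bar> \<le> \<bar>x\<bar>"
        using ro(1)[of "x / h"] h0 by (simp add: abs_mult field_simps)
      have "\<bar>x - h * of_int (ro (x / h))\<bar> = h * \<bar>x / h - of_int (ro (x / h))\<bar>"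
      proof -
        have "h * \<bar>x / h - of_int (ro (x / h))\<bar> = \<bar>h * (x / h - of_int (ro (x / h)))\<bar>"
          using h0 by (simp only: abs_mult abs_of_pos)
        also have "h * (x / h - of_int (ro (x / h))) = x - h * of_int (ro (x / h))"
          using h0 by (simp add: right_diff_distrib)
        finally show ?thesis ..
      qed
      also have "\<dots> \<le> h * 1" using ro(2) h0 by (intro mult_left_mono) auto
      finally show "\<bar>x - h * of_int (ro (x / h))\<bar> \<le> h" by simp
    qed
    have "lp_norm p n w \<le> lp_norm p n z"
    proof (rule lp_norm_mono[OF p n])
      fix i assume i: "i \<in> {1..n}"
      show "cmod (w i) \<le> cmod (z i)"
        unfolding cmod_def using wi[OF i] le1
        by (intro real_sqrt_le_mono add_mono) (simp_all add: abs_le_square_iff[symmetric])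
    qed
    then have "w \<in> F" using z ab by (auto simp: F_def w_def)
    \<comment> \<open>Each coordinate is off by at most 2 h, which is half of the inscribed cube's
      n^(-1/p).\<close>
    moreover have "lp_norm p n (\<lambda>i. z i - w i) \<le> 1 / 2"
    proof (rule lp_norm_le_of_coordinates[OF p n])
      fix i assume i: "i \<in> {1..n}"
      have "cmod (z i - w i) \<le> \<bar>Re (z i - w i)\<bar> + \<bar>Im (z i - w i)\<bar>" by (rule cmod_le)
      also have "\<dots> \<le> h + h" using wi[OF i] le2 by (intro add_mono) auto
      finally show "cmod (z i - w i) \<le> 1 / 2 * real n powr - real_of_ereal (1 / p)"
        by (simp add: h_def e_def)
    qed simp
    ultimately show "\<exists>w\<in>F. lp_norm p n (\<lambda>i. z i - w i) \<le> 1 / 2" by blast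
  qed
qed

text \<open>Let S be the supremum over the ball and M the maximum over \<open>F\<close>. Splitting y
  = w + (y - w) and scaling y - w by 2 back into the ball gives S \<le> M + S/2. The sum over
  \<open>J\<close> with a coordinate map \<open>\<kappa>\<close> lets a multi-index sum serve as a
  linear form in one variable without collecting terms.\<close>

lemma linear_form_le_twice_net:
  fixes b :: "'j \<Rightarrow> complex"
  assumes p: "1 \<le> p" and n: "1 \<le> n" and F: "finite F" "\<And>w. w \<in> F \<Longrightarrow> lp_norm p n w \<le> 1"
    and net: "\<And>z. lp_norm p n z \<le> 1 \<Longrightarrow> \<exists>w\<in>F. lp_norm p n (\<lambda>i. z i - w i) \<le> 1 / 2"
    and J: "\<And>j. j \<in> J \<Longrightarrow> \<kappa> j \<in> {1..n}" and x: "lp_norm p n x \<le> 1"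
  shows "\<exists>w\<in>F. cmod (\<Sum>j\<in>J. b j * x (\<kappa> j)) \<le> 2 * cmod (\<Sum>j\<in>J. b j * w (\<kappa> j))"
proof -
  define T where "T x = (\<Sum>j\<in>J. b j * x (\<kappa> j))" for x
  define U where "U = {x. lp_norm p n x \<le> 1}"
  have xU: "x \<in> U" using x by (simp add: U_def)
  have FU: "F \<subseteq> U" using F by (auto simp: U_def)
  have bdd: "bdd_above ((\<lambda>x. cmod (T x)) ` U)"
  proof (rule bdd_aboveI2)
    fix y assume "y \<in> U"
    then have y: "cmod (y i) \<le> 1" if "i \<in> {1..n}" for i
      using cmod_le_lp_norm[OF p that, of y] by (simp add: U_def)
    have "cmod (T y) \<le> (\<Sum>j\<in>J. cmod (b j * y (\<kappa> j)))" unfolding T_def by (rule norm_sum)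
    also have "\<dots> \<le> (\<Sum>j\<in>J. cmod (b j))"
      using y J by (intro sum_mono) (auto simp: norm_mult mult_left_le)
    finally show "cmod (T y) \<le> (\<Sum>j\<in>J. cmod (b j))" .
  qed
  define S where "S = (SUP y\<in>U. cmod (T y))"
  have leS: "cmod (T y) \<le> S" if "y \<in> U" for y
    unfolding S_def using bdd that by (rule cSUP_upper2) simp
  define M where "M = Max ((\<lambda>w. cmod (T w)) ` F)"
  have Fne: "F \<noteq> {}" using net[OF x] by auto
  have "cmod (T y) \<le> M + S / 2" if "y \<in> U" for y
  proof -
    obtain w where w: "w \<in> F" "lp_norm p n (\<lambda>i. y i - w i) \<le> 1 / 2"
      using net \<open>y \<in> U\<close> by (auto simp: U_def)
    have "(\<lambda>i. 2 * (y i - w i)) \<in> U"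
      using w(2) lp_norm_scale[OF p n, of 2 "\<lambda>i. y i - w i"] by (simp only: U_def mem_Collect_eq) simp
    then have "cmod (T (\<lambda>i. 2 * (y i - w i))) \<le> S" by (rule leS)
    moreover have "T (\<lambda>i. 2 * (y i - w i)) = 2 * (T y - T w)"
      by (simp add: T_def sum_subtractf sum_distrib_left algebra_simps)
    ultimately have "cmod (T y - T w) \<le> S / 2" by (simp only: norm_mult) simp
    moreover have "cmod (T w) \<le> M" unfolding M_def using F(1) w(1) by (intro Max_ge) auto
    moreover have "cmod (T y) \<le> cmod (T w) + cmod (T y - T w)"
      by (metis add_diff_cancel_left' add_diff_eq norm_triangle_ineq)
    ultimately show ?thesis by linarith
  qed
  then have "S \<le> M + S / 2" unfolding S_def using xU by (intro cSUP_least) auto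
  then have "cmod (T x) \<le> 2 * M" using leS[OF xU] by linarith
  moreover have "M \<in> (\<lambda>w. cmod (T w)) ` F" unfolding M_def using F(1) Fne by (intro Max_in) auto
  ultimately show ?thesis unfolding T_def by blast
qed

section \<open>Multi-index sums and the replacement of variables by net points\<close>

lemma random_multilinear_fun_upd:
  assumes "k < length ns"
  shows "random_multilinear \<gamma> c ns \<omega> (z(k := x)) =
    (\<Sum>js\<in>multi_indices ns. (\<gamma> js \<omega> * c js * (\<Prod>l\<in>{..<length ns} - {k}. z l (js ! l))) * x (js ! k))"
  unfolding random_multilinear_def
proof (intro sum.cong refl)
  fix js
  have "(\<Prod>l<length ns. (z(k := x)) l (js ! l)) = x (js ! k) * (\<Prod>l\<in>{..<length ns} - {k}. z l (js ! l))"
    using assms by (subst prod.remove[of _ k]) (auto intro!: prod.cong)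
  then show "\<gamma> js \<omega> * c js * (\<Prod>l<length ns. (z(k := x)) l (js ! l)) =
      \<gamma> js \<omega> * c js * (\<Prod>l\<in>{..<length ns} - {k}. z l (js ! l)) * x (js ! k)"
    by (simp add: mult_ac)
qed

lemma random_multilinear_cong:
  assumes "\<And>k. k < length ns \<Longrightarrow> z k = w k"
  shows "random_multilinear \<gamma> c ns \<omega> z = random_multilinear \<gamma> c ns \<omega> w"
  unfolding random_multilinear_def using assms by (intro sum.cong refl arg_cong2[where f = "(*)"] prod.cong) auto

text \<open>With the other variables frozen the form is linear in one slot, so each replacement by a
  net point costs a factor 2. The net point may depend on \<omega>.\<close>

lemma random_multilinear_le_net:
  assumes len: "length ns = length ps" and p: "\<And>k. k < length ps \<Longrightarrow> 1 \<le> ps ! k"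
    and n: "\<And>k. k < length ps \<Longrightarrow> 1 \<le> ns ! k"
    and F: "\<And>k. k < length ps \<Longrightarrow> finite (F k)"
      "\<And>k w. k < length ps \<Longrightarrow> w \<in> F k \<Longrightarrow> lp_norm (ps ! k) (ns ! k) w \<le> 1"
      "\<And>k z. k < length ps \<Longrightarrow> lp_norm (ps ! k) (ns ! k) z \<le> 1 \<Longrightarrow>
         \<exists>w\<in>F k. lp_norm (ps ! k) (ns ! k) (\<lambda>i. z i - w i) \<le> 1 / 2"
    and z: "\<And>k. k < length ps \<Longrightarrow> lp_norm (ps ! k) (ns ! k) (z k) \<le> 1"
  shows "\<exists>w\<in>PiE {..<length ps} F. cmod (random_multilinear \<gamma> c ns \<omega> z)
           \<le> 2 ^ length ps * cmod (random_multilinear \<gamma> c ns \<omega> w)"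
proof -
  let ?L = "\<lambda>z. cmod (random_multilinear \<gamma> c ns \<omega> z)"
  \<comment> \<open>Invariant: the slots below \<open>k\<close> already lie in their nets, the
    remaining ones still agree with \<open>z\<close>.\<close>
  have "\<exists>w. (\<forall>l<k. w l \<in> F l) \<and> (\<forall>l\<ge>k. w l = z l) \<and> ?L z \<le> 2 ^ k * ?L w" if "k \<le> length ps" for k
    using that
  proof (induction k)
    case (Suc k)
    then obtain w where w: "\<forall>l<k. w l \<in> F l" "\<forall>l\<ge>k. w l = z l" "?L z \<le> 2 ^ k * ?L w" by auto
    have k: "k < length ps" "k < length ns" using Suc len by auto
    have "\<exists>x\<in>F k. ?L (w(k := w k)) \<le> 2 * ?L (w(k := x))"
      unfolding random_multilinear_fun_upd[OF k(2)]
    proof (rule linear_form_le_twice_net[OF p[OF k(1)] n[OF k(1)] F(1)[OF k(1)] F(2)[OF k(1)] F(3)[OF k(1)]])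
      show "js ! k \<in> {1..ns ! k}" if "js \<in> multi_indices ns" for js
        using that k by (simp add: multi_indices_def)
      show "lp_norm (ps ! k) (ns ! k) (w k) \<le> 1" using z[OF k(1)] w(2) by simp
    qed auto
    then obtain x where x: "x \<in> F k" "?L w \<le> 2 * ?L (w(k := x))" by auto
    show ?case
    proof (intro exI[of _ "w(k := x)"] conjI)
      have "2 ^ k * ?L w \<le> 2 ^ k * (2 * ?L (w(k := x)))" using x by (intro mult_left_mono) auto
      then have "?L z \<le> 2 ^ k * (2 * ?L (w(k := x)))" using w(3) by (rule order_trans[rotated])
      then show "?L z \<le> 2 ^ Suc k * ?L (w(k := x))" by (simp only: power_Suc mult_ac)
    qed (use w x in \<open>auto simp: less_Suc_eq\<close>)
  qed auto
  from this[of "length ps"] obtain w where w: "\<forall>l<length ps. w l \<in> F l" "?L z \<le> 2 ^ length ps * ?L w"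
    by auto
  have "random_multilinear \<gamma> c ns \<omega> (restrict w {..<length ps}) = random_multilinear \<gamma> c ns \<omega> w"
    by (rule random_multilinear_cong) (simp add: len)
  then show ?thesis using w by (intro bexI[of _ "restrict w {..<length ps}"]) auto
qed

text \<open>Distributivity, with lists read as functions on positions. It separates the variables in
  the l_q sums of the upper bound and in the l_2 sums of the lower bound.\<close>

lemma sum_multi_indices_prod:
  fixes f :: "nat \<Rightarrow> nat \<Rightarrow> 'b::comm_semiring_1"
  shows "(\<Sum>js\<in>multi_indices ns. \<Prod>k<length ns. f k (js ! k)) = (\<Prod>k<length ns. \<Sum>i=1..ns ! k. f k i)"
proof -
  have "(\<Prod>k<length ns. \<Sum>i=1..ns ! k. f k i) = (\<Sum>g\<in>PiE {..<length ns} (\<lambda>k. {1..ns ! k}). \<Prod>k<length ns. f k (g k))"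
    by (rule prod_sum_PiE) auto
  also have "\<dots> = (\<Sum>js\<in>multi_indices ns. \<Prod>k<length ns. f k (js ! k))"
  proof (rule sum.reindex_bij_witness[of _ "\<lambda>js. restrict (\<lambda>k. js ! k) {..<length ns}" "\<lambda>g. map g [0..<length ns]"])
    fix js assume js: "js \<in> multi_indices ns"
    show "map (restrict (\<lambda>k. js ! k) {..<length ns}) [0..<length ns] = js"
      using js by (intro nth_equalityI) (auto simp: multi_indices_def)
    show "restrict ((!) js) {..<length ns} \<in> PiE {..<length ns} (\<lambda>k. {1..ns ! k})"
      using js by (auto simp: multi_indices_def)
  next
    fix g assume g: "g \<in> PiE {..<length ns} (\<lambda>k. {1..ns ! k})"
    show "restrict ((!) (map g [0..<length ns])) {..<length ns} = g"
      using g by (intro ext) (auto simp: PiE_def extensional_def)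
    show "map g [0..<length ns] \<in> multi_indices ns"
      using g by (auto simp: multi_indices_def PiE_def Pi_def)
  qed auto
  finally show ?thesis ..
qed

lemma finite_multi_indices [simp]: "finite (multi_indices ns)"
proof (rule finite_subset)
  show "multi_indices ns \<subseteq> {js. set js \<subseteq> {1..Max (set ns)} \<and> length js = length ns}"
  proof
    fix js assume js: "js \<in> multi_indices ns"
    have "x \<in> {1..Max (set ns)}" if "x \<in> set js" for x
    proof -
      obtain k where k: "k < length js" "x = js ! k" using \<open>x \<in> set js\<close> by (metis in_set_conv_nth)
      then have "x \<in> {1..ns ! k}" "ns ! k \<le> Max (set ns)"
        using js by (auto simp: multi_indices_def)
      then show ?thesis by auto
    qed
    then show "js \<in> {js. set js \<subseteq> {1..Max (set ns)} \<and> length js = length ns}"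
      using js by (auto simp: multi_indices_def)
  qed
qed (rule finite_lists_length_eq, simp)

lemma multi_indices_subset:
  assumes "ns \<noteq> []" "\<forall>n\<in>set ns. 1 \<le> n"
  shows "multi_indices ns \<subseteq> all_multi_indices"
proof
  fix js assume js: "js \<in> multi_indices ns"
  have "set js \<subseteq> {1..Max (set ns)}"
  proof
    fix x assume "x \<in> set js"
    then obtain k where k: "k < length js" "x = js ! k" by (metis in_set_conv_nth)
    then have "x \<in> {1..ns ! k}" "ns ! k \<le> Max (set ns)"
      using js by (auto simp: multi_indices_def)
    then show "x \<in> {1..Max (set ns)}" by auto
  qed
  moreover have "Max (set ns) \<ge> 1" using assms Max_in[of "set ns"] by auto
  moreover have "length js \<ge> 1" using js assms by (auto simp: multi_indices_def Suc_le_eq)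
  ultimately show "js \<in> all_multi_indices" unfolding all_multi_indices_def by auto
qed

section \<open>The upper estimate\<close>

text \<open>The facts about \<open>r\<close> on which both estimates rest. If r > 2, minimality
  forces r \<le> p' for every p, hence p \<le> r' = r/(r-1). The last claim is met by a p attaining
  the minimum: if p \<ge> 2, then r = 2 and both sides equal 1 - 1/p; if p < 2, then r = p' and
  \<open>dim_exponent p\<close> is 0.\<close>

lemma r_exponent_properties:
  assumes ne: "ps \<noteq> []" and p1: "\<forall>p\<in>set ps. 1 \<le> p" and ex: "\<exists>p\<in>set ps. p \<noteq> 1"
  defines "r \<equiv> r_exponent ps"
  shows "2 \<le> r"
    and "\<And>p. p \<in> set ps \<Longrightarrow> r / (r - 1) = 2 \<or> p \<le> ereal (r / (r - 1))"
    and "\<exists>p\<in>set ps. 1 - real_of_ereal (1 / p) = 1 / r + dim_exponent p"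
proof -
  define f where "f = (\<lambda>p. max 2 (conj_exponent p))"
  have conj: "conj_exponent (ereal u) = ereal (u / (u - 1))" if "u > 1" for u
    using that by (simp add: conj_exponent_def one_ereal_def)
  have mr: "Min (f ` set ps) \<in> f ` set ps" using ne by (intro Min_in) auto
  obtain p' where p': "p' \<in> set ps" "p' \<noteq> 1" using ex by blast
  then have p'1: "1 \<le> p'" using p1 by blast
  \<comment> \<open>An exponent other than 1 has a finite conjugate, so the minimum is a real number
    and \<open>real_of_ereal\<close> loses nothing.\<close>
  have "f p' \<noteq> \<infinity>"
    using p'1
  proof (cases rule: ereal_exponent_cases)
    case infinite
    then show ?thesis by (simp add: f_def conj_exponent_def one_ereal_def)
  next
    case (finite q)
    then have "q > 1" using p' by (auto simp: one_ereal_def)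
    then show ?thesis using finite conj by (simp add: f_def max_def)
  qed
  moreover have "Min (f ` set ps) \<le> f p'" using p' by (intro Min_le) auto
  moreover have "2 \<le> Min (f ` set ps)" using mr by (auto simp: f_def)
  ultimately have Mr: "Min (f ` set ps) = ereal r" and r2: "2 \<le> r"
    unfolding r_def r_exponent_def f_def
    by (cases "Min ((\<lambda>p. max 2 (conj_exponent p)) ` set ps)"; force)+
  show "2 \<le> r" by (rule r2)
  show "r / (r - 1) = 2 \<or> p \<le> ereal (r / (r - 1))" if p: "p \<in> set ps" for p
  proof (cases "r = 2")
    case False
    then have r: "r > 2" using r2 by simp
    have fp: "ereal r \<le> f p" using p by (simp flip: Mr)
    have "1 \<le> p" using p p1 by blast
    then have "p \<le> ereal (r / (r - 1))"
    proof (cases rule: ereal_exponent_cases)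
      case infinite
      then show ?thesis using fp r by (simp add: f_def conj_exponent_def one_ereal_def)
    next
      case (finite q)
      show ?thesis
      proof (cases "q = 1")
        case True
        then show ?thesis using finite r by (simp add: field_simps)
      next
        case False
        then have q: "q > 1" using finite by simp
        then have "r \<le> max 2 (q / (q - 1))"
          using fp finite conj[OF q] by (simp add: f_def max_def split: if_splits)
        then have "r \<le> q / (q - 1)" using r by (auto simp: max_def split: if_splits)
        then show ?thesis using finite q r by (simp add: field_simps)
      qed
    qed
    then show ?thesis ..
  qed simp
  obtain p where p: "p \<in> set ps" "f p = ereal r" using mr Mr by auto
  have "1 \<le> p" using p p1 by blast
  then have "1 - real_of_ereal (1 / p) = 1 / r + dim_exponent p"
  proof (cases rule: ereal_exponent_cases)
    case infinite
    then have "r = 2" using p by (simp add: f_def conj_exponent_def one_ereal_def)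
    then show ?thesis using infinite by (simp add: dim_exponent_def)
  next
    case (finite q)
    have "q \<noteq> 1" using p finite by (auto simp: f_def conj_exponent_def one_ereal_def)
    then have q: "q > 1" using finite by simp
    have r: "r = max 2 (q / (q - 1))" using p(2) finite conj[OF q] by (simp add: f_def max_def split: if_splits)
    show ?thesis
    proof (cases "q \<ge> 2")
      case True
      then have "r = 2" using r q by (simp add: field_simps)
      moreover have "max (1 / 2 - 1 / q) 0 = 1 / 2 - 1 / q" using True by (simp add: field_simps max_def)
      ultimately show ?thesis using finite by (simp add: dim_exponent_def)
    next
      case False
      then have "r = q / (q - 1)" using r q by (simp add: max_def field_simps)
      then have "1 / r = 1 - 1 / q" using q by (simp add: diff_divide_distrib)
      moreover have "max (1 / 2 - 1 / q) 0 = 0" using False q by (simp add: field_simps max_def)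
      ultimately show ?thesis using finite by (simp add: dim_exponent_def)
    qed
  qed
  then show "\<exists>p\<in>set ps. 1 - real_of_ereal (1 / p) = 1 / r + dim_exponent p" using p by blast
qed

section \<open>Moment generating functions of the random form and the union over the nets\<close>

text \<open>Independence factorises the expectation of the product of exponentials, so the exponents
  D |w a_j|^p simply add up.\<close>

lemma (in prob_space) mgf_indep_sum_le:
  fixes \<gamma> :: "'b \<Rightarrow> 'a \<Rightarrow> complex"
  assumes J: "finite J" and ind: "indep_vars (\<lambda>_. borel) \<gamma> J"
    and mgf: "\<And>j w. j \<in> J \<Longrightarrow> (\<integral>\<^sup>+\<omega>. ennreal (exp (Re (w * \<gamma> j \<omega>))) \<partial>M) \<le> ennreal (exp (D * cmod w powr p))"
  shows "(\<integral>\<^sup>+\<omega>. ennreal (exp (Re (w * (\<Sum>j\<in>J. \<gamma> j \<omega> * a j)))) \<partial>M)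
    \<le> ennreal (exp (D * cmod w powr p * (\<Sum>j\<in>J. cmod (a j) powr p)))"
proof -
  have "(\<integral>\<^sup>+\<omega>. ennreal (exp (Re (w * (\<Sum>j\<in>J. \<gamma> j \<omega> * a j)))) \<partial>M)
      = (\<integral>\<^sup>+\<omega>. (\<Prod>j\<in>J. ennreal (exp (Re ((w * a j) * \<gamma> j \<omega>)))) \<partial>M)"
    using J by (simp add: sum_distrib_left exp_sum prod_ennreal mult_ac Re_sum del: times_complex.sel)
  also have "\<dots> = (\<Prod>j\<in>J. \<integral>\<^sup>+\<omega>. ennreal (exp (Re ((w * a j) * \<gamma> j \<omega>))) \<partial>M)"
    by (intro indep_vars_nn_integral J indep_vars_compose2[OF ind, where Y = "\<lambda>j x. ennreal (exp (Re ((w * a j) * x)))"]) auto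
  also have "\<dots> \<le> (\<Prod>j\<in>J. ennreal (exp (D * cmod (w * a j) powr p)))"
    by (intro prod_mono_ennreal mgf)
  also have "\<dots> = ennreal (exp (D * cmod w powr p * (\<Sum>j\<in>J. cmod (a j) powr p)))"
    using J by (simp add: prod_ennreal norm_mult powr_mult mult.assoc flip: exp_sum sum_distrib_left)
  finally show ?thesis .
qed

lemma indep_vars_measurable:
  assumes "prob_space P" "prob_space.indep_vars P (\<lambda>_. borel) \<gamma> J" "j \<in> J"
  shows "\<gamma> j \<in> borel_measurable P"
  using assms by (simp add: prob_space.indep_vars_def)

text \<open>At a fixed point the coefficient of \<gamma>_j is c_j times a product over the
  variables, so the sum of q-th powers factorises into one sum per variable. Each of these is at
  most 2 (n_k^dim)^q, whence the factor \<open>2 ^ length ps\<close>.\<close>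

lemma mgf_random_multilinear_le:
  fixes \<gamma> :: "nat list \<Rightarrow> 'a \<Rightarrow> complex"
  assumes P: "prob_space P" and ind: "prob_space.indep_vars P (\<lambda>_. borel) \<gamma> (multi_indices ns)"
    and mgf: "\<And>j w. j \<in> multi_indices ns \<Longrightarrow>
      (\<integral>\<^sup>+\<omega>. ennreal (exp (Re (w * \<gamma> j \<omega>))) \<partial>P) \<le> ennreal (exp (D * cmod w powr q))"
    and len: "length ns = length ps" and D: "D \<ge> 0" and R: "R > 0" and q: "1 < q"
    and p: "\<And>k. k < length ps \<Longrightarrow> 1 \<le> ps ! k" "\<And>k. k < length ps \<Longrightarrow> q = 2 \<or> ps ! k \<le> ereal q"
    and n: "\<And>k. k < length ps \<Longrightarrow> 1 \<le> ns ! k"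
    and c: "\<And>j. j \<in> multi_indices ns \<Longrightarrow> cmod (c j) \<le> R"
    and w: "\<And>k. k < length ps \<Longrightarrow> lp_norm (ps ! k) (ns ! k) (w k) \<le> 1"
  shows "(\<integral>\<^sup>+\<omega>. ennreal (exp (Re (z * random_multilinear \<gamma> c ns \<omega> w))) \<partial>P)
    \<le> ennreal (exp (D * 2 ^ length ps *
        (cmod z * (R * (\<Prod>k<length ps. real (ns ! k) powr dim_exponent (ps ! k)))) powr q))"
proof -
  let ?d = "\<lambda>k. real (ns ! k) powr dim_exponent (ps ! k)"
  let ?a = "\<lambda>j. c j * (\<Prod>k<length ns. w k (j ! k))"
  have "(\<Sum>j\<in>multi_indices ns. cmod (?a j) powr q)
      \<le> (\<Sum>j\<in>multi_indices ns. R powr q * (\<Prod>k<length ns. cmod (w k (j ! k)) powr q))"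
  proof (intro sum_mono)
    fix j assume j: "j \<in> multi_indices ns"
    have "cmod (?a j) powr q = cmod (c j) powr q * (\<Prod>k<length ns. cmod (w k (j ! k)) powr q)"
      by (simp add: norm_mult powr_mult prod_norm[symmetric] prod_powr_distrib)
    also have "\<dots> \<le> R powr q * (\<Prod>k<length ns. cmod (w k (j ! k)) powr q)"
      using c[OF j] q by (intro mult_right_mono powr_mono2 prod_nonneg) auto
    finally show "cmod (?a j) powr q \<le> R powr q * (\<Prod>k<length ns. cmod (w k (j ! k)) powr q)" .
  qed
  also have "\<dots> = R powr q * (\<Prod>k<length ns. \<Sum>i=1..ns ! k. cmod (w k i) powr q)"
    unfolding sum_distrib_left[symmetric] by (subst sum_multi_indices_prod) simp
  also have "\<dots> \<le> R powr q * (\<Prod>k<length ns. 2 * ?d k powr q)"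
    using p n w q len
    by (intro mult_left_mono prod_mono conjI sum_nonneg lp_ball_power_sum_le_dim_exponent) auto
  also have "\<dots> = 2 ^ length ps * (R * (\<Prod>k<length ps. ?d k)) powr q"
    using R len by (simp add: prod.distrib powr_mult prod_powr_distrib)
  finally have a: "(\<Sum>j\<in>multi_indices ns. cmod (?a j) powr q) \<le> 2 ^ length ps * (R * (\<Prod>k<length ps. ?d k)) powr q" .
  have "(\<integral>\<^sup>+\<omega>. ennreal (exp (Re (z * random_multilinear \<gamma> c ns \<omega> w))) \<partial>P)
      = (\<integral>\<^sup>+\<omega>. ennreal (exp (Re (z * (\<Sum>j\<in>multi_indices ns. \<gamma> j \<omega> * ?a j)))) \<partial>P)"
    by (simp add: random_multilinear_def mult.assoc)
  also have "\<dots> \<le> ennreal (exp (D * cmod z powr q * (\<Sum>j\<in>multi_indices ns. cmod (?a j) powr q)))"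
    by (rule prob_space.mgf_indep_sum_le[OF P finite_multi_indices ind mgf])
  also have "\<dots> \<le> ennreal (exp (D * cmod z powr q * (2 ^ length ps * (R * (\<Prod>k<length ps. ?d k)) powr q)))"
    using a D by (intro ennreal_leI) (auto intro!: mult_left_mono)
  also have "D * cmod z powr q * (2 ^ length ps * (R * (\<Prod>k<length ps. ?d k)) powr q)
      = D * 2 ^ length ps * (cmod z * (R * (\<Prod>k<length ps. ?d k))) powr q"
    using R by (simp add: powr_mult mult_ac)
  finally show ?thesis .
qed

lemma prod_ball_nonempty:
  assumes "0 \<in> K" and p: "\<And>k. k < length ps \<Longrightarrow> 1 \<le> ps ! k" and n: "\<And>k. k < length ps \<Longrightarrow> 1 \<le> ns ! k"
  shows "prod_ball K ps ns \<noteq> {}"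
proof -
  have "restrict (\<lambda>_. 0) {1..ns ! k} \<in> lp_ball K (ps ! k) (ns ! k)" if "k < length ps" for k
    using assms lp_norm_le_of_coordinates[OF p[OF that] n[OF that], of 0 "restrict (\<lambda>_. 0) {1..ns ! k}"] that
    by (auto simp: lp_ball_def)
  then show ?thesis unfolding prod_ball_def by (subst PiE_eq_empty_iff) auto
qed

lemma prod_ball_lp_norm_le:
  assumes "z \<in> prod_ball K ps ns" "k < length ps"
  shows "lp_norm (ps ! k) (ns ! k) (z k) \<le> 1"
  using assms by (auto simp: prod_ball_def lp_ball_def PiE_iff)

text \<open>The witness is a maximiser over the finite product of the nets, which bounds all values
  of the form on the balls at once. The supremum is thereby dominated by finitely many random
  variables.\<close>

lemma sup_multilinear_le_net:
  assumes len: "length ns = length ps" and K: "0 \<in> K"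
    and p: "\<And>k. k < length ps \<Longrightarrow> 1 \<le> ps ! k" and n: "\<And>k. k < length ps \<Longrightarrow> 1 \<le> ns ! k"
    and F: "\<And>k. k < length ps \<Longrightarrow> finite (F k)"
      "\<And>k w. k < length ps \<Longrightarrow> w \<in> F k \<Longrightarrow> lp_norm (ps ! k) (ns ! k) w \<le> 1"
      "\<And>k z. k < length ps \<Longrightarrow> lp_norm (ps ! k) (ns ! k) z \<le> 1 \<Longrightarrow>
         \<exists>w\<in>F k. lp_norm (ps ! k) (ns ! k) (\<lambda>i. z i - w i) \<le> 1 / 2"
  shows "\<exists>w\<in>PiE {..<length ps} F. \<bar>sup_multilinear K ps \<gamma> c ns \<omega>\<bar>
           \<le> 2 ^ length ps * cmod (random_multilinear \<gamma> c ns \<omega> w)"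
proof -
  let ?L = "\<lambda>z. cmod (random_multilinear \<gamma> c ns \<omega> z)"
  let ?F = "PiE {..<length ps} F"
  define M where "M = Max (?L ` ?F)"
  have finF: "finite ?F" using F(1) by (intro finite_PiE) auto
  have le: "?L z \<le> 2 ^ length ps * M" if z: "z \<in> prod_ball K ps ns" for z
  proof -
    have "\<exists>w\<in>?F. ?L z \<le> 2 ^ length ps * ?L w"
      by (rule random_multilinear_le_net[OF len p n F prod_ball_lp_norm_le[OF z]])
    then obtain w where w: "w \<in> ?F" "?L z \<le> 2 ^ length ps * ?L w" ..
    note w(2)
    also have "2 ^ length ps * ?L w \<le> 2 ^ length ps * M"
      unfolding M_def using finF w by (intro mult_left_mono Max_ge) auto
    finally show ?thesis .
  qed
  obtain z where z: "z \<in> prod_ball K ps ns" using prod_ball_nonempty[OF K p n] by blast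
  have "sup_multilinear K ps \<gamma> c ns \<omega> \<le> 2 ^ length ps * M"
    unfolding sup_multilinear_def using z le by (intro cSUP_least) auto
  moreover have "0 \<le> sup_multilinear K ps \<gamma> c ns \<omega>"
    unfolding sup_multilinear_def using le by (intro cSUP_upper2[OF _ z] bdd_aboveI2) auto
  ultimately have le: "\<bar>sup_multilinear K ps \<gamma> c ns \<omega>\<bar> \<le> 2 ^ length ps * M" by linarith
  have "\<exists>w\<in>?F. ?L z \<le> 2 ^ length ps * ?L w"
    by (rule random_multilinear_le_net[OF len p n F prod_ball_lp_norm_le[OF z]])
  then have "?F \<noteq> {}" by blast
  then have "M \<in> ?L ` ?F" unfolding M_def using finF by (intro Max_in) auto
  then obtain w where "w \<in> ?F" "M = ?L w" by (rule imageE)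
  then show ?thesis using le by metis
qed

text \<open>\<open>R\<close> is any positive bound of the coefficients rather than their supremum,
  since the scale \<open>\<rho>\<close> has to be positive. \<open>C\<close> is obtained before the
  measure, the variables and the dimensions.\<close>

lemma orlicz_norm_sup_multilinear_le:
  fixes ps :: "ereal list" and D :: real
  assumes ne: "ps \<noteq> []" and p1: "\<forall>p\<in>set ps. 1 \<le> p" and ex: "\<exists>p\<in>set ps. p \<noteq> 1" and D: "D \<ge> 0"
  defines "r \<equiv> r_exponent ps"
  obtains C where "C > 0"
    "\<And>(P :: 'a measure) \<gamma> K c ns R.
       prob_space P \<Longrightarrow> 0 \<in> K \<Longrightarrow> prob_space.indep_vars P (\<lambda>_. borel) \<gamma> all_multi_indices \<Longrightarrow>
       (\<And>j w. j \<in> all_multi_indices \<Longrightarrow>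
          (\<integral>\<^sup>+\<omega>. ennreal (exp (Re (w * \<gamma> j \<omega>))) \<partial>P) \<le> ennreal (exp (D * cmod w powr (r / (r - 1))))) \<Longrightarrow>
       length ns = length ps \<Longrightarrow> \<forall>n\<in>set ns. 1 \<le> n \<Longrightarrow>
       (\<And>j. j \<in> multi_indices ns \<Longrightarrow> cmod (c j) \<le> R) \<Longrightarrow> R > 0 \<Longrightarrow>
       orlicz_norm r P (sup_multilinear K ps \<gamma> c ns)
         \<le> ennreal (C * R * (\<Sum>k<length ps. real (ns ! k)) powr (1 / r) *
              (\<Prod>k<length ps. real (ns ! k) powr dim_exponent (ps ! k)))"
proof -
  note r = r_exponent_properties[OF ne p1 ex, folded r_def]
  define q where "q = r / (r - 1)"
  have q1: "1 < q" using r(1) by (simp add: q_def field_simps)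
  define m where "m = length ps"
  have D': "D * 2 ^ m \<ge> 0" using D by simp
  obtain \<delta> \<Lambda> where \<delta>: "\<delta> > 0" and \<Lambda>: "\<Lambda> > 0" and
    expm: "\<And>(P :: 'a measure) X \<rho>. X \<in> borel_measurable P \<Longrightarrow> \<rho> > 0 \<Longrightarrow>
      (\<And>w. (\<integral>\<^sup>+\<omega>. ennreal (exp (Re (w * X \<omega>))) \<partial>P)
              \<le> ennreal (exp (D * 2 ^ m * (cmod w * \<rho>) powr q))) \<Longrightarrow>
      (\<integral>\<^sup>+\<omega>. ennreal (exp (\<delta> * (cmod (X \<omega>) / \<rho>) powr r)) \<partial>P) \<le> ennreal \<Lambda>"
    using exp_moment_of_mgf_bound[OF r(1) D'] unfolding q_def by blast
  \<comment> \<open>The logarithm pays for the at most 1000000^N net points,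
    \<open>\<Lambda>\<close> for the moment bound through \<Lambda> \<le> exp (\<Lambda> N), and 2
    for the requirement \<kappa> \<ge> 2 of the finite-maximum lemma.\<close>
  define \<kappa> where "\<kappa> = ln 1000000 + \<Lambda> + 2"
  have \<kappa>2: "\<kappa> \<ge> 2" using \<Lambda> by (simp add: \<kappa>_def)
  define C where "C = 2 ^ m * (\<kappa> / (\<delta> * ln 2)) powr (1 / r)"
  have "C > 0" using \<kappa>2 \<delta> by (simp add: C_def)
  show thesis
  proof (rule that[OF \<open>C > 0\<close>])
    fix P :: "'a measure" and \<gamma> and K :: "complex set" and c ns and R :: real
    assume P: "prob_space P" and K: "0 \<in> K"
      and ind: "prob_space.indep_vars P (\<lambda>_. borel) \<gamma> all_multi_indices"
      and mgf: "\<And>j w. j \<in> all_multi_indices \<Longrightarrow>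
          (\<integral>\<^sup>+\<omega>. ennreal (exp (Re (w * \<gamma> j \<omega>))) \<partial>P) \<le> ennreal (exp (D * cmod w powr (r / (r - 1))))"
      and len: "length ns = length ps" and ns: "\<forall>n\<in>set ns. 1 \<le> n"
      and c: "\<And>j. j \<in> multi_indices ns \<Longrightarrow> cmod (c j) \<le> R" and R: "R > 0"
    have p: "1 \<le> ps ! k" if "k < length ps" for k using p1 that by auto
    have n: "1 \<le> ns ! k" if "k < length ps" for k using ns that len by auto
    have sub: "multi_indices ns \<subseteq> all_multi_indices"
      using len ne ns by (intro multi_indices_subset) auto
    have ind': "prob_space.indep_vars P (\<lambda>_. borel) \<gamma> (multi_indices ns)"
      using prob_space.indep_vars_subset[OF P ind sub] .
    define N where "N = (\<Sum>k<m. real (ns ! k))"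
    define \<rho> where "\<rho> = R * (\<Prod>k<m. real (ns ! k) powr dim_exponent (ps ! k))"
    have \<rho>0: "\<rho> > 0" unfolding \<rho>_def m_def using R n by (intro mult_pos_pos prod_pos) (auto simp: Suc_le_eq)
    have N1: "N \<ge> 1"
    proof -
      have "real (ns ! 0) \<le> N" unfolding N_def using ne by (intro member_le_sum) (auto simp: m_def)
      moreover have "1 \<le> real (ns ! 0)" using n[of 0] ne by simp
      ultimately show ?thesis by linarith
    qed
    define net where "net k F \<longleftrightarrow> finite F \<and> card F \<le> 1000000 ^ (ns ! k) \<and> (\<forall>w\<in>F. lp_norm (ps ! k) (ns ! k) w \<le> 1) \<and>
        (\<forall>z. lp_norm (ps ! k) (ns ! k) z \<le> 1 \<longrightarrow> (\<exists>w\<in>F. lp_norm (ps ! k) (ns ! k) (\<lambda>i. z i - w i) \<le> 1 / 2))"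
      for k F
    have "\<exists>F. net k F" if "k < length ps" for k
      unfolding net_def by (rule lp_ball_net[OF p[OF that] n[OF that]]) blast
    then obtain F where "net k (F k)" if "k < length ps" for k by metis
    then have F: "\<And>k. k < length ps \<Longrightarrow> finite (F k)"
      "\<And>k. k < length ps \<Longrightarrow> card (F k) \<le> 1000000 ^ (ns ! k)"
      "\<And>k w. k < length ps \<Longrightarrow> w \<in> F k \<Longrightarrow> lp_norm (ps ! k) (ns ! k) w \<le> 1"
      "\<And>k z. k < length ps \<Longrightarrow> lp_norm (ps ! k) (ns ! k) z \<le> 1 \<Longrightarrow>
         \<exists>w\<in>F k. lp_norm (ps ! k) (ns ! k) (\<lambda>i. z i - w i) \<le> 1 / 2"
      unfolding net_def by auto
    let ?F = "PiE {..<length ps} F"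
    have finF: "finite ?F" using F(1) by (intro finite_PiE) auto
    have "real (card ?F) = (\<Prod>k<m. real (card (F k)))" by (simp add: card_PiE m_def)
    also have "\<dots> \<le> (\<Prod>k<m. real (1000000 ^ (ns ! k)))"
      using F(2) by (intro prod_mono conjI) (auto simp: m_def simp del: of_nat_power)
    also have "\<dots> = (\<Prod>k<m. exp (ln 1000000 * real (ns ! k)))"
      by (intro prod.cong refl) (simp add: exp_of_nat2_mult)
    also have "\<dots> = exp (ln 1000000 * N)"
      by (simp add: N_def exp_sum sum_distrib_left)
    finally have card: "real (card ?F) \<le> exp (ln 1000000 * N)" .
    have "\<Lambda> \<le> exp \<Lambda>" using exp_ge_add_one_self[of \<Lambda>] by linarith
    also have "\<dots> \<le> exp (\<Lambda> * N)" using \<Lambda> N1 by simp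
    finally have "real (card ?F) * \<Lambda> \<le> exp (ln 1000000 * N) * exp (\<Lambda> * N)"
      using card \<Lambda> by (intro mult_mono) auto
    also have "\<dots> \<le> exp (\<kappa> * N)"
      using N1 by (simp add: \<kappa>_def algebra_simps flip: exp_add)
    finally have cardK: "real (card ?F) * \<Lambda> \<le> exp (\<kappa> * N)" .
    have meas: "(\<lambda>\<omega>. random_multilinear \<gamma> c ns \<omega> w) \<in> borel_measurable P" for w
      unfolding random_multilinear_def
      using indep_vars_measurable[OF P ind'] by (intro borel_measurable_sum borel_measurable_times) auto
    have "orlicz_norm r P (sup_multilinear K ps \<gamma> c ns)
        \<le> ennreal (2 ^ m * \<rho> * (\<kappa> / (\<delta> * ln 2)) powr (1 / r) * N powr (1 / r))"
    proof (rule orlicz_norm_le_of_finite_max[where F = ?F and X = "\<lambda>w \<omega>. random_multilinear \<gamma> c ns \<omega> w" and K = \<Lambda>])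
      show "(\<integral>\<^sup>+\<omega>. ennreal (exp (\<delta> * (cmod (random_multilinear \<gamma> c ns \<omega> w) / \<rho>) powr r)) \<partial>P) \<le> ennreal \<Lambda>"
        if "w \<in> ?F" for w
      proof (rule expm[OF meas \<rho>0])
        show "(\<integral>\<^sup>+\<omega>. ennreal (exp (Re (z * random_multilinear \<gamma> c ns \<omega> w))) \<partial>P)
            \<le> ennreal (exp (D * 2 ^ m * (cmod z * \<rho>) powr q))" for z
          unfolding \<rho>_def m_def
        proof (rule mgf_random_multilinear_le[OF P ind' _ len D R q1 p _ n c])
          show "(\<integral>\<^sup>+\<omega>. ennreal (exp (Re (w * \<gamma> j \<omega>))) \<partial>P) \<le> ennreal (exp (D * cmod w powr q))"
            if "j \<in> multi_indices ns" for j w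
            using mgf that sub unfolding q_def by blast
          show "q = 2 \<or> ps ! k \<le> ereal q" if "k < length ps" for k
            using r(2)[of "ps ! k"] that unfolding q_def by simp
          show "lp_norm (ps ! k) (ns ! k) (w k) \<le> 1" if "k < length ps" for k
            using \<open>w \<in> ?F\<close> F(3) that by (auto simp: PiE_iff)
        qed
      qed
      show "\<exists>w\<in>?F. \<bar>sup_multilinear K ps \<gamma> c ns \<omega>\<bar> \<le> 2 ^ m * cmod (random_multilinear \<gamma> c ns \<omega> w)" for \<omega>
        unfolding m_def by (rule sup_multilinear_le_net[OF len K p n F(1) F(3) F(4)])
    qed (use r(1) \<delta> \<rho>0 N1 finF cardK \<kappa>2 \<Lambda> meas P in auto)
    then show "orlicz_norm r P (sup_multilinear K ps \<gamma> c ns)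
         \<le> ennreal (C * R * (\<Sum>k<length ps. real (ns ! k)) powr (1 / r) *
              (\<Prod>k<length ps. real (ns ! k) powr dim_exponent (ps ! k)))"
      by (simp add: C_def \<rho>_def N_def m_def mult_ac)
  qed
qed

section \<open>Rademacher, Steinhaus and Gaussian variables\<close>

lemma mgf_of_subgaussian_with:
  assumes "subgaussian_with P f t" "t \<le> s"
  shows "(\<integral>\<^sup>+\<omega>. ennreal (exp (Re (w * f \<omega>))) \<partial>P) \<le> ennreal (exp (s\<^sup>2 / 2 * cmod w powr 2))"
proof -
  have "(\<integral>\<^sup>+\<omega>. ennreal (exp (Re (w * f \<omega>))) \<partial>P) \<le> ennreal (exp (t\<^sup>2 * (cmod w)\<^sup>2 / 2))"
    using assms(1) by (simp add: subgaussian_with_def)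
  also have "\<dots> \<le> ennreal (exp (s\<^sup>2 / 2 * cmod w powr 2))"
  proof -
    have "t\<^sup>2 \<le> s\<^sup>2" using assms by (intro power_mono) (auto simp: subgaussian_with_def)
    then show ?thesis by (intro ennreal_leI) (auto intro: mult_right_mono)
  qed
  finally show ?thesis .
qed

text \<open>The point is \<open>min x\<^sup>2 x \<le> x powr q\<close> for \<open>1 \<le> q \<le> 2\<close>.\<close>
lemma mgf_interpolate_bounded:
  fixes A M q :: real
  assumes P: "prob_space P" and q: "1 \<le> q" "q \<le> 2"
    and mgf: "\<And>w. (\<integral>\<^sup>+\<omega>. ennreal (exp (Re (w * f \<omega>))) \<partial>P) \<le> ennreal (exp (A * cmod w powr 2))"
    and bdd: "q = 2 \<or> (AE \<omega> in P. cmod (f \<omega>) \<le> M)" and A: "A \<ge> 0"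
  shows "(\<integral>\<^sup>+\<omega>. ennreal (exp (Re (w * f \<omega>))) \<partial>P) \<le> ennreal (exp (max A M * cmod w powr q))"
proof (cases "q = 2 \<or> cmod w \<le> 1")
  case True
  then have "cmod w powr 2 \<le> cmod w powr q" using q powr_mono'[of q 2 "cmod w"] by auto
  then have "A * cmod w powr 2 \<le> max A M * cmod w powr q" using A by (intro mult_mono) auto
  then show ?thesis by (intro order_trans[OF mgf] ennreal_leI) simp
next
  case False
  then have "AE \<omega> in P. cmod (f \<omega>) \<le> M" using bdd by simp
  then have "AE \<omega> in P. ennreal (exp (Re (w * f \<omega>))) \<le> ennreal (exp (max A M * cmod w powr q))"
  proof eventually_elim
    case (elim \<omega>)
    have "Re (w * f \<omega>) \<le> cmod w * cmod (f \<omega>)"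
      by (metis complex_Re_le_cmod norm_mult)
    also have "\<dots> \<le> cmod w powr q * max A M"
      using False q elim powr_mono[of 1 q "cmod w"] by (intro mult_mono) auto
    finally show ?case by (intro ennreal_leI) (simp add: mult.commute)
  qed
  then have "(\<integral>\<^sup>+\<omega>. ennreal (exp (Re (w * f \<omega>))) \<partial>P) \<le> (\<integral>\<^sup>+\<omega>. ennreal (exp (max A M * cmod w powr q)) \<partial>P)"
    by (rule nn_integral_mono_AE)
  then show ?thesis using P by (simp add: prob_space.emeasure_space_1)
qed

text \<open>Hoeffding's lemma for Re (w f), which has mean zero and values in [-|w|, |w|]; its
  exponent |w|^2/2 is rounded up to |w|^2.\<close>

lemma (in prob_space) mgf_bounded_mean_zero:
  fixes f :: "'a \<Rightarrow> complex"
  assumes f[measurable]: "f \<in> borel_measurable M" and bdd: "AE \<omega> in M. cmod (f \<omega>) \<le> 1"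
    and mean: "expectation f = 0"
  shows "(\<integral>\<^sup>+\<omega>. ennreal (exp (Re (w * f \<omega>))) \<partial>M) \<le> ennreal (exp (1 * cmod w powr 2))"
proof -
  have int: "integrable M f" using bdd by (intro integrable_const_bound[where B = 1]) auto
  interpret interval_bounded_random_variable M "\<lambda>\<omega>. Re (w * f \<omega>)" "- cmod w" "cmod w"
  proof
    show "AE \<omega> in M. Re (w * f \<omega>) \<in> {- cmod w..cmod w}"
      using bdd
    proof eventually_elim
      case (elim \<omega>)
      have "\<bar>Re (w * f \<omega>)\<bar> \<le> cmod w * cmod (f \<omega>)" by (metis abs_Re_le_cmod norm_mult)
      also have "\<dots> \<le> cmod w" using elim by (simp add: mult_left_le)
      finally show ?case by (simp add: abs_le_iff)
    qed
  qed measurable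
  have "expectation (\<lambda>\<omega>. Re (w * f \<omega>)) = Re (expectation (\<lambda>\<omega>. w * f \<omega>))"
    using int by (intro integral_Re) auto
  also have "\<dots> = 0" using mean by simp
  finally have "(\<integral>\<^sup>+\<omega>. ennreal (exp (1 * Re (w * f \<omega>))) \<partial>M) \<le> ennreal (exp (1\<^sup>2 * (cmod w - - cmod w)\<^sup>2 / 8))"
    by (intro Hoeffdings_lemma_nn_integral_0) auto
  also have "\<dots> \<le> ennreal (exp (1 * cmod w powr 2))"
    by (intro ennreal_leI) (simp add: power2_eq_square)
  finally show ?thesis by simp
qed

lemma rademacher_AE:
  assumes P: "prob_space P" and f: "rademacher P f"
  shows "AE \<omega> in P. f \<omega> = 1 \<or> f \<omega> = -1"
proof -
  interpret prob_space P by fact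
  have [measurable]: "f \<in> borel_measurable P" using f by (simp add: rademacher_def)
  have "prob {\<omega> \<in> space P. f \<omega> = 1 \<or> f \<omega> = -1} = prob ({\<omega> \<in> space P. f \<omega> = 1} \<union> {\<omega> \<in> space P. f \<omega> = -1})"
    by (intro arg_cong[where f = prob]) auto
  also have "\<dots> = prob {\<omega> \<in> space P. f \<omega> = 1} + prob {\<omega> \<in> space P. f \<omega> = -1}"
    by (intro finite_measure_Union) auto
  also have "\<dots> = 1" using f by (simp add: rademacher_def)
  finally show ?thesis by (subst (asm) prob_Collect_eq_1) auto
qed

lemma rademacher_expectation:
  assumes P: "prob_space P" and f: "rademacher P f"
  shows "integral\<^sup>L P f = 0"
proof -
  interpret prob_space P by fact
  have [measurable]: "f \<in> borel_measurable P" using f by (simp add: rademacher_def)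
  let ?A = "{\<omega> \<in> space P. f \<omega> = 1}" and ?B = "{\<omega> \<in> space P. f \<omega> = -1}"
  have [measurable]: "?A \<in> events" "?B \<in> events" by measurable
  have "integral\<^sup>L P f = expectation (\<lambda>\<omega>. of_real (indicator ?A \<omega> - indicator ?B \<omega>))"
    using rademacher_AE[OF P f] AE_space
    by (intro integral_cong_AE) (measurable, auto elim!: eventually_elim2 split: split_indicator)
  also have "\<dots> = of_real (expectation (\<lambda>\<omega>. indicator ?A \<omega> - indicator ?B \<omega>))"
    by (rule integral_complex_of_real)
  also have "expectation (\<lambda>\<omega>. indicator ?A \<omega> - indicator ?B \<omega>) = prob ?A - prob ?B"
    by (subst Bochner_Integration.integral_diff) (auto simp: emeasure_eq_measure)
  also have "\<dots> = 0" using f by (simp add: rademacher_def)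
  finally show ?thesis by simp
qed

text \<open>The antiderivative has period 2 pi. The case k = 1 gives the mean of a Steinhaus
  variable; k = 2 serves to exclude a vanishing real part.\<close>

lemma integral_cis_uniform:
  fixes k :: nat
  assumes "k > 0"
  shows "(LINT x|uniform_measure lborel {0..<2 * pi}. cis (real k * x)) = 0"
proof -
  let ?F = "\<lambda>x. cis (real k * x) / (\<i> * of_nat k)"
  have der: "(?F has_vector_derivative cis (real k * x)) (at x within S)" for x S
  proof -
    have "((\<lambda>z. exp (\<i> * of_nat k * z) / (\<i> * of_nat k)) has_field_derivative exp (\<i> * of_nat k * of_real x)) (at (of_real x))"
      using assms by (auto intro!: derivative_eq_intros)
    from has_vector_derivative_real_field[OF this, of S]
    show ?thesis by (simp add: cis_conv_exp mult.assoc)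
  qed
  have cisk: "cis (real k * (2 * pi)) = 1"
    by (metis cis_multiple_2pi Ints_of_nat mult.commute)
  have "(LINT x|lborel. indicator {0..2 * pi} x *\<^sub>R cis (real k * x)) = ?F (2 * pi) - ?F 0"
    by (intro integral_FTC_Icc der continuous_intros) auto
  also have "\<dots> = 0" using cisk by simp
  finally have I: "(LINT x|lborel. indicator {0..2 * pi} x *\<^sub>R cis (real k * x)) = 0" .
  have "(LINT x|uniform_measure lborel {0..<2 * pi}. cis (real k * x))
      = (LINT x|density lborel (\<lambda>x. ennreal (indicator {0..<2 * pi} x / (2 * pi))). cis (real k * x))"
    unfolding uniform_measure_def
    by (intro arg_cong2[where f = "integral\<^sup>L"] arg_cong2[where f = density] refl ext)
       (auto split: split_indicator simp: divide_ennreal ennreal_1[symmetric] simp del: ennreal_1)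
  also have "\<dots> = (LINT x|lborel. (indicator {0..<2 * pi} x / (2 * pi)) *\<^sub>R cis (real k * x))"
    by (intro integral_density) (auto simp: cis_conv_exp)
  \<comment> \<open>Passing to the closed interval changes the integrand only at the null point 2
    pi.\<close>
  also have "\<dots> = (LINT x|lborel. (1 / (2 * pi)) *\<^sub>R (indicator {0..2 * pi} x *\<^sub>R cis (real k * x)))"
    using AE_lborel_singleton[of "2 * pi"]
    by (intro integral_cong_AE) (auto simp: cis_conv_exp elim!: eventually_mono split: split_indicator)
  also have "\<dots> = 0" by (subst integral_scaleR_right) (simp only: I scaleR_zero_right)
  finally show ?thesis .
qed

lemma cis_measurable [measurable]: "cis \<in> borel_measurable borel"
proof -
  have "(\<lambda>x. exp (\<i> * complex_of_real x)) \<in> borel_measurable borel" by measurable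
  then show ?thesis by (simp add: cis_conv_exp[symmetric])
qed

lemma steinhaus_AE:
  assumes f: "steinhaus P f"
  shows "AE \<omega> in P. cmod (f \<omega>) = 1"
proof -
  have [measurable]: "f \<in> borel_measurable P" using f by (simp add: steinhaus_def)
  have "AE x in distr (uniform_measure lborel {0..<2 * pi}) borel cis. cmod x = 1"
    by (subst AE_distr_iff) auto
  moreover have "distr P borel f = distr (uniform_measure lborel {0..<2 * pi}) borel cis"
    using f by (simp add: steinhaus_def)
  ultimately have "AE x in distr P borel f. cmod x = 1" by (simp only:)
  then show ?thesis by (subst (asm) AE_distr_iff) auto
qed

lemma steinhaus_power_expectation:
  assumes f: "steinhaus P f" and k: "k > 0"
  shows "integral\<^sup>L P (\<lambda>\<omega>. f \<omega> ^ k) = 0"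
proof -
  have [measurable]: "f \<in> borel_measurable P" using f by (simp add: steinhaus_def)
  have "integral\<^sup>L P (\<lambda>\<omega>. f \<omega> ^ k) = integral\<^sup>L (distr P borel f) (\<lambda>x. x ^ k)"
    by (subst integral_distr) auto
  also have "\<dots> = integral\<^sup>L (distr (uniform_measure lborel {0..<2 * pi}) borel cis) (\<lambda>x. x ^ k)"
    using f by (simp add: steinhaus_def)
  also have "\<dots> = (LINT x|uniform_measure lborel {0..<2 * pi}. cis x ^ k)"
    by (subst integral_distr) auto
  also have "\<dots> = (LINT x|uniform_measure lborel {0..<2 * pi}. cis (real k * x))"
    by (intro Bochner_Integration.integral_cong refl Complex.DeMoivre)
  finally show ?thesis using integral_cis_uniform[OF k] by simp
qed

lemma nn_integral_lborel_translate:
  fixes f :: "'b::euclidean_space \<Rightarrow> ennreal"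
  assumes [measurable]: "f \<in> borel_measurable borel"
  shows "(\<integral>\<^sup>+x. f (c + x) \<partial>lborel) = (\<integral>\<^sup>+x. f x \<partial>lborel)"
proof -
  have "(\<integral>\<^sup>+x. f x \<partial>lborel) = (\<integral>\<^sup>+x. f x \<partial>distr lborel borel ((+) c))"
    by (simp add: lborel_distr_plus)
  also have "\<dots> = (\<integral>\<^sup>+x. f (c + x) \<partial>lborel)" by (subst nn_integral_distr) auto
  finally show ?thesis ..
qed

text \<open>
  Completing the square turns the moment generating function of a Gaussian density into a
  multiple of a translate of that density.
\<close>
lemma normal_gaussian_mgf:
  assumes P: "prob_space P" and f: "normal_gaussian P f"
  shows "(\<forall>w. (\<integral>\<^sup>+\<omega>. ennreal (exp (Re (w * f \<omega>))) \<partial>P) = ennreal (exp ((Re w)\<^sup>2 / 2))) \<or>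
    (\<forall>w. (\<integral>\<^sup>+\<omega>. ennreal (exp (Re (w * f \<omega>))) \<partial>P) = ennreal (exp ((cmod w)\<^sup>2 / 4)))"
proof -
  interpret prob_space P by fact
  have fm[measurable]: "f \<in> borel_measurable P" using f by (simp add: normal_gaussian_def)
  have dist: "(\<integral>\<^sup>+\<omega>. ennreal (exp (Re (w * f \<omega>))) \<partial>P) = (\<integral>\<^sup>+v. ennreal (exp (Re (w * v))) \<partial>distr P borel f)" for w
    by (subst nn_integral_distr) auto
  from f consider
    (real) "distr P borel f = distr (density lborel std_normal_density) borel complex_of_real" |
    (complex) "distr P borel f = density lborel (\<lambda>w. ennreal (exp (- (cmod w)\<^sup>2) / pi))"
    unfolding normal_gaussian_def by blast
  then show ?thesis
  proof cases
    case real
    have "(\<integral>\<^sup>+\<omega>. ennreal (exp (Re (w * f \<omega>))) \<partial>P) = ennreal (exp ((Re w)\<^sup>2 / 2))" for w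
    proof -
      let ?x = "Re w"
      have "(\<integral>\<^sup>+\<omega>. ennreal (exp (Re (w * f \<omega>))) \<partial>P)
          = (\<integral>\<^sup>+t. ennreal (exp (?x * t)) \<partial>density lborel std_normal_density)"
        unfolding dist real by (subst nn_integral_distr) auto
      also have "\<dots> = (\<integral>\<^sup>+t. ennreal (std_normal_density t) * ennreal (exp (?x * t)) \<partial>lborel)"
        by (subst nn_integral_density) auto
      also have "\<dots> = (\<integral>\<^sup>+t. ennreal (exp (?x\<^sup>2 / 2)) * ennreal (std_normal_density (- ?x + t)) \<partial>lborel)"
      proof (intro nn_integral_cong)
        fix t
        have "- t\<^sup>2 / 2 + ?x * t = ?x\<^sup>2 / 2 + - (- ?x + t)\<^sup>2 / 2"
          by (simp add: power2_eq_square field_simps)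
        then have "exp (- t\<^sup>2 / 2) * exp (?x * t) = exp (?x\<^sup>2 / 2) * exp (- (- ?x + t)\<^sup>2 / 2)"
          by (simp only: exp_add[symmetric])
        then show "ennreal (std_normal_density t) * ennreal (exp (?x * t))
            = ennreal (exp (?x\<^sup>2 / 2)) * ennreal (std_normal_density (- ?x + t))"
          by (simp add: std_normal_density_def flip: ennreal_mult)
      qed
      also have "\<dots> = ennreal (exp (?x\<^sup>2 / 2)) * (\<integral>\<^sup>+t. ennreal (std_normal_density (- ?x + t)) \<partial>lborel)"
        by (rule nn_integral_cmult) measurable
      also have "(\<integral>\<^sup>+t. ennreal (std_normal_density (- ?x + t)) \<partial>lborel) = (\<integral>\<^sup>+t. ennreal (std_normal_density t) \<partial>lborel)"
        by (rule nn_integral_lborel_translate) measurable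
      also have "\<dots> = emeasure (density lborel std_normal_density) (space (density lborel std_normal_density))"
        by (simp add: emeasure_density)
      also have "\<dots> = 1"
        by (rule prob_space.emeasure_space_1) (simp add: prob_space_normal_density)
      finally show ?thesis by simp
    qed
    then show ?thesis by blast
  next
    case complex
    let ?h = "\<lambda>v::complex. ennreal (exp (- (cmod v)\<^sup>2) / pi)"
    \<comment> \<open>The planar Gaussian integral is not computed: the density is the law of
      \<open>f\<close> under a probability measure, so its total mass is 1.\<close>
    have "(\<integral>\<^sup>+v. ?h v \<partial>lborel) = emeasure (distr P borel f) (space (distr P borel f))"
      unfolding complex by (simp add: emeasure_density)
    also have "\<dots> = 1" by (intro prob_space.emeasure_space_1 prob_space_distr fm)
    finally have one: "(\<integral>\<^sup>+v. ?h v \<partial>lborel) = 1" .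
    have "(\<integral>\<^sup>+\<omega>. ennreal (exp (Re (w * f \<omega>))) \<partial>P) = ennreal (exp ((cmod w)\<^sup>2 / 4))" for w
    proof -
      have "(\<integral>\<^sup>+\<omega>. ennreal (exp (Re (w * f \<omega>))) \<partial>P)
          = (\<integral>\<^sup>+v. ?h v * ennreal (exp (Re (w * v))) \<partial>lborel)"
        unfolding dist complex by (subst nn_integral_density) auto
      also have "\<dots> = (\<integral>\<^sup>+v. ennreal (exp ((cmod w)\<^sup>2 / 4)) * ?h (- (cnj w / 2) + v) \<partial>lborel)"
      proof (intro nn_integral_cong)
        fix v
        have "- (cmod v)\<^sup>2 + Re (w * v) = (cmod w)\<^sup>2 / 4 + - (cmod (- (cnj w / 2) + v))\<^sup>2"
          unfolding cmod_power2 by (simp add: power2_eq_square field_simps)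
        then have "exp (- (cmod v)\<^sup>2) * exp (Re (w * v)) = exp ((cmod w)\<^sup>2 / 4) * exp (- (cmod (- (cnj w / 2) + v))\<^sup>2)"
          by (simp only: exp_add[symmetric])
        then show "?h v * ennreal (exp (Re (w * v))) = ennreal (exp ((cmod w)\<^sup>2 / 4)) * ?h (- (cnj w / 2) + v)"
          by (simp flip: ennreal_mult del: times_complex.sel)
      qed
      also have "\<dots> = ennreal (exp ((cmod w)\<^sup>2 / 4)) * (\<integral>\<^sup>+v. ?h (- (cnj w / 2) + v) \<partial>lborel)"
        by (rule nn_integral_cmult) measurable
      also have "(\<integral>\<^sup>+v. ?h (- (cnj w / 2) + v) \<partial>lborel) = (\<integral>\<^sup>+v. ?h v \<partial>lborel)"
        by (rule nn_integral_lborel_translate) measurable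
      finally show ?thesis using one by simp
    qed
    then show ?thesis by blast
  qed
qed

lemma special_mgf_le:
  assumes P: "prob_space P" and f: "rademacher P f \<or> steinhaus P f \<or> normal_gaussian P f"
  shows "(\<integral>\<^sup>+\<omega>. ennreal (exp (Re (w * f \<omega>))) \<partial>P) \<le> ennreal (exp (1 * cmod w powr 2))"
  using f
proof (elim disjE)
  assume f: "rademacher P f"
  show ?thesis
    using rademacher_AE[OF P f] f
    by (intro prob_space.mgf_bounded_mean_zero[OF P] rademacher_expectation[OF P f])
      (auto simp: rademacher_def elim!: eventually_mono)
next
  assume f: "steinhaus P f"
  show ?thesis
    using steinhaus_AE[OF f] steinhaus_power_expectation[OF f, of 1] f
    by (intro prob_space.mgf_bounded_mean_zero[OF P])
      (auto simp: steinhaus_def elim!: eventually_mono)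
next
  assume f: "normal_gaussian P f"
  have "(Re w)\<^sup>2 / 2 \<le> (cmod w)\<^sup>2" unfolding cmod_power2 by (simp add: add_increasing2)
  then show ?thesis
    using normal_gaussian_mgf[OF P f] by (auto intro!: ennreal_leI)
qed

text \<open>If Re f vanished almost everywhere, a Rademacher variable could not be 1 or -1, a
  Steinhaus variable would satisfy f^2 = -1 against E f^2 = 0, and a Gaussian one would have E exp
  (Re f) = 1 instead of exp (1/2) or exp (1/4).\<close>

lemma special_second_moment_nonzero:
  assumes P: "prob_space P" and f: "rademacher P f \<or> steinhaus P f \<or> normal_gaussian P f"
  shows "(\<integral>\<^sup>+\<omega>. ennreal ((Re (f \<omega>))\<^sup>2) \<partial>P) \<noteq> 0"
proof
  interpret prob_space P by fact
  have [measurable]: "f \<in> borel_measurable P"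
    using f by (auto simp: rademacher_def steinhaus_def normal_gaussian_def)
  assume "(\<integral>\<^sup>+\<omega>. ennreal ((Re (f \<omega>))\<^sup>2) \<partial>P) = 0"
  then have "AE \<omega> in P. ennreal ((Re (f \<omega>))\<^sup>2) = 0"
    by (subst (asm) nn_integral_0_iff_AE) auto
  then have Re0: "AE \<omega> in P. Re (f \<omega>) = 0"
    by eventually_elim (auto simp: ennreal_eq_0_iff)
  show False
    using f
  proof (elim disjE)
    assume "rademacher P f"
    from rademacher_AE[OF P this] Re0 have "AE \<omega> in P. False"
      by eventually_elim auto
    then show False by simp
  next
    assume f: "steinhaus P f"
    from steinhaus_AE[OF f] Re0 have "AE \<omega> in P. f \<omega> ^ 2 = -1"
    proof eventually_elim
      case (elim \<omega>)
      then have "(Im (f \<omega>))\<^sup>2 = 1" using cmod_power2[of "f \<omega>"] by simp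
      then show ?case using elim by (simp add: complex_eq_iff power2_eq_square)
    qed
    then have "expectation (\<lambda>\<omega>. f \<omega> ^ 2) = expectation (\<lambda>\<omega>. -1)"
      by (intro integral_cong_AE) auto
    then show False using steinhaus_power_expectation[OF f, of 2] by (simp add: prob_space)
  next
    assume f: "normal_gaussian P f"
    have "(\<integral>\<^sup>+\<omega>. ennreal (exp (Re (1 * f \<omega>))) \<partial>P) = (\<integral>\<^sup>+\<omega>. 1 \<partial>P)"
      using Re0 by (intro nn_integral_cong_AE) (auto elim!: eventually_mono)
    then have "(\<integral>\<^sup>+\<omega>. ennreal (exp (Re (1 * f \<omega>))) \<partial>P) = ennreal 1" by (simp add: emeasure_space_1)
    then have "ennreal 1 = ennreal (exp (1 / 2)) \<or> ennreal 1 = ennreal (exp (1 / 4))"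
      using normal_gaussian_mgf[OF P f] by (elim disjE) (drule spec[of _ 1], simp)+
    then show False by (simp del: ennreal_1)
  qed
qed

text \<open>The second moment only depends on the law, and only finitely many laws occur.\<close>
lemma special_second_moment_ge:
  obtains c\<^sub>0 :: real where "c\<^sub>0 > 0"
    "\<And>(P :: 'a measure) f. prob_space P \<Longrightarrow> rademacher P f \<or> steinhaus P f \<or> normal_gaussian P f \<Longrightarrow>
       ennreal c\<^sub>0 \<le> (\<integral>\<^sup>+\<omega>. ennreal ((Re (f \<omega>))\<^sup>2) \<partial>P)"
proof -
  define I where "I = (\<lambda>Q. \<integral>\<^sup>+v. ennreal ((Re v)\<^sup>2) \<partial>(Q :: complex measure))"
  define \<L> where "\<L> = {distr (uniform_measure lborel {0..<2 * pi}) borel cis,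
    distr (density lborel std_normal_density) borel complex_of_real,
    density lborel (\<lambda>w. ennreal (exp (- (cmod w)\<^sup>2) / pi))}"
  \<comment> \<open>Zero moments are removed before the minimum is taken, so \<open>c\<close> is
    positive without evaluating any moment. The entry 1 covers Rademacher variables, which are
    defined by two point masses and not by an equation of laws, and keeps \<open>c\<close>
    finite.\<close>
  define c where "c = Min (insert 1 (I ` \<L> - {0}))"
  have fin: "finite (insert 1 (I ` \<L> - {0}))" by (simp add: \<L>_def)
  then have "c \<in> insert 1 (I ` \<L> - {0})" "c \<le> 1" unfolding c_def by (intro Min_in Min_le; simp)+
  then have c: "0 < c" "c \<le> 1" by (auto simp: zero_less_iff_neq_zero)
  have ge: "c \<le> (\<integral>\<^sup>+\<omega>. ennreal ((Re (f \<omega>))\<^sup>2) \<partial>P)"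
    if P: "prob_space P" and f: "rademacher P f \<or> steinhaus P f \<or> normal_gaussian P f"
    for P :: "'a measure" and f
  proof (cases "rademacher P f")
    case True
    have "(\<integral>\<^sup>+\<omega>. ennreal ((Re (f \<omega>))\<^sup>2) \<partial>P) = (\<integral>\<^sup>+\<omega>. 1 \<partial>P)"
      using rademacher_AE[OF P True] by (intro nn_integral_cong_AE) (auto elim!: eventually_mono)
    then show ?thesis using c by (simp add: prob_space.emeasure_space_1[OF P])
  next
    case False
    have [measurable]: "f \<in> borel_measurable P"
      using f by (auto simp: rademacher_def steinhaus_def normal_gaussian_def)
    have eq: "(\<integral>\<^sup>+\<omega>. ennreal ((Re (f \<omega>))\<^sup>2) \<partial>P) = I (distr P borel f)"
      unfolding I_def by (subst nn_integral_distr) auto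
    have "distr P borel f \<in> \<L>"
      using f False by (auto simp: steinhaus_def normal_gaussian_def \<L>_def)
    moreover have "I (distr P borel f) \<noteq> 0"
      using special_second_moment_nonzero[OF P f] eq by simp
    ultimately show ?thesis unfolding eq c_def by (intro Min_le) (auto simp: \<L>_def)
  qed
  have "c \<noteq> \<top>" using c(2) by (auto simp: top_unique)
  then obtain c\<^sub>0 where c\<^sub>0: "c = ennreal c\<^sub>0" "c\<^sub>0 \<ge> 0" by (cases c) auto
  show thesis
    using c(1) ge c\<^sub>0 by (intro that[of c\<^sub>0]) (auto simp: zero_less_iff_neq_zero)
qed

section \<open>The lower estimate\<close>

lemma square_le_exp: "(y::real)\<^sup>2 \<le> 2 * (exp y + exp (- y))"
proof -
  have "y\<^sup>2 \<le> 2 * exp \<bar>y\<bar>"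
    using exp_lower_Taylor_quadratic[of "\<bar>y\<bar>"] by simp
  also have "exp \<bar>y\<bar> \<le> exp y + exp (- y)" by (auto simp: abs_if add_increasing)
  finally show ?thesis by simp
qed

text \<open>Square of the Taylor bound (|y|/2)^2 / 2 \<le> exp (|y|/2).\<close>

lemma power4_le_exp: "(y::real) ^ 4 \<le> 64 * (exp y + exp (- y))"
proof -
  have "\<bar>y\<bar>\<^sup>2 / 8 \<le> exp (\<bar>y\<bar> / 2)"
    using exp_lower_Taylor_quadratic[of "\<bar>y\<bar> / 2"] by (simp add: power_divide)
  then have "(\<bar>y\<bar>\<^sup>2 / 8)\<^sup>2 \<le> (exp (\<bar>y\<bar> / 2))\<^sup>2" by (rule power_mono) simp
  then have "y ^ 4 \<le> 64 * exp \<bar>y\<bar>"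
    by (simp add: power_divide flip: exp_double)
  also have "exp \<bar>y\<bar> \<le> exp y + exp (- y)" by (auto simp: abs_if add_increasing)
  finally show ?thesis by simp
qed

context prob_space
begin

lemma subgaussian_square_integrable:
  fixes X :: "'a \<Rightarrow> real"
  assumes X[measurable]: "X \<in> borel_measurable M"
    and mgf: "\<And>x. (\<integral>\<^sup>+\<omega>. ennreal (exp (x * X \<omega>)) \<partial>M) \<le> ennreal (exp (x\<^sup>2))"
  shows "integrable M X" "integrable M (\<lambda>\<omega>. (X \<omega>)\<^sup>2)" "\<And>x. integrable M (\<lambda>\<omega>. exp (x * X \<omega>))"
proof -
  show ex: "integrable M (\<lambda>\<omega>. exp (x * X \<omega>))" for x
    using order.strict_trans1[OF mgf[of x] ennreal_less_top] by (intro integrableI_nonneg) auto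
  show X2: "integrable M (\<lambda>\<omega>. (X \<omega>)\<^sup>2)"
  proof (rule Bochner_Integration.integrable_bound)
    show "integrable M (\<lambda>\<omega>. 2 * (exp (1 * X \<omega>) + exp (-1 * X \<omega>)))"
      by (intro integrable_mult_right Bochner_Integration.integrable_add ex)
    show "AE \<omega> in M. norm ((X \<omega>)\<^sup>2) \<le> norm (2 * (exp (1 * X \<omega>) + exp (-1 * X \<omega>)))"
      using square_le_exp by (intro AE_I2) (simp add: add_nonneg_nonneg)
  qed measurable
  then show "integrable M X" by (rule square_integrable_imp_integrable[OF X])
qed

lemma subgaussian_mean_zero:
  fixes X :: "'a \<Rightarrow> real"
  assumes X[measurable]: "X \<in> borel_measurable M"
    and mgf: "\<And>x. (\<integral>\<^sup>+\<omega>. ennreal (exp (x * X \<omega>)) \<partial>M) \<le> ennreal (exp (x\<^sup>2))"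
  shows "expectation X = 0"
proof -
  note int = subgaussian_square_integrable[OF X mgf]
  have lin: "x * expectation X \<le> 2 * x\<^sup>2" if x: "\<bar>x\<bar> \<le> 1" for x
  proof -
    have "1 + x * expectation X = expectation (\<lambda>\<omega>. 1 + x * X \<omega>)"
      using int(1) by (simp add: prob_space)
    also have "\<dots> \<le> expectation (\<lambda>\<omega>. exp (x * X \<omega>))"
      using int by (intro integral_mono exp_ge_add_one_self) auto
    also have "\<dots> \<le> exp (x\<^sup>2)"
      using mgf[of x] int(3)[of x] by (subst (asm) nn_integral_eq_integral) (auto simp: ennreal_le_iff)
    also have "\<dots> \<le> 1 + x\<^sup>2 + (x\<^sup>2)\<^sup>2"
      using x by (intro exp_bound) (auto simp: abs_square_le_1)
    also have "(x\<^sup>2)\<^sup>2 \<le> x\<^sup>2 * 1"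
      unfolding power2_eq_square[of "x\<^sup>2"] using x by (intro mult_left_mono) (auto simp: abs_square_le_1)
    finally show ?thesis by simp
  qed
  show ?thesis
  proof (rule ccontr)
    assume "expectation X \<noteq> 0"
    then have e0: "\<bar>expectation X\<bar> > 0" by simp
    \<comment> \<open>Testing with t and -t yields |E X| \<le> 2 t, which t \<le> |E X| / 4
      contradicts.\<close>
    define t where "t = min 1 (\<bar>expectation X\<bar> / 4)"
    have t: "0 < t" "t \<le> 1" "4 * t \<le> \<bar>expectation X\<bar>" using e0 by (auto simp: t_def)
    have "t * expectation X \<le> 2 * t\<^sup>2" using lin[of t] t by simp
    moreover have "(- t) * expectation X \<le> 2 * t\<^sup>2" using lin[of "- t"] t by simp
    ultimately have "t * \<bar>expectation X\<bar> \<le> t * (2 * t)"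
      by (auto simp: abs_if power2_eq_square)
    then have "\<bar>expectation X\<bar> \<le> 2 * t" using t by simp
    then show False using t by linarith
  qed
qed

text \<open>Independence and mean zero annihilate the cross terms.\<close>

lemma second_moment_indep_sum:
  fixes X :: "'b \<Rightarrow> 'a \<Rightarrow> real"
  assumes J: "finite J" and ind: "indep_vars (\<lambda>_. borel) X J"
    and int: "\<And>j. j \<in> J \<Longrightarrow> integrable M (X j)" "\<And>j. j \<in> J \<Longrightarrow> integrable M (\<lambda>\<omega>. (X j \<omega>)\<^sup>2)"
    and mean: "\<And>j. j \<in> J \<Longrightarrow> expectation (X j) = 0"
  shows "expectation (\<lambda>\<omega>. (\<Sum>j\<in>J. a j * X j \<omega>)\<^sup>2) = (\<Sum>j\<in>J. (a j)\<^sup>2 * expectation (\<lambda>\<omega>. (X j \<omega>)\<^sup>2))"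
    and "integrable M (\<lambda>\<omega>. (\<Sum>j\<in>J. a j * X j \<omega>)\<^sup>2)"
proof -
  have cross: "integrable M (\<lambda>\<omega>. X i \<omega> * X j \<omega>) \<and> expectation (\<lambda>\<omega>. X i \<omega> * X j \<omega>) = 0"
    if "i \<in> J" "j \<in> J" "i \<noteq> j" for i j
  proof -
    have ind2: "indep_vars (\<lambda>_. borel) X {i, j}" using that by (intro indep_vars_subset[OF ind]) auto
    have "expectation (\<lambda>\<omega>. \<Prod>k\<in>{i, j}. X k \<omega>) = (\<Prod>k\<in>{i, j}. expectation (X k))"
      using int that by (intro indep_vars_lebesgue_integral ind2) auto
    moreover have "integrable M (\<lambda>\<omega>. \<Prod>k\<in>{i, j}. X k \<omega>)"
      using int that by (intro indep_vars_integrable ind2) auto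
    ultimately show ?thesis using that mean by simp
  qed
  have prod_int: "integrable M (\<lambda>\<omega>. X i \<omega> * X j \<omega>)" if "i \<in> J" "j \<in> J" for i j
    using cross[OF that] int(2)[OF that(1)] by (cases "i = j") (auto simp: power2_eq_square)
  have sq: "(\<Sum>j\<in>J. a j * X j \<omega>)\<^sup>2 = (\<Sum>i\<in>J. \<Sum>j\<in>J. (a i * a j) * (X i \<omega> * X j \<omega>))" for \<omega>
    by (simp add: power2_eq_square sum_product mult_ac)
  show "integrable M (\<lambda>\<omega>. (\<Sum>j\<in>J. a j * X j \<omega>)\<^sup>2)"
    unfolding sq by (intro Bochner_Integration.integrable_sum integrable_mult_right prod_int)
  have "expectation (\<lambda>\<omega>. (\<Sum>j\<in>J. a j * X j \<omega>)\<^sup>2)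
      = (\<Sum>i\<in>J. \<Sum>j\<in>J. (a i * a j) * expectation (\<lambda>\<omega>. X i \<omega> * X j \<omega>))"
    unfolding sq using prod_int
    by (simp add: Bochner_Integration.integral_sum Bochner_Integration.integrable_sum)
  also have "\<dots> = (\<Sum>i\<in>J. \<Sum>j\<in>J. if i = j then (a i)\<^sup>2 * expectation (\<lambda>\<omega>. (X i \<omega>)\<^sup>2) else 0)"
    using cross by (intro sum.cong refl) (auto simp: power2_eq_square)
  also have "\<dots> = (\<Sum>j\<in>J. (a j)\<^sup>2 * expectation (\<lambda>\<omega>. (X j \<omega>)\<^sup>2))"
    using J by simp
  finally show "expectation (\<lambda>\<omega>. (\<Sum>j\<in>J. a j * X j \<omega>)\<^sup>2) = (\<Sum>j\<in>J. (a j)\<^sup>2 * expectation (\<lambda>\<omega>. (X j \<omega>)\<^sup>2))" .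
qed

text \<open>
  Instead of Hoelder's inequality between the first, second and fourth moments, the proof
  integrates \<open>v\<^sup>2 \<le> \<tau> \<bar>v\<bar> + v ^ 4 / \<tau>\<^sup>2\<close> for a suitable \<open>\<tau>\<close>.
\<close>
lemma first_moment_indep_sum_ge:
  fixes \<gamma> :: "'b \<Rightarrow> 'a \<Rightarrow> complex" and a :: "'b \<Rightarrow> real"
  assumes J: "finite J" and ind: "indep_vars (\<lambda>_. borel) \<gamma> J"
    and mgf: "\<And>j w. j \<in> J \<Longrightarrow> (\<integral>\<^sup>+\<omega>. ennreal (exp (Re (w * \<gamma> j \<omega>))) \<partial>M) \<le> ennreal (exp (1 * cmod w powr 2))"
    and c0: "c\<^sub>0 > 0" and second: "\<And>j. j \<in> J \<Longrightarrow> ennreal c\<^sub>0 \<le> (\<integral>\<^sup>+\<omega>. ennreal ((Re (\<gamma> j \<omega>))\<^sup>2) \<partial>M)"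
    and s: "s > 0" "s\<^sup>2 = (\<Sum>j\<in>J. (a j)\<^sup>2)"
  shows "ennreal (c\<^sub>0 / (2 * sqrt (256 * exp 1 / c\<^sub>0)) * s) \<le> (\<integral>\<^sup>+\<omega>. ennreal \<bar>\<Sum>j\<in>J. a j * Re (\<gamma> j \<omega>)\<bar> \<partial>M)"
proof -
  have \<gamma>m[measurable]: "\<gamma> j \<in> borel_measurable M" if "j \<in> J" for j
    using ind that by (simp add: indep_vars_def)
  define X where "X j \<omega> = Re (\<gamma> j \<omega>)" for j \<omega>
  have Xm[measurable]: "X j \<in> borel_measurable M" if "j \<in> J" for j
    unfolding X_def using that by measurable
  have Xind: "indep_vars (\<lambda>_. borel) X J"
    unfolding X_def by (intro indep_vars_compose2[OF ind]) auto
  have Xmgf: "(\<integral>\<^sup>+\<omega>. ennreal (exp (x * X j \<omega>)) \<partial>M) \<le> ennreal (exp (x\<^sup>2))" if "j \<in> J" for j x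
    using mgf[OF that, of "of_real x"] by (simp add: X_def)
  note Xint = subgaussian_square_integrable[OF Xm Xmgf]
  \<comment> \<open>Normalised so that the squared coefficients add up to 1; then \<open>V\<close>
    obeys the same bound exp (x^2) as each single variable.\<close>
  define V where "V \<omega> = (\<Sum>j\<in>J. (a j / s) * X j \<omega>)" for \<omega>
  have Vm[measurable]: "V \<in> borel_measurable M" unfolding V_def by measurable
  have s1: "(\<Sum>j\<in>J. (a j / s)\<^sup>2) = 1"
    using s(1) by (simp add: power_divide flip: sum_divide_distrib s(2))
  have "c\<^sub>0 \<le> expectation (\<lambda>\<omega>. (X j \<omega>)\<^sup>2)" if "j \<in> J" for j
    using second[OF that] Xint(2)[OF that that] unfolding X_def[symmetric]
    by (subst (asm) nn_integral_eq_integral) (auto simp: ennreal_le_iff)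
  then have "(\<Sum>j\<in>J. (a j / s)\<^sup>2 * c\<^sub>0) \<le> (\<Sum>j\<in>J. (a j / s)\<^sup>2 * expectation (\<lambda>\<omega>. (X j \<omega>)\<^sup>2))"
    by (intro sum_mono mult_left_mono) auto
  also have "\<dots> = expectation (\<lambda>\<omega>. (V \<omega>)\<^sup>2)"
    unfolding V_def
    by (rule second_moment_indep_sum(1)[symmetric, OF J Xind]) (use Xint subgaussian_mean_zero[OF Xm Xmgf] in auto)
  also have "(\<Sum>j\<in>J. (a j / s)\<^sup>2 * c\<^sub>0) = c\<^sub>0" using s1 by (simp flip: sum_distrib_right)
  finally have "ennreal c\<^sub>0 \<le> ennreal (expectation (\<lambda>\<omega>. (V \<omega>)\<^sup>2))" by (rule ennreal_leI)
  also have "\<dots> = (\<integral>\<^sup>+\<omega>. ennreal ((V \<omega>)\<^sup>2) \<partial>M)"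
    unfolding V_def
    by (intro nn_integral_eq_integral[symmetric] second_moment_indep_sum(2)[OF J Xind])
      (use Xint subgaussian_mean_zero[OF Xm Xmgf] in auto)
  finally have V2: "ennreal c\<^sub>0 \<le> (\<integral>\<^sup>+\<omega>. ennreal ((V \<omega>)\<^sup>2) \<partial>M)" .
  have Vmgf: "(\<integral>\<^sup>+\<omega>. ennreal (exp (x * V \<omega>)) \<partial>M) \<le> ennreal (exp (x\<^sup>2))" for x
  proof -
    have "(\<integral>\<^sup>+\<omega>. ennreal (exp (Re (of_real x * (\<Sum>j\<in>J. \<gamma> j \<omega> * of_real (a j / s))))) \<partial>M)
        \<le> ennreal (exp (1 * cmod (of_real x) powr 2 * (\<Sum>j\<in>J. cmod (of_real (a j / s)) powr 2)))"
      by (rule mgf_indep_sum_le[OF J ind mgf])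
    moreover have "(\<Sum>j\<in>J. cmod (of_real (a j / s)) powr 2) = 1"
      using s1 by (simp add: power_divide del: of_real_divide)
    moreover have "Re (of_real x * (\<Sum>j\<in>J. \<gamma> j \<omega> * of_real (a j / s))) = x * V \<omega>" for \<omega>
      by (simp add: V_def X_def mult_ac del: of_real_divide)
    ultimately show ?thesis by (simp del: times_complex.sel)
  qed
  have V4: "(\<integral>\<^sup>+\<omega>. ennreal ((V \<omega>) ^ 4) \<partial>M) \<le> ennreal (128 * exp 1)"
  proof -
    have "(\<integral>\<^sup>+\<omega>. ennreal ((V \<omega>) ^ 4) \<partial>M)
        \<le> (\<integral>\<^sup>+\<omega>. ennreal 64 * (ennreal (exp (1 * V \<omega>)) + ennreal (exp (-1 * V \<omega>))) \<partial>M)"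
    proof (intro nn_integral_mono)
      fix \<omega>
      have "ennreal ((V \<omega>) ^ 4) \<le> ennreal (64 * (exp (1 * V \<omega>) + exp (-1 * V \<omega>)))"
        using power4_le_exp[of "V \<omega>"] by (intro ennreal_leI) simp
      also have "\<dots> = ennreal 64 * (ennreal (exp (1 * V \<omega>)) + ennreal (exp (-1 * V \<omega>)))"
        by (simp only: ennreal_mult' ennreal_plus exp_ge_zero zero_le_numeral)
      finally show "ennreal ((V \<omega>) ^ 4) \<le> ennreal 64 * (ennreal (exp (1 * V \<omega>)) + ennreal (exp (-1 * V \<omega>)))" .
    qed
    also have "\<dots> = ennreal 64 * ((\<integral>\<^sup>+\<omega>. ennreal (exp (1 * V \<omega>)) \<partial>M) + (\<integral>\<^sup>+\<omega>. ennreal (exp (-1 * V \<omega>)) \<partial>M))"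
      by (subst nn_integral_cmult, measurable) (subst nn_integral_add, auto)
    also have "\<dots> \<le> ennreal 64 * (ennreal (exp (1\<^sup>2)) + ennreal (exp ((-1)\<^sup>2)))"
      by (intro mult_left_mono add_mono Vmgf) auto
    also have "\<dots> = ennreal (128 * exp 1)"
      by (simp flip: ennreal_plus ennreal_mult' ennreal_numeral)
    finally show ?thesis .
  qed
  \<comment> \<open>Chosen so that 128 e / \<tau>^2 = c_0 / 2: the fourth-moment term uses up at
    most half of the lower bound \<open>c\<^sub>0\<close> for E V^2, and \<tau> E |V| must supply
    the other half.\<close>
  define \<tau> where "\<tau> = sqrt (256 * exp 1 / c\<^sub>0)"
  have \<tau>0: "\<tau> > 0" using c0 by (simp add: \<tau>_def)
  have \<tau>2: "\<tau>\<^sup>2 = 256 * exp 1 / c\<^sub>0" using c0 by (simp add: \<tau>_def)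
  have pt: "v\<^sup>2 \<le> \<tau> * \<bar>v\<bar> + v ^ 4 / \<tau>\<^sup>2" for v :: real
  proof (cases "\<bar>v\<bar> \<le> \<tau>")
    case True
    have "v\<^sup>2 = \<bar>v\<bar> * \<bar>v\<bar>" by (simp add: power2_eq_square)
    also have "\<dots> \<le> \<tau> * \<bar>v\<bar>" using True by (intro mult_right_mono) auto
    also have "\<dots> \<le> \<tau> * \<bar>v\<bar> + v ^ 4 / \<tau>\<^sup>2" by simp
    finally show ?thesis .
  next
    case False
    then have "\<tau>\<^sup>2 \<le> \<bar>v\<bar>\<^sup>2" using \<tau>0 by (intro power_mono) auto
    then have "v\<^sup>2 * \<tau>\<^sup>2 \<le> v\<^sup>2 * v\<^sup>2" by (intro mult_left_mono) auto
    also have "v\<^sup>2 * v\<^sup>2 = v ^ 4" by (simp flip: power_add)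
    finally have "v\<^sup>2 \<le> v ^ 4 / \<tau>\<^sup>2" using \<tau>0 by (simp add: pos_le_divide_eq)
    then show ?thesis using \<tau>0 by (simp add: add_increasing)
  qed
  define I where "I = (\<integral>\<^sup>+\<omega>. ennreal \<bar>V \<omega>\<bar> \<partial>M)"
  have "ennreal c\<^sub>0 \<le> (\<integral>\<^sup>+\<omega>. ennreal \<tau> * ennreal \<bar>V \<omega>\<bar> + ennreal (1 / \<tau>\<^sup>2) * ennreal ((V \<omega>) ^ 4) \<partial>M)"
  proof (rule order_trans[OF V2 nn_integral_mono])
    fix \<omega>
    have "ennreal ((V \<omega>)\<^sup>2) \<le> ennreal (\<tau> * \<bar>V \<omega>\<bar> + 1 / \<tau>\<^sup>2 * (V \<omega>) ^ 4)"
      using pt[of "V \<omega>"] by (intro ennreal_leI) simp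
    also have "\<dots> = ennreal \<tau> * ennreal \<bar>V \<omega>\<bar> + ennreal (1 / \<tau>\<^sup>2) * ennreal ((V \<omega>) ^ 4)"
      using \<tau>0 by (simp flip: ennreal_mult ennreal_plus)
    finally show "ennreal ((V \<omega>)\<^sup>2) \<le> \<dots>" .
  qed
  also have "\<dots> = ennreal \<tau> * I + ennreal (1 / \<tau>\<^sup>2) * (\<integral>\<^sup>+\<omega>. ennreal ((V \<omega>) ^ 4) \<partial>M)"
    unfolding I_def by (subst nn_integral_add) (auto simp: nn_integral_cmult)
  also have "\<dots> \<le> ennreal \<tau> * I + ennreal (1 / \<tau>\<^sup>2) * ennreal (128 * exp 1)"
    by (intro add_left_mono mult_left_mono V4) auto
  also have "ennreal (1 / \<tau>\<^sup>2) * ennreal (128 * exp 1) = ennreal (c\<^sub>0 / 2)"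
    using c0 by (subst ennreal_mult'[symmetric]) (auto simp: \<tau>2)
  finally have main: "ennreal c\<^sub>0 \<le> ennreal \<tau> * I + ennreal (c\<^sub>0 / 2)" .
  have VI: "ennreal (c\<^sub>0 / (2 * \<tau>)) \<le> I"
  proof (cases I)
    case (real x)
    then have "ennreal c\<^sub>0 \<le> ennreal (\<tau> * x + c\<^sub>0 / 2)"
      using main \<tau>0 c0 by (simp add: ennreal_plus ennreal_mult')
    then have "c\<^sub>0 \<le> \<tau> * x + c\<^sub>0 / 2"
      using real \<tau>0 c0 by (subst (asm) ennreal_le_iff) auto
    then show ?thesis using real \<tau>0 by (auto simp: field_simps intro!: ennreal_leI)
  qed simp
  have "ennreal (c\<^sub>0 / (2 * \<tau>) * s) = ennreal s * ennreal (c\<^sub>0 / (2 * \<tau>))"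
    using s by (simp add: ennreal_mult'[symmetric] mult.commute)
  also have "\<dots> \<le> ennreal s * I" by (intro mult_left_mono VI) auto
  also have "\<dots> = (\<integral>\<^sup>+\<omega>. ennreal s * ennreal \<bar>V \<omega>\<bar> \<partial>M)"
    unfolding I_def by (rule nn_integral_cmult[symmetric]) measurable
  also have "\<dots> = (\<integral>\<^sup>+\<omega>. ennreal \<bar>\<Sum>j\<in>J. a j * Re (\<gamma> j \<omega>)\<bar> \<partial>M)"
  proof (intro nn_integral_cong)
    fix \<omega>
    have "(\<Sum>j\<in>J. a j * Re (\<gamma> j \<omega>)) = s * V \<omega>"
      using s(1) by (simp add: V_def X_def sum_distrib_left)
    then show "ennreal s * ennreal \<bar>V \<omega>\<bar> = ennreal \<bar>\<Sum>j\<in>J. a j * Re (\<gamma> j \<omega>)\<bar>"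
      using s(1) by (simp add: abs_mult ennreal_mult')
  qed
  finally show ?thesis unfolding \<tau>_def .
qed

end

text \<open>The point is \<open>t \<le> exp (t powr r)\<close>.\<close>
lemma orlicz_norm_ge_first_moment:
  assumes r: "r \<ge> 1" and P: "prob_space P" and Z[measurable]: "Z \<in> borel_measurable P"
    and Z0: "\<And>\<omega>. 0 \<le> Z \<omega>" and Zf: "\<And>\<omega>. Z \<omega> \<le> \<bar>f \<omega>\<bar>"
    and b: "ennreal b \<le> (\<integral>\<^sup>+\<omega>. ennreal (Z \<omega>) \<partial>P)"
  shows "ennreal (b / 2) \<le> orlicz_norm r P f"
  unfolding orlicz_norm_def
proof (intro Inf_greatest, clarify)
  fix \<epsilon> :: real assume \<epsilon>: "\<epsilon> > 0" and le: "(\<integral>\<^sup>+\<omega>. ennreal (orlicz_fun r (\<bar>f \<omega>\<bar> / \<epsilon>)) \<partial>P) \<le> 1"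
  have pt: "t - 1 \<le> orlicz_fun r u" if "0 \<le> t" "t \<le> u" for t u :: real
  proof -
    have "t powr 1 \<le> 1 + t powr r" using that r by (intro powr_le_one_plus_powr) auto
    also have "t powr r \<le> u powr r" using that r by (intro powr_mono2) auto
    also have "1 + u powr r \<le> exp (u powr r)" by (rule exp_ge_add_one_self)
    finally show ?thesis using that by (simp add: orlicz_fun_def)
  qed
  \<comment> \<open>\<open>ennreal\<close> takes the positive part of Z/\<epsilon> - 1, and Z \<le>
    \<epsilon> (1 + that part). The positive part has integral at most 1, so E Z \<le> 2
    \<epsilon>.\<close>
  have "(\<integral>\<^sup>+\<omega>. ennreal (Z \<omega>) \<partial>P) \<le> (\<integral>\<^sup>+\<omega>. ennreal \<epsilon> * (1 + ennreal (Z \<omega> / \<epsilon> - 1)) \<partial>P)"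
  proof (intro nn_integral_mono)
    fix \<omega>
    have "ennreal (Z \<omega>) \<le> ennreal (\<epsilon> * (1 + max 0 (Z \<omega> / \<epsilon> - 1)))"
      using \<epsilon> by (intro ennreal_leI) (auto simp: field_simps max_def)
    also have "\<dots> = ennreal \<epsilon> * (1 + ennreal (Z \<omega> / \<epsilon> - 1))"
      using \<epsilon> by (simp add: ennreal_mult' ennreal_plus)
    finally show "ennreal (Z \<omega>) \<le> ennreal \<epsilon> * (1 + ennreal (Z \<omega> / \<epsilon> - 1))" .
  qed
  also have "\<dots> = ennreal \<epsilon> * (1 + (\<integral>\<^sup>+\<omega>. ennreal (Z \<omega> / \<epsilon> - 1) \<partial>P))"
    using prob_space.emeasure_space_1[OF P]
    by (subst nn_integral_cmult, measurable) (subst nn_integral_add, auto)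
  also have "(\<integral>\<^sup>+\<omega>. ennreal (Z \<omega> / \<epsilon> - 1) \<partial>P) \<le> (\<integral>\<^sup>+\<omega>. ennreal (orlicz_fun r (\<bar>f \<omega>\<bar> / \<epsilon>)) \<partial>P)"
    using Z0 Zf \<epsilon> by (intro nn_integral_mono ennreal_leI pt) (auto simp: divide_right_mono)
  also note le
  also have "ennreal \<epsilon> * (1 + 1) = ennreal (\<epsilon> * 2)"
    using \<epsilon> by (simp add: ennreal_mult' one_add_one)
  finally have "ennreal b \<le> ennreal (\<epsilon> * 2)"
    using b by (meson order_trans add_left_mono mult_left_mono zero_le)
  then have "b \<le> \<epsilon> * 2" using \<epsilon> by (subst (asm) ennreal_le_iff) auto
  then show "ennreal (b / 2) \<le> ennreal \<epsilon>" by (intro ennreal_leI) simp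
qed

text \<open>A real-valued \<open>SUP\<close> is an upper bound only for sets bounded above;
  coordinates of modulus at most 1 give the bound, namely the sum of all |\<gamma>_j c_j|.\<close>

lemma cmod_random_multilinear_le_sup:
  assumes p: "\<And>k. k < length ps \<Longrightarrow> 1 \<le> ps ! k" and len: "length ns = length ps"
    and z: "z \<in> prod_ball K ps ns"
  shows "cmod (random_multilinear \<gamma> c ns \<omega> z) \<le> sup_multilinear K ps \<gamma> c ns \<omega>"
  unfolding sup_multilinear_def
proof (rule cSUP_upper[OF z], rule bdd_aboveI2)
  fix z assume z: "z \<in> prod_ball K ps ns"
  have "cmod (random_multilinear \<gamma> c ns \<omega> z)
      \<le> (\<Sum>js\<in>multi_indices ns. cmod (\<gamma> js \<omega> * c js * (\<Prod>k<length ns. z k (js ! k))))"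
    unfolding random_multilinear_def by (rule norm_sum)
  also have "\<dots> \<le> (\<Sum>js\<in>multi_indices ns. cmod (\<gamma> js \<omega> * c js))"
  proof (intro sum_mono)
    fix js assume js: "js \<in> multi_indices ns"
    have "(\<Prod>k<length ns. cmod (z k (js ! k))) \<le> 1"
    proof (intro prod_le_1 conjI)
      fix k assume "k \<in> {..<length ns}"
      then have "js ! k \<in> {1..ns ! k}" "k < length ps" using js len by (auto simp: multi_indices_def)
      then show "cmod (z k (js ! k)) \<le> 1"
        using cmod_le_lp_norm[OF p, of k "js ! k" "ns ! k" "z k"] prod_ball_lp_norm_le[OF z, of k] by linarith
    qed auto
    then show "cmod (\<gamma> js \<omega> * c js * (\<Prod>k<length ns. z k (js ! k))) \<le> cmod (\<gamma> js \<omega> * c js)"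
      by (subst norm_mult) (auto intro: mult_left_le simp: prod_norm[symmetric])
  qed
  finally show "cmod (random_multilinear \<gamma> c ns \<omega> z) \<le> (\<Sum>js\<in>multi_indices ns. cmod (\<gamma> js \<omega> * c js))" .
qed

text \<open>It maximises the \<open>\<ell>\<^sub>2\<close>-norm on the unit ball of \<open>\<ell>\<^sub>p\<^sup>n\<close>.\<close>
definition test_vector :: "ereal \<Rightarrow> nat \<Rightarrow> nat \<Rightarrow> real" where
  "test_vector p n i =
     (if 2 \<le> p then real n powr (- real_of_ereal (1 / p)) else if i = 1 then 1 else 0)"

lemma lp_norm_test_vector_le:
  assumes p: "1 \<le> p" and n: "1 \<le> n"
  shows "lp_norm p n (\<lambda>i. of_real (test_vector p n i)) \<le> 1"
proof (cases "2 \<le> p")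
  case True
  then show ?thesis by (intro lp_norm_le_of_coordinates[OF p n]) (auto simp: test_vector_def)
next
  case False
  from p show ?thesis
  proof (cases rule: ereal_exponent_cases)
    case infinite
    then show ?thesis using False by simp
  next
    case (finite q)
    have "(\<Sum>i=1..n. cmod (of_real (test_vector p n i)) powr q) = (\<Sum>i=1..n. if i = 1 then 1 else 0)"
      using False by (intro sum.cong) (auto simp: test_vector_def)
    then show ?thesis using n finite by (simp add: lp_norm_def)
  qed
qed

lemma sum_test_vector_square:
  assumes p: "1 \<le> p" and n: "1 \<le> n"
  shows "(\<Sum>i=1..n. (test_vector p n i)\<^sup>2) = (real n powr dim_exponent p)\<^sup>2"
  using p
proof (cases rule: ereal_exponent_cases)
  case infinite
  then show ?thesis using n by (simp add: test_vector_def dim_exponent_def flip: powr_numeral add: powr_powr)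
next
  case (finite q)
  show ?thesis
  proof (cases "2 \<le> q")
    case True
    have m: "max (1 / 2 - 1 / q) 0 = 1 / 2 - 1 / q" using True by (simp add: field_simps max_def)
    have "(\<Sum>i=1..n. (test_vector p n i)\<^sup>2) = (\<Sum>i=1..n. (real n powr (- (1 / q)))\<^sup>2)"
      using True finite by (simp add: test_vector_def)
    also have "\<dots> = real n powr 1 * (real n powr (- (1 / q)) * real n powr (- (1 / q)))"
      by (simp add: power2_eq_square)
    also have "\<dots> = (real n powr (1 / 2 - 1 / q))\<^sup>2"
      unfolding power2_eq_square powr_add[symmetric] by simp
    finally show ?thesis using finite m by (simp add: dim_exponent_def)
  next
    case False
    then have m: "max (1 / 2 - 1 / q) 0 = 0" using finite by (simp add: field_simps max_def)
    have "(\<Sum>i=1..n. (test_vector p n i)\<^sup>2) = (\<Sum>i=1..n. if i = 1 then 1 else 0)"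
      using False finite by (intro sum.cong) (auto simp: test_vector_def)
    then show ?thesis using n finite m by (simp add: dim_exponent_def)
  qed
qed

lemma orlicz_norm_sup_multilinear_ge:
  fixes ps :: "ereal list" and P :: "'a measure"
  assumes ne: "ps \<noteq> []" and p1: "\<forall>p\<in>set ps. 1 \<le> p" and ex: "\<exists>p\<in>set ps. p \<noteq> 1"
    and P: "prob_space P" and K: "\<real> \<subseteq> K"
    and ind: "prob_space.indep_vars P (\<lambda>_. borel) \<gamma> all_multi_indices"
    and mgf: "\<And>j w. j \<in> all_multi_indices \<Longrightarrow>
      (\<integral>\<^sup>+\<omega>. ennreal (exp (Re (w * \<gamma> j \<omega>))) \<partial>P) \<le> ennreal (exp (1 * cmod w powr 2))"
    and c0: "c\<^sub>0 > 0" and second: "\<And>j. j \<in> all_multi_indices \<Longrightarrow>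
      ennreal c\<^sub>0 \<le> (\<integral>\<^sup>+\<omega>. ennreal ((Re (\<gamma> j \<omega>))\<^sup>2) \<partial>P)"
    and n: "1 \<le> n"
  defines "r \<equiv> r_exponent ps"
  shows "ennreal (c\<^sub>0 / (2 * sqrt (256 * exp 1 / c\<^sub>0)) / 2 *
      real n powr (1 / r + (\<Sum>k<length ps. dim_exponent (ps ! k))))
    \<le> orlicz_norm r P (sup_multilinear K ps \<gamma> (\<lambda>_. 1) (replicate (length ps) n))"
proof -
  interpret prob_space P by fact
  define m where "m = length ps"
  define ns where "ns = replicate m n"
  define C where "C = c\<^sub>0 / (2 * sqrt (256 * exp 1 / c\<^sub>0))"
  have C0: "C > 0" using c0 by (simp add: C_def)
  note r = r_exponent_properties[OF ne p1 ex, folded r_def]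
  obtain k\<^sub>0 where k\<^sub>0: "k\<^sub>0 < m"
    "1 - real_of_ereal (1 / ps ! k\<^sub>0) = 1 / r + dim_exponent (ps ! k\<^sub>0)"
    using r(3) unfolding m_def by (metis in_set_conv_nth)
  have p: "1 \<le> ps ! k" if "k < m" for k using p1 that by (auto simp: m_def)
  have len: "length ns = length ps" and lenm: "length ns = m" by (simp_all add: ns_def m_def)
  have nsk: "ns ! k = n" if "k < m" for k using that by (simp add: ns_def)
  have sub: "multi_indices ns \<subseteq> all_multi_indices"
    using ne n by (intro multi_indices_subset) (auto simp: ns_def m_def)
  define d where "d k = real n powr dim_exponent (ps ! k)" for k
  define e where "e = real n powr (- real_of_ereal (1 / ps ! k\<^sub>0))"
  define A where "A js = (\<Prod>k\<in>{..<m} - {k\<^sub>0}. test_vector (ps ! k) n (js ! k))" for js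
  define J where "J i = {js \<in> multi_indices ns. js ! k\<^sub>0 = i}" for i
  define Y where "Y i \<omega> = (\<Sum>js\<in>J i. A js * Re (\<gamma> js \<omega>))" for i \<omega>
  define Z where "Z \<omega> = e * (\<Sum>i=1..n. \<bar>Y i \<omega>\<bar>)" for \<omega>
  define s where "s = (\<Prod>k\<in>{..<m} - {k\<^sub>0}. d k)"
  have d0: "d k > 0" for k using n by (simp add: d_def)
  have s0: "s > 0" unfolding s_def using d0 by (intro prod_pos) auto
  have finJ: "finite (J i)" for i by (simp add: J_def)
  have JA: "J i \<subseteq> all_multi_indices" for i using sub by (auto simp: J_def)
  have \<gamma>m[measurable]: "\<gamma> js \<in> borel_measurable P" if "js \<in> J i" for js i
    using indep_vars_measurable[OF P ind] JA that by blast
  have Ym[measurable]: "Y i \<in> borel_measurable P" for i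
    unfolding Y_def by measurable
  have sum_sq: "s\<^sup>2 = (\<Sum>js\<in>J i. (A js)\<^sup>2)" if i: "i \<in> {1..n}" for i
  proof -
    \<comment> \<open>The indicator of x = i in slot \<open>k\<^sub>0\<close> turns the sum over the
      slice \<open>J i\<close> into a sum over all multi-indices, which factorises.\<close>
    let ?f = "\<lambda>k x. if k = k\<^sub>0 then (if x = i then 1 else 0) else (test_vector (ps ! k) n x)\<^sup>2"
    have "(\<Sum>js\<in>J i. (A js)\<^sup>2) = (\<Sum>js\<in>multi_indices ns. if js ! k\<^sub>0 = i then (A js)\<^sup>2 else 0)"
      unfolding J_def by (subst sum.inter_filter[symmetric]) auto
    also have "\<dots> = (\<Sum>js\<in>multi_indices ns. \<Prod>k<length ns. ?f k (js ! k))"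
    proof (intro sum.cong refl)
      fix js
      have "(\<Prod>k<length ns. ?f k (js ! k)) = ?f k\<^sub>0 (js ! k\<^sub>0) * (\<Prod>k\<in>{..<m} - {k\<^sub>0}. ?f k (js ! k))"
        unfolding lenm using k\<^sub>0(1) by (subst prod.remove[of _ k\<^sub>0]) auto
      also have "(\<Prod>k\<in>{..<m} - {k\<^sub>0}. ?f k (js ! k)) = (A js)\<^sup>2"
        unfolding A_def prod_power_distrib by (intro prod.cong) auto
      finally show "(if js ! k\<^sub>0 = i then (A js)\<^sup>2 else 0) = (\<Prod>k<length ns. ?f k (js ! k))" by simp
    qed
    also have "\<dots> = (\<Prod>k<length ns. \<Sum>x=1..ns ! k. ?f k x)"
      by (rule sum_multi_indices_prod)
    also have "\<dots> = (\<Sum>x=1..ns ! k\<^sub>0. ?f k\<^sub>0 x) * (\<Prod>k\<in>{..<m} - {k\<^sub>0}. \<Sum>x=1..ns ! k. ?f k x)"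
      unfolding lenm using k\<^sub>0(1) by (subst prod.remove[of _ k\<^sub>0]) auto
    also have "(\<Sum>x=1..ns ! k\<^sub>0. ?f k\<^sub>0 x) = 1" using i nsk[OF k\<^sub>0(1)] by simp
    also have "(\<Prod>k\<in>{..<m} - {k\<^sub>0}. \<Sum>x=1..ns ! k. ?f k x) = (\<Prod>k\<in>{..<m} - {k\<^sub>0}. (d k)\<^sup>2)"
      using sum_test_vector_square[OF p n] nsk by (intro prod.cong) (auto simp: d_def)
    finally show ?thesis by (simp add: s_def prod_power_distrib)
  qed
  have EY: "ennreal (C * s) \<le> (\<integral>\<^sup>+\<omega>. ennreal \<bar>Y i \<omega>\<bar> \<partial>P)" if i: "i \<in> {1..n}" for i
    unfolding C_def Y_def
    by (rule first_moment_indep_sum_ge[OF finJ indep_vars_subset[OF ind JA] _ c0 _ s0 sum_sq[OF i]])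
      (use mgf second JA in blast)+
  have e0: "e > 0" using n by (simp add: e_def)
  have "e * n * s = real n powr (1 / r + (\<Sum>k<length ps. dim_exponent (ps ! k)))"
  proof -
    have "e * n = real n powr (1 - real_of_ereal (1 / ps ! k\<^sub>0))"
      using n by (simp add: e_def powr_diff powr_minus field_simps)
    also have "\<dots> = real n powr (1 / r) * d k\<^sub>0"
      unfolding k\<^sub>0(2) d_def by (rule powr_add)
    finally have "e * n * s = real n powr (1 / r) * (\<Prod>k<m. d k)"
      using k\<^sub>0(1) by (simp add: s_def prod.remove[of "{..<m}" k\<^sub>0] mult.assoc)
    then show ?thesis
      using n by (simp add: d_def m_def powr_add powr_sum)
  qed
  then have "ennreal (C * real n powr (1 / r + (\<Sum>k<length ps. dim_exponent (ps ! k))))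
      = ennreal (e * (n * (C * s)))" by (simp add: mult_ac)
  also have "\<dots> = ennreal e * (\<Sum>i=1..n. ennreal (C * s))"
    using e0 C0 s0 by (simp add: ennreal_mult' ennreal_of_nat_eq_real_of_nat)
  also have "\<dots> \<le> ennreal e * (\<Sum>i=1..n. \<integral>\<^sup>+\<omega>. ennreal \<bar>Y i \<omega>\<bar> \<partial>P)"
    by (intro mult_left_mono sum_mono EY) auto
  also have "\<dots> = (\<integral>\<^sup>+\<omega>. ennreal (Z \<omega>) \<partial>P)"
    unfolding Z_def using e0
    by (simp add: ennreal_mult' nn_integral_cmult nn_integral_sum flip: sum_ennreal)
  finally have EZ: "ennreal (C * real n powr (1 / r + (\<Sum>k<length ps. dim_exponent (ps ! k))))
      \<le> (\<integral>\<^sup>+\<omega>. ennreal (Z \<omega>) \<partial>P)" .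
  have ZS: "Z \<omega> \<le> \<bar>sup_multilinear K ps \<gamma> (\<lambda>_. 1) ns \<omega>\<bar>" for \<omega>
  proof -
    \<comment> \<open>The signs depend on \<omega>, which is legitimate because the supremum is
      taken for each \<omega> separately. They are real, so the point lies in the ball over either
      field.\<close>
    define x where "x i = complex_of_real (e * (if Y i \<omega> \<ge> 0 then 1 else -1))" for i
    define u where "u k i = complex_of_real (test_vector (ps ! k) n i)" for k i
    define z where "z = (\<lambda>k\<in>{..<m}. restrict ((u(k\<^sub>0 := x)) k) {1..n})"
    have z: "z \<in> prod_ball K ps ns"
      unfolding prod_ball_def
    proof (rule PiE_I)
      fix k assume k: "k \<in> {..<length ps}"
      have cong: "lp_norm q n (restrict y {1..n}) = lp_norm q n y" for q y
        by (simp add: lp_norm_def)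
      have "lp_norm (ps ! k) n ((u(k\<^sub>0 := x)) k) \<le> 1"
      proof (cases "k = k\<^sub>0")
        case True
        then show ?thesis
          using lp_norm_le_of_coordinates[OF p[OF k\<^sub>0(1)] n, of 1 x] e0 by (simp add: x_def e_def)
      next
        case False
        then show ?thesis
          using lp_norm_test_vector_le[OF p n, of k] k by (simp add: u_def[abs_def] m_def)
      qed
      moreover have "(u(k\<^sub>0 := x)) k i \<in> K" for i
        using K Reals_of_real by (auto simp: u_def x_def)
      ultimately show "z k \<in> lp_ball K (ps ! k) (ns ! k)"
        using k nsk[of k] by (auto simp: z_def lp_ball_def m_def cong simp del: One_nat_def)
    qed (simp add: z_def m_def)
    have "random_multilinear \<gamma> (\<lambda>_. 1) ns \<omega> z
        = (\<Sum>js\<in>multi_indices ns. \<gamma> js \<omega> * (\<Prod>l\<in>{..<m} - {k\<^sub>0}. u l (js ! l)) * x (js ! k\<^sub>0))"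
    proof -
      have "random_multilinear \<gamma> (\<lambda>_. 1) ns \<omega> z = random_multilinear \<gamma> (\<lambda>_. 1) ns \<omega> (u(k\<^sub>0 := x))"
        unfolding random_multilinear_def
      proof (intro sum.cong refl arg_cong2[where f = "(*)"] prod.cong)
        fix js k assume js: "js \<in> multi_indices ns" and k: "k \<in> {..<length ns}"
        then have "js ! k \<in> {1..n}" using nsk[of k] lenm by (auto simp: multi_indices_def)
        then show "z k (js ! k) = (u(k\<^sub>0 := x)) k (js ! k)" using k lenm by (simp add: z_def)
      qed
      then show ?thesis using random_multilinear_fun_upd[of k\<^sub>0 ns \<gamma> "\<lambda>_. 1" \<omega> u x] k\<^sub>0(1) lenm by simp
    qed
    also have "\<dots> = (\<Sum>js\<in>multi_indices ns. \<gamma> js \<omega> * of_real (A js * (e * (if Y (js ! k\<^sub>0) \<omega> \<ge> 0 then 1 else -1))))"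
      by (simp add: u_def x_def A_def mult.assoc)
    \<comment> \<open>All factors besides the \<gamma>_j are real, so taking real parts reduces
      complex variables to real ones; Re \<le> cmod makes this a lower bound.\<close>
    finally have "Re (random_multilinear \<gamma> (\<lambda>_. 1) ns \<omega> z)
        = (\<Sum>js\<in>multi_indices ns. Re (\<gamma> js \<omega>) * (A js * (e * (if Y (js ! k\<^sub>0) \<omega> \<ge> 0 then 1 else -1))))"
      by (simp only: Re_sum times_complex.sel Re_complex_of_real Im_complex_of_real mult_zero_right diff_zero)
    also have "\<dots> = (\<Sum>i=1..n. \<Sum>js\<in>J i. Re (\<gamma> js \<omega>) * (A js * (e * (if Y (js ! k\<^sub>0) \<omega> \<ge> 0 then 1 else -1))))"
      unfolding J_def
      by (rule sum.group[symmetric, OF finite_multi_indices]) (use k\<^sub>0(1) nsk lenm in \<open>auto simp: multi_indices_def\<close>)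
    also have "\<dots> = (\<Sum>i=1..n. e * \<bar>Y i \<omega>\<bar>)"
    proof (intro sum.cong refl)
      fix i
      have "(\<Sum>js\<in>J i. Re (\<gamma> js \<omega>) * (A js * (e * (if Y (js ! k\<^sub>0) \<omega> \<ge> 0 then 1 else -1))))
          = e * (if Y i \<omega> \<ge> 0 then 1 else -1) * Y i \<omega>"
        unfolding Y_def[of i] sum_distrib_left
        by (intro sum.cong refl) (auto simp: J_def Y_def)
      then show "(\<Sum>js\<in>J i. Re (\<gamma> js \<omega>) * (A js * (e * (if Y (js ! k\<^sub>0) \<omega> \<ge> 0 then 1 else -1))))
          = e * \<bar>Y i \<omega>\<bar>" by (simp add: abs_if)
    qed
    also have "\<dots> = Z \<omega>" by (simp add: Z_def sum_distrib_left)
    finally have "Z \<omega> = Re (random_multilinear \<gamma> (\<lambda>_. 1) ns \<omega> z)" ..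
    also have "\<dots> \<le> cmod (random_multilinear \<gamma> (\<lambda>_. 1) ns \<omega> z)" by (rule complex_Re_le_cmod)
    also have "\<dots> \<le> sup_multilinear K ps \<gamma> (\<lambda>_. 1) ns \<omega>"
      using p by (intro cmod_random_multilinear_le_sup len z) (simp add: m_def)
    finally show ?thesis by linarith
  qed
  have "ennreal (C * real n powr (1 / r + (\<Sum>k<length ps. dim_exponent (ps ! k))) / 2)
      \<le> orlicz_norm r P (sup_multilinear K ps \<gamma> (\<lambda>_. 1) ns)"
  proof (rule orlicz_norm_ge_first_moment[OF _ P _ _ ZS EZ])
    show "Z \<in> borel_measurable P" unfolding Z_def by measurable
    show "0 \<le> Z \<omega>" for \<omega> unfolding Z_def using e0 by (intro mult_nonneg_nonneg sum_nonneg) auto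
  qed (use r(1) in simp)
  then show ?thesis by (simp add: C_def ns_def m_def)
qed

text \<open>\<open>sg\<close> is an infimum, so an admissible constant below s + 1 is picked rather
  than one equal to s; this affects only the size of the final constant.\<close>

lemma family_mgf_le:
  fixes s M :: real
  assumes P: "prob_space P" and q: "1 \<le> q" "q \<le> 2"
    and sub: "\<forall>j\<in>J. subgaussian P (\<gamma> j)"
    and s: "(SUP j\<in>J. ereal (sg P (\<gamma> j))) = ereal s"
    and M: "q = 2 \<or> (SUP j\<in>J. esssup P (\<lambda>\<omega>. ereal (cmod (\<gamma> j \<omega>)))) = ereal M"
    and j: "j \<in> J"
  shows "(\<integral>\<^sup>+\<omega>. ennreal (exp (Re (w * \<gamma> j \<omega>))) \<partial>P)
    \<le> ennreal (exp (max ((s + 1)\<^sup>2 / 2) M * cmod w powr q))"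
proof (rule mgf_interpolate_bounded[OF P q])
  have "ereal (sg P (\<gamma> j)) \<le> ereal s" unfolding s[symmetric] using j by (rule SUP_upper)
  then have "Inf {t. subgaussian_with P (\<gamma> j) t} < s + 1" by (simp add: sg_def)
  moreover have "{t. subgaussian_with P (\<gamma> j) t} \<noteq> {}" using sub j by (auto simp: subgaussian_def)
  ultimately obtain t where t: "subgaussian_with P (\<gamma> j) t" "t < s + 1"
    by (metis cInf_lessD mem_Collect_eq)
  show "(\<integral>\<^sup>+\<omega>. ennreal (exp (Re (w * \<gamma> j \<omega>))) \<partial>P) \<le> ennreal (exp ((s + 1)\<^sup>2 / 2 * cmod w powr 2))" for w
    using t by (intro mgf_of_subgaussian_with) auto
  show "q = 2 \<or> (AE \<omega> in P. cmod (\<gamma> j \<omega>) \<le> M)"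
    using M
  proof
    assume M: "(SUP j\<in>J. esssup P (\<lambda>\<omega>. ereal (cmod (\<gamma> j \<omega>)))) = ereal M"
    have "esssup P (\<lambda>\<omega>. ereal (cmod (\<gamma> j \<omega>))) \<le> ereal M" unfolding M[symmetric] using j by (rule SUP_upper)
    then have "AE \<omega> in P. cmod (\<gamma> j \<omega>) \<le> M"
      using esssup_AE[of "\<lambda>\<omega>. ereal (cmod (\<gamma> j \<omega>))" P]
      by (auto elim!: eventually_mono dest: order_trans)
    then show ?thesis ..
  qed simp
qed simp

theorem theorem6p21:
  fixes ps :: "ereal list"
  assumes "ps \<noteq> []" and "\<forall>p\<in>set ps. 1 \<le> p" and "\<exists>p\<in>set ps. p \<noteq> 1"
  shows
    "(\<forall>s M :: real. \<exists>C>0.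
        \<forall>(P :: 'a measure) \<gamma> K c ns.
          prob_space P \<longrightarrow>
          K = \<real> \<or> K = UNIV \<longrightarrow>
          prob_space.indep_vars P (\<lambda>_. borel) \<gamma> all_multi_indices \<longrightarrow>
          (\<forall>j\<in>all_multi_indices. subgaussian P (\<gamma> j)) \<longrightarrow>
          (SUP j\<in>all_multi_indices. ereal (sg P (\<gamma> j))) = ereal s \<longrightarrow>
          (r_exponent ps > 2 \<longrightarrow>
             (SUP j\<in>all_multi_indices. esssup P (\<lambda>\<omega>. ereal (cmod (\<gamma> j \<omega>)))) = ereal M) \<longrightarrow>
          length ns = length ps \<longrightarrow> (\<forall>n\<in>set ns. 1 \<le> n) \<longrightarrow>
          (\<forall>j\<in>multi_indices ns. c j \<in> K) \<longrightarrow>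
          orlicz_norm (r_exponent ps) P (sup_multilinear K ps \<gamma> c ns) \<le>
            ennreal (C * (1 + ln (real (length ps))) powr (1 / r_exponent ps) *
              (SUP j\<in>multi_indices ns. cmod (c j)) *
              (\<Sum>k<length ps. real (ns ! k)) powr (1 / r_exponent ps) *
              (\<Prod>k<length ps. real (ns ! k) powr dim_exponent (ps ! k)))) \<and>
     (\<exists>c\<^sub>1>0. \<exists>c\<^sub>2>0.
        \<forall>(P :: 'a measure) \<gamma> K n.
          prob_space P \<longrightarrow>
          K = \<real> \<or> K = UNIV \<longrightarrow>
          prob_space.indep_vars P (\<lambda>_. borel) \<gamma> all_multi_indices \<longrightarrow>
          (\<forall>j\<in>all_multi_indices. rademacher P (\<gamma> j) \<or> steinhaus P (\<gamma> j) \<or>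
             (r_exponent ps = 2 \<and> normal_gaussian P (\<gamma> j))) \<longrightarrow>
          1 \<le> n \<longrightarrow>
          ennreal (c\<^sub>1 * real n powr (1 / r_exponent ps + (\<Sum>k<length ps. dim_exponent (ps ! k))))
            \<le> orlicz_norm (r_exponent ps) P
                (sup_multilinear K ps \<gamma> (\<lambda>_. 1) (replicate (length ps) n)) \<and>
          orlicz_norm (r_exponent ps) P
              (sup_multilinear K ps \<gamma> (\<lambda>_. 1) (replicate (length ps) n))
            \<le> ennreal (c\<^sub>2 * real n powr (1 / r_exponent ps + (\<Sum>k<length ps. dim_exponent (ps ! k)))))"
proof (intro conjI allI)
  define r where "r = r_exponent ps"
  define q where "q = r / (r - 1)"
  have r2: "2 \<le> r" using r_exponent_properties(1)[OF assms] by (simp add: r_def)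
  have q: "1 \<le> q" "q \<le> 2" and q2: "q = 2 \<longleftrightarrow> r = 2" using r2 by (auto simp: q_def field_simps)
  fix s M :: real
  \<comment> \<open>\<open>M\<close> is an arbitrary real at this point; the square keeps the mgf
    constant nonnegative.\<close>
  have "max ((s + 1)\<^sup>2 / 2) M \<ge> 0" by (simp add: le_max_iff_disj)
  from orlicz_norm_sup_multilinear_le[OF assms this, folded r_def, where 'a = 'a]
  obtain C where C: "C > 0" and
    up: "\<And>(P :: 'a measure) \<gamma> K c ns R.
       prob_space P \<Longrightarrow> 0 \<in> K \<Longrightarrow> prob_space.indep_vars P (\<lambda>_. borel) \<gamma> all_multi_indices \<Longrightarrow>
       (\<And>j w. j \<in> all_multi_indices \<Longrightarrow>
          (\<integral>\<^sup>+\<omega>. ennreal (exp (Re (w * \<gamma> j \<omega>))) \<partial>P)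
            \<le> ennreal (exp (max ((s + 1)\<^sup>2 / 2) M * cmod w powr q))) \<Longrightarrow>
       length ns = length ps \<Longrightarrow> \<forall>n\<in>set ns. 1 \<le> n \<Longrightarrow>
       (\<And>j. j \<in> multi_indices ns \<Longrightarrow> cmod (c j) \<le> R) \<Longrightarrow> R > 0 \<Longrightarrow>
       orlicz_norm r P (sup_multilinear K ps \<gamma> c ns)
         \<le> ennreal (C * R * (\<Sum>k<length ps. real (ns ! k)) powr (1 / r) *
              (\<Prod>k<length ps. real (ns ! k) powr dim_exponent (ps ! k)))"
    unfolding q_def by blast
  let ?B = "\<lambda>(c :: nat list \<Rightarrow> complex) ns. C * (1 + ln (real (length ps))) powr (1 / r) *
      (SUP j\<in>multi_indices ns. cmod (c j)) *
      (\<Sum>k<length ps. real (ns ! k)) powr (1 / r) *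
      (\<Prod>k<length ps. real (ns ! k) powr dim_exponent (ps ! k))"
  have main: "orlicz_norm r P (sup_multilinear K ps \<gamma> c ns) \<le> ennreal (?B c ns)"
    if P: "prob_space P" and K: "K = \<real> \<or> K = UNIV"
      and ind: "prob_space.indep_vars P (\<lambda>_. borel) \<gamma> all_multi_indices"
      and sub: "\<forall>j\<in>all_multi_indices. subgaussian P (\<gamma> j)"
      and s: "(SUP j\<in>all_multi_indices. ereal (sg P (\<gamma> j))) = ereal s"
      and M: "r > 2 \<longrightarrow> (SUP j\<in>all_multi_indices. esssup P (\<lambda>\<omega>. ereal (cmod (\<gamma> j \<omega>)))) = ereal M"
      and len: "length ns = length ps" and ns: "\<forall>n\<in>set ns. 1 \<le> n"
    for P :: "'a measure" and \<gamma> K c ns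
  \<comment> \<open>All coefficients may vanish, while \<open>up\<close> asks for a positive bound.
    Enlarging their supremum by \<epsilon> / (C X) adds exactly \<epsilon> to the right-hand
    side.\<close>
  proof (rule ennreal_le_epsilon)
    fix \<epsilon> :: real assume \<epsilon>: "\<epsilon> > 0"
    define R where "R = (SUP j\<in>multi_indices ns. cmod (c j))"
    define X where "X = (\<Sum>k<length ps. real (ns ! k)) powr (1 / r) *
      (\<Prod>k<length ps. real (ns ! k) powr dim_exponent (ps ! k))"
    have nk: "real (ns ! k) > 0" if "k < length ps" for k
      using ns len that by (metis nth_mem less_le_trans of_nat_0_less_iff zero_less_one)
    have X0: "X > 0" unfolding X_def
    proof (intro mult_pos_pos prod_pos ballI)
      have "0 < (\<Sum>k<length ps. real (ns ! k))" using assms(1) nk by (intro sum_pos) auto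
      then show "0 < (\<Sum>k<length ps. real (ns ! k)) powr (1 / r)" by simp
      show "0 < real (ns ! k) powr dim_exponent (ps ! k)" if "k \<in> {..<length ps}" for k
        using nk[of k] that by simp
    qed
    have cR: "cmod (c j) \<le> R" if "j \<in> multi_indices ns" for j
      unfolding R_def using that by (intro cSUP_upper) auto
    have "replicate (length ns) 1 \<in> multi_indices ns"
      using ns by (auto simp: multi_indices_def)
    from order_trans[OF norm_ge_zero cR[OF this]] have R0: "R \<ge> 0" .
    have R': "R + \<epsilon> / (C * X) > 0" using R0 \<epsilon> C X0 by (intro add_nonneg_pos) auto
    \<comment> \<open>The logarithmic factor is at least 1 because the list of exponents is
      nonempty, so it may be inserted into the bound.\<close>
    have L: "1 \<le> (1 + ln (real (length ps))) powr (1 / r)"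
      using assms(1) r2 by (intro ge_one_powr_ge_zero) (auto simp: Suc_le_eq)
    have "orlicz_norm r P (sup_multilinear K ps \<gamma> c ns)
        \<le> ennreal (C * (R + \<epsilon> / (C * X)) * (\<Sum>k<length ps. real (ns ! k)) powr (1 / r) *
              (\<Prod>k<length ps. real (ns ! k) powr dim_exponent (ps ! k)))"
    proof (rule up[OF P _ ind _ len ns _ R'])
      show "0 \<in> K" using K by auto
      show "(\<integral>\<^sup>+\<omega>. ennreal (exp (Re (w * \<gamma> j \<omega>))) \<partial>P)
            \<le> ennreal (exp (max ((s + 1)\<^sup>2 / 2) M * cmod w powr q))" if "j \<in> all_multi_indices" for j w
        by (rule family_mgf_le[OF P q sub s _ that]) (use M r2 q2 in auto)
      show "cmod (c j) \<le> R + \<epsilon> / (C * X)" if "j \<in> multi_indices ns" for j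
        using cR[OF that] \<epsilon> C X0 by (intro add_increasing2) auto
    qed
    also have "C * (R + \<epsilon> / (C * X)) * (\<Sum>k<length ps. real (ns ! k)) powr (1 / r) *
              (\<Prod>k<length ps. real (ns ! k) powr dim_exponent (ps ! k)) = C * R * X + \<epsilon>"
    proof -
      have "C * (R + \<epsilon> / (C * X)) * X = C * R * X + \<epsilon>" using C X0 by (simp add: field_simps)
      then show ?thesis by (simp only: X_def mult.assoc)
    qed
    also have "ennreal (C * R * X + \<epsilon>) \<le> ennreal (?B c ns + \<epsilon>)"
    proof (intro ennreal_leI add_right_mono)
      have "C * R * X * 1 \<le> C * R * X * (1 + ln (real (length ps))) powr (1 / r)"
        using L C R0 X0 by (intro mult_left_mono) auto
      then show "C * R * X \<le> ?B c ns" by (simp add: R_def X_def mult_ac)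
    qed
    also have "\<dots> = ennreal (?B c ns) + ennreal \<epsilon>"
      using C R0 \<epsilon> by (intro ennreal_plus mult_nonneg_nonneg prod_nonneg) (auto simp: R_def)
    finally show "orlicz_norm r P (sup_multilinear K ps \<gamma> c ns) \<le> ennreal (?B c ns) + ennreal \<epsilon>" .
  qed
  show "\<exists>C>0. \<forall>(P :: 'a measure) \<gamma> K c ns.
          prob_space P \<longrightarrow>
          K = \<real> \<or> K = UNIV \<longrightarrow>
          prob_space.indep_vars P (\<lambda>_. borel) \<gamma> all_multi_indices \<longrightarrow>
          (\<forall>j\<in>all_multi_indices. subgaussian P (\<gamma> j)) \<longrightarrow>
          (SUP j\<in>all_multi_indices. ereal (sg P (\<gamma> j))) = ereal s \<longrightarrow>
          (r_exponent ps > 2 \<longrightarrow>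
             (SUP j\<in>all_multi_indices. esssup P (\<lambda>\<omega>. ereal (cmod (\<gamma> j \<omega>)))) = ereal M) \<longrightarrow>
          length ns = length ps \<longrightarrow> (\<forall>n\<in>set ns. 1 \<le> n) \<longrightarrow>
          (\<forall>j\<in>multi_indices ns. c j \<in> K) \<longrightarrow>
          orlicz_norm (r_exponent ps) P (sup_multilinear K ps \<gamma> c ns) \<le>
            ennreal (C * (1 + ln (real (length ps))) powr (1 / r_exponent ps) *
              (SUP j\<in>multi_indices ns. cmod (c j)) *
              (\<Sum>k<length ps. real (ns ! k)) powr (1 / r_exponent ps) *
              (\<Prod>k<length ps. real (ns ! k) powr dim_exponent (ps ! k)))"
    unfolding r_def[symmetric]
    by (intro exI[of _ C] conjI[OF C] allI impI, rule main) assumption+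
next
  define r where "r = r_exponent ps"
  define q where "q = r / (r - 1)"
  have r2: "2 \<le> r" using r_exponent_properties(1)[OF assms] by (simp add: r_def)
  have q: "1 \<le> q" "q \<le> 2" and q2: "q = 2 \<longleftrightarrow> r = 2" using r2 by (auto simp: q_def field_simps)
  obtain c\<^sub>0 :: real where c\<^sub>0: "c\<^sub>0 > 0" and
    second: "\<And>(P :: 'a measure) f. prob_space P \<Longrightarrow> rademacher P f \<or> steinhaus P f \<or> normal_gaussian P f \<Longrightarrow>
       ennreal c\<^sub>0 \<le> (\<integral>\<^sup>+\<omega>. ennreal ((Re (f \<omega>))\<^sup>2) \<partial>P)"
    by (rule special_second_moment_ge) blast
  define c\<^sub>1 where "c\<^sub>1 = c\<^sub>0 / (2 * sqrt (256 * exp 1 / c\<^sub>0)) / 2"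
  have c\<^sub>1: "c\<^sub>1 > 0" using c\<^sub>0 by (simp add: c\<^sub>1_def)
  from orlicz_norm_sup_multilinear_le[OF assms zero_le_one, folded r_def, where 'a = 'a]
  obtain C where C: "C > 0" and
    up: "\<And>(P :: 'a measure) \<gamma> K c ns R.
       prob_space P \<Longrightarrow> 0 \<in> K \<Longrightarrow> prob_space.indep_vars P (\<lambda>_. borel) \<gamma> all_multi_indices \<Longrightarrow>
       (\<And>j w. j \<in> all_multi_indices \<Longrightarrow>
          (\<integral>\<^sup>+\<omega>. ennreal (exp (Re (w * \<gamma> j \<omega>))) \<partial>P) \<le> ennreal (exp (1 * cmod w powr q))) \<Longrightarrow>
       length ns = length ps \<Longrightarrow> \<forall>n\<in>set ns. 1 \<le> n \<Longrightarrow>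
       (\<And>j. j \<in> multi_indices ns \<Longrightarrow> cmod (c j) \<le> R) \<Longrightarrow> R > 0 \<Longrightarrow>
       orlicz_norm r P (sup_multilinear K ps \<gamma> c ns)
         \<le> ennreal (C * R * (\<Sum>k<length ps. real (ns ! k)) powr (1 / r) *
              (\<Prod>k<length ps. real (ns ! k) powr dim_exponent (ps ! k)))"
    unfolding q_def by blast
  \<comment> \<open>With all dimensions equal to n their sum is m n, and m^(1/r) moves into the
    constant.\<close>
  define c\<^sub>2 where "c\<^sub>2 = C * real (length ps) powr (1 / r)"
  have c\<^sub>2: "c\<^sub>2 > 0" using C assms(1) by (simp add: c\<^sub>2_def)
  let ?E = "\<lambda>n. real n powr (1 / r + (\<Sum>k<length ps. dim_exponent (ps ! k)))"
  have main: "ennreal (c\<^sub>1 * ?E n) \<le> orlicz_norm r P (sup_multilinear K ps \<gamma> (\<lambda>_. 1) (replicate (length ps) n)) \<and>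
      orlicz_norm r P (sup_multilinear K ps \<gamma> (\<lambda>_. 1) (replicate (length ps) n)) \<le> ennreal (c\<^sub>2 * ?E n)"
    if P: "prob_space P" and K: "K = \<real> \<or> K = UNIV"
      and ind: "prob_space.indep_vars P (\<lambda>_. borel) \<gamma> all_multi_indices"
      and law: "\<forall>j\<in>all_multi_indices. rademacher P (\<gamma> j) \<or> steinhaus P (\<gamma> j) \<or> (r = 2 \<and> normal_gaussian P (\<gamma> j))"
      and n: "1 \<le> n"
    for P :: "'a measure" and \<gamma> K n
  proof
    have law': "rademacher P (\<gamma> j) \<or> steinhaus P (\<gamma> j) \<or> normal_gaussian P (\<gamma> j)"
      if "j \<in> all_multi_indices" for j using law that by blast
    have RK: "\<real> \<subseteq> K" using K by auto
    show "ennreal (c\<^sub>1 * ?E n) \<le> orlicz_norm r P (sup_multilinear K ps \<gamma> (\<lambda>_. 1) (replicate (length ps) n))"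
      unfolding c\<^sub>1_def r_def
      by (rule orlicz_norm_sup_multilinear_ge[OF assms P RK ind special_mgf_le[OF P law'] c\<^sub>0 second[OF P law'] n])
    have "orlicz_norm r P (sup_multilinear K ps \<gamma> (\<lambda>_. 1) (replicate (length ps) n))
        \<le> ennreal (C * 1 * (\<Sum>k<length ps. real (replicate (length ps) n ! k)) powr (1 / r) *
              (\<Prod>k<length ps. real (replicate (length ps) n ! k) powr dim_exponent (ps ! k)))"
    proof (rule up[OF P _ ind])
      show "0 \<in> K" using K by auto
      show "(\<integral>\<^sup>+\<omega>. ennreal (exp (Re (w * \<gamma> j \<omega>))) \<partial>P) \<le> ennreal (exp (1 * cmod w powr q))"
        if j: "j \<in> all_multi_indices" for j w
      proof -
        \<comment> \<open>For r > 2 only Rademacher and Steinhaus variables remain, and these have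
          modulus 1 almost everywhere.\<close>
        have "q = 2 \<or> (AE \<omega> in P. cmod (\<gamma> j \<omega>) \<le> 1)"
        proof (cases "r = 2")
          case False
          then consider "rademacher P (\<gamma> j)" | "steinhaus P (\<gamma> j)" using law j by blast
          then have "AE \<omega> in P. cmod (\<gamma> j \<omega>) \<le> 1"
          proof cases
            case 1
            show ?thesis using rademacher_AE[OF P 1] by (auto elim!: eventually_mono)
          next
            case 2
            show ?thesis using steinhaus_AE[OF 2] by (auto elim!: eventually_mono)
          qed
          then show ?thesis ..
        qed (simp add: q2)
        from mgf_interpolate_bounded[OF P q special_mgf_le[OF P law'[OF j]] this zero_le_one, of w]
        show ?thesis by simp
      qed
    qed (use n in auto)
    also have "C * 1 * (\<Sum>k<length ps. real (replicate (length ps) n ! k)) powr (1 / r) *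
              (\<Prod>k<length ps. real (replicate (length ps) n ! k) powr dim_exponent (ps ! k)) = c\<^sub>2 * ?E n"
      using n by (simp add: c\<^sub>2_def powr_mult powr_add powr_sum)
    finally show "orlicz_norm r P (sup_multilinear K ps \<gamma> (\<lambda>_. 1) (replicate (length ps) n)) \<le> ennreal (c\<^sub>2 * ?E n)" .
  qed
  show "\<exists>c\<^sub>1>0. \<exists>c\<^sub>2>0.
        \<forall>(P :: 'a measure) \<gamma> K n.
          prob_space P \<longrightarrow>
          K = \<real> \<or> K = UNIV \<longrightarrow>
          prob_space.indep_vars P (\<lambda>_. borel) \<gamma> all_multi_indices \<longrightarrow>
          (\<forall>j\<in>all_multi_indices. rademacher P (\<gamma> j) \<or> steinhaus P (\<gamma> j) \<or>
             (r_exponent ps = 2 \<and> normal_gaussian P (\<gamma> j))) \<longrightarrow>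
          1 \<le> n \<longrightarrow>
          ennreal (c\<^sub>1 * real n powr (1 / r_exponent ps + (\<Sum>k<length ps. dim_exponent (ps ! k))))
            \<le> orlicz_norm (r_exponent ps) P
                (sup_multilinear K ps \<gamma> (\<lambda>_. 1) (replicate (length ps) n)) \<and>
          orlicz_norm (r_exponent ps) P
              (sup_multilinear K ps \<gamma> (\<lambda>_. 1) (replicate (length ps) n))
            \<le> ennreal (c\<^sub>2 * real n powr (1 / r_exponent ps + (\<Sum>k<length ps. dim_exponent (ps ! k))))"
    unfolding r_def[symmetric]
    by (intro exI[of _ c\<^sub>1] exI[of _ c\<^sub>2] conjI[OF c\<^sub>1] conjI[OF c\<^sub>2] allI impI main)
qed

end
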